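(* Let $G$ be a finite soluble group with all Sylow subgroups of nilpotency class at most two. If the Sylow $2$-subgroups of $G$ are isomorphic to the quaternion group $Q_8$ of order $8$, then $G$ is an IYB-group.
   Context: A set-theoretic solution of the Yang–Baxter equation is a pair $(X,r)$ with $X$ a nonempty set and $r:X\times X\to X\times X$ a map such that $r_{12}r_{23}r_{12}=r_{23}r_{12}r_{23}$, where $r_{12}=r\times \mathrm{Id}_X$ and $r_{23}=\mathrm{Id}_X\times r$ are maps $X^3\to X^3$. Write $r(x,y)=(f_x(y),g_y(x))$. The solution is involutive if $r^2=\mathrm{id}_{X\times X}$, and non-degenerate if $f_x$ and $g_y$ are bijections of $X$ for all $x,y\in X$. The permutation group of an involutive non-degenerate solution $(X,r)$ is $\mathcal{G}(X,r)=\langle f_x\mid x\in X\rangle\le \mathrm{Sym}(X)$. A group $G$ is an involutive Yang–Baxter group (IYB-group) if $G\cong\mathcal{G}(X,r)$ for some involutive non-degenerate set-theoretic solution $(X,r)$ of the Yang–Baxter equation. *)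

theory Defs
  imports
    "HOL-Algebra.Bij"
    "HOL-Algebra.Elementary_Groups"
    "HOL-Algebra.Solvable_Groups"
    "HOL-Algebra.Sylow"
begin

section \<open>Set-theoretic solutions of the Yang--Baxter equation\<close>

definition r12 :: "('x \<times> 'x \<Rightarrow> 'x \<times> 'x) \<Rightarrow> 'x \<times> 'x \<times> 'x \<Rightarrow> 'x \<times> 'x \<times> 'x" where
  "r12 r = (\<lambda>(x, y, z). let (u, v) = r (x, y) in (u, v, z))"

definition r23 :: "('x \<times> 'x \<Rightarrow> 'x \<times> 'x) \<Rightarrow> 'x \<times> 'x \<times> 'x \<Rightarrow> 'x \<times> 'x \<times> 'x" where
  "r23 r = (\<lambda>(x, y, z). (x, r (y, z)))"

definition ybe_solution :: "'x set \<Rightarrow> ('x \<times> 'x \<Rightarrow> 'x \<times> 'x) \<Rightarrow> bool" where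
  "ybe_solution X r \<longleftrightarrow>
     X \<noteq> {} \<and> r \<in> X \<times> X \<rightarrow> X \<times> X \<and>
     (\<forall>t \<in> X \<times> X \<times> X. r12 r (r23 r (r12 r t)) = r23 r (r12 r (r23 r t)))"

definition involutive_solution :: "'x set \<Rightarrow> ('x \<times> 'x \<Rightarrow> 'x \<times> 'x) \<Rightarrow> bool" where
  "involutive_solution X r \<longleftrightarrow> (\<forall>p \<in> X \<times> X. r (r p) = p)"

text \<open>The two component maps, \<open>r (x, y) = (left_map r x y, right_map r y x)\<close>.\<close>

definition left_map :: "('x \<times> 'x \<Rightarrow> 'x \<times> 'x) \<Rightarrow> 'x \<Rightarrow> 'x \<Rightarrow> 'x" where
  "left_map r x y = fst (r (x, y))"

definition right_map :: "('x \<times> 'x \<Rightarrow> 'x \<times> 'x) \<Rightarrow> 'x \<Rightarrow> 'x \<Rightarrow> 'x" where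
  "right_map r y x = snd (r (x, y))"

definition nondegenerate_solution :: "'x set \<Rightarrow> ('x \<times> 'x \<Rightarrow> 'x \<times> 'x) \<Rightarrow> bool" where
  "nondegenerate_solution X r \<longleftrightarrow>
     (\<forall>x \<in> X. bij_betw (left_map r x) X X) \<and> (\<forall>y \<in> X. bij_betw (right_map r y) X X)"

text \<open>Elements of \<^const>\<open>BijGroup\<close> are extensional functions, hence the restriction.\<close>

definition permutation_group :: "'x set \<Rightarrow> ('x \<times> 'x \<Rightarrow> 'x \<times> 'x) \<Rightarrow> ('x \<Rightarrow> 'x) monoid" where
  "permutation_group X r =
     subgroup_generated (BijGroup X) ((\<lambda>x. restrict (left_map r x) X) ` X)"

text \<open>
  HOL cannot quantify existentially over types, so the type of the points of \<open>X\<close> is a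
  parameter. For finite \<open>G\<close> the choice \<open>nat\<close> is no restriction: a finite
  permutation group of an involutive non-degenerate solution carries the structure of a
  finite left brace, from which one obtains a solution on a finite set (two copies of
  the brace) with the same permutation group.
\<close>

definition iyb_group :: "'x itself \<Rightarrow> ('a, 'b) monoid_scheme \<Rightarrow> bool" where
  "iyb_group _ G \<longleftrightarrow>
     (\<exists>(X :: 'x set) r. ybe_solution X r \<and> involutive_solution X r \<and>
        nondegenerate_solution X r \<and> G \<cong> permutation_group X r)"


section \<open>Sylow subgroups and nilpotency class\<close>

text \<open>Only meaningful for finite \<open>G\<close>, since \<^const>\<open>order\<close> is 0 otherwise.\<close>

definition sylow_subgroup :: "('a, 'b) monoid_scheme \<Rightarrow> nat \<Rightarrow> 'a set \<Rightarrow> bool" where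
  "sylow_subgroup G p P \<longleftrightarrow>
     prime p \<and> subgroup P G \<and> card P = p ^ multiplicity p (order G)"

definition commutator_subgroup :: "('a, 'b) monoid_scheme \<Rightarrow> 'a set \<Rightarrow> 'a set \<Rightarrow> 'a set" where
  "commutator_subgroup G H K =
     generate G (\<Union>h \<in> H. \<Union>k \<in> K. {h \<otimes>\<^bsub>G\<^esub> k \<otimes>\<^bsub>G\<^esub> inv\<^bsub>G\<^esub> h \<otimes>\<^bsub>G\<^esub> inv\<^bsub>G\<^esub> k})"

lemma commutator_subgroup_same: "commutator_subgroup G H H = derived G H"
  by (simp add: commutator_subgroup_def derived_def)

text \<open>Indexed from 0: \<open>lower_central G n\<close> is the term usually written \<open>\<gamma>\<^sub>n\<^sub>+\<^sub>1(G)\<close>.\<close>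

primrec lower_central :: "('a, 'b) monoid_scheme \<Rightarrow> nat \<Rightarrow> 'a set" where
  "lower_central G 0 = carrier G"
| "lower_central G (Suc n) = commutator_subgroup G (lower_central G n) (carrier G)"

definition nilpotent_class_le :: "('a, 'b) monoid_scheme \<Rightarrow> nat \<Rightarrow> bool" where
  "nilpotent_class_le G c \<longleftrightarrow> lower_central G c = {\<one>\<^bsub>G\<^esub>}"


section \<open>The quaternion group of order 8\<close>

text \<open>
  \<open>(a, b, c, d)\<close> stands for the quaternion \<open>a + b i + c j + d k\<close>, multiplied by
  Hamilton's rule; the carrier is \<open>{\<plusminus>1, \<plusminus>i, \<plusminus>j, \<plusminus>k}\<close>.
\<close>

type_synonym int_quaternion = "int \<times> int \<times> int \<times> int"

fun hamilton_mult :: "int_quaternion \<Rightarrow> int_quaternion \<Rightarrow> int_quaternion" where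
  "hamilton_mult (a, b, c, d) (a', b', c', d') =
     (a * a' - b * b' - c * c' - d * d',
      a * b' + b * a' + c * d' - d * c',
      a * c' - b * d' + c * a' + d * b',
      a * d' + b * c' - c * b' + d * a')"

definition quaternion_group :: "int_quaternion monoid" where
  "quaternion_group =
     \<lparr>carrier = {(1, 0, 0, 0), (-1, 0, 0, 0), (0, 1, 0, 0), (0, -1, 0, 0),
                 (0, 0, 1, 0), (0, 0, -1, 0), (0, 0, 0, 1), (0, 0, 0, -1)},
      monoid.mult = hamilton_mult,
      one = (1, 0, 0, 0)\<rparr>"

lemma order_quaternion_group: "order quaternion_group = 8"
  by (simp add: order_def quaternion_group_def)

lemma hamilton_mult_assoc:
  "hamilton_mult (hamilton_mult x y) z = hamilton_mult x (hamilton_mult y z)"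
  by (cases x; cases y; cases z) (simp add: algebra_simps)

lemma group_quaternion_group: "group quaternion_group"
proof (rule groupI)
  fix x assume "x \<in> carrier quaternion_group"
  then show "\<exists>y\<in>carrier quaternion_group. y \<otimes>\<^bsub>quaternion_group\<^esub> x = \<one>\<^bsub>quaternion_group\<^esub>"
    by (auto simp: quaternion_group_def)
qed (auto simp: quaternion_group_def hamilton_mult_assoc)

end

theory Submission
  imports Defs "HOL-Library.Nat_Bijection" "HOL-Algebra.Group_Action" "HOL-Algebra.Multiplicative_Group"
begin


text \<open>
  A finite group \<open>G\<close> is an IYB-group as soon as there is a \<open>G\<close>-module \<open>M\<close> and a bijective
  1-cocycle \<open>\<pi>: G \<rightarrow> M\<close>: through \<open>\<pi>\<close> the group becomes the multiplicative group of a left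
  brace, and \<open>bijective_cocycle_gset\<close> turns the brace into a solution whose permutation group
  is \<open>G\<close> itself. Bijectivity can be obtained one prime at a time. If for every prime \<open>p\<close> there
  is a cocycle of \<open>G\<close> onto a module of order \<open>|G|\<^sub>p\<close>, the elements where it vanishes form a
  subgroup of order prime to \<open>p\<close>; the product of all these cocycles therefore vanishes only at
  \<open>1\<close>, hence is injective, and it is bijective because its target has order \<open>|G|\<close>
  (\<open>bijective_cocycle_from_prime_parts\<close>).

  Fix \<open>p\<close> and a Sylow \<open>p\<close>-subgroup \<open>P\<close>. The cocycle is found by induction on \<open>|G|\<close>
  (\<open>prime_part_cocycle\<close>). A nontrivial normal subgroup of order prime to \<open>p\<close> can be factored
  out, so assume that there is none, and let \<open>U\<close> be the largest normal \<open>p\<close>-subgroup. Let \<open>C\<close> be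
  the normal subgroup of all \<open>g\<close> with \<open>[U,g] \<subseteq> Z(U)\<close>. Since \<open>P\<close> has class at most two and
  contains \<open>U\<close>, it lies in \<open>C\<close>.

  If \<open>C = U\<close>, then \<open>P = U\<close> is normal and has a complement \<open>H\<close>. It remains to find on \<open>P\<close> a left
  brace structure which \<open>H\<close> preserves. This is done by perturbing the product of \<open>P\<close> with a
  bimultiplicative form with central values (\<open>central_form\<close>): the trivial form if \<open>P\<close> is abelian,
  the square root of the commutator if \<open>p\<close> is odd (the Baer correspondence), and for \<open>Q\<^sub>8\<close> the
  coboundary of a sign function invariant under \<open>H\<close>, which exists because \<open>|H|\<close> is odd.

  If \<open>C \<noteq> U\<close>, solubility gives a normal subgroup \<open>T\<close> with \<open>U < T \<subseteq> C\<close> and \<open>T/U\<close> a \<open>q\<close>-group, where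
  \<open>q \<noteq> p\<close>. For a Sylow \<open>q\<close>-subgroup \<open>Q\<close> of \<open>T\<close> the Frattini argument gives \<open>G = U N(Q)\<close>. As the
  commutators \<open>[u,y]\<close> with \<open>u \<in> U\<close>, \<open>y \<in> Q\<close> are central in \<open>U\<close>, the map \<open>\<nu>(u) = \<Prod>\<^sub>y [u,y]\<close> is a
  homomorphism on \<open>U\<close>, and \<open>u h \<mapsto> \<nu>(u)\<close> is a cocycle on \<open>G\<close> whose restriction to the normal
  subgroup \<open>A = \<nu>(U)\<close> is a permutation of \<open>A\<close> (\<open>central_commutator_cocycle\<close>). Here \<open>A\<close> is not
  trivial, for otherwise \<open>Q\<close> would be a nontrivial normal subgroup of order prime to \<open>p\<close>. So the
  induction hypothesis applies to \<open>G/A\<close>, and its cocycle combines with the one onto \<open>A\<close>. The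
  induction thus meets the quotients of \<open>P\<close>, which is why the assumption on \<open>P\<close> is first
  weakened to a condition stable under images (\<open>brace_type\<close>).
\<close>

section \<open>Cocycles with values in a module\<close>

locale cocycle = G?: group G + M?: comm_group M
  for G :: "('g, 'b) monoid_scheme" (structure) and M :: "('m, 'c) monoid_scheme" +
  fixes act :: "'g \<Rightarrow> 'm \<Rightarrow> 'm" and \<pi> :: "'g \<Rightarrow> 'm"
  assumes act_hom: "g \<in> carrier G \<Longrightarrow> act g \<in> hom M M"
    and act_mult: "\<lbrakk>g \<in> carrier G; h \<in> carrier G; m \<in> carrier M\<rbrakk> \<Longrightarrow> act (g \<otimes> h) m = act g (act h m)"
    and act_one: "m \<in> carrier M \<Longrightarrow> act \<one> m = m"
    and cocycle_closed: "g \<in> carrier G \<Longrightarrow> \<pi> g \<in> carrier M"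
    and cocycle_mult: "\<lbrakk>g \<in> carrier G; h \<in> carrier G\<rbrakk> \<Longrightarrow> \<pi> (g \<otimes> h) = \<pi> g \<otimes>\<^bsub>M\<^esub> act g (\<pi> h)"
begin

lemma act_closed [simp]: "\<lbrakk>g \<in> carrier G; m \<in> carrier M\<rbrakk> \<Longrightarrow> act g m \<in> carrier M"
  using act_hom by (auto simp: hom_def)

lemma act_distrib:
  "\<lbrakk>g \<in> carrier G; m \<in> carrier M; n \<in> carrier M\<rbrakk> \<Longrightarrow> act g (m \<otimes>\<^bsub>M\<^esub> n) = act g m \<otimes>\<^bsub>M\<^esub> act g n"
  using act_hom by (auto simp: hom_def)

lemma act_unit [simp]: "g \<in> carrier G \<Longrightarrow> act g \<one>\<^bsub>M\<^esub> = \<one>\<^bsub>M\<^esub>"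
  using act_hom[of g] M.is_group by (meson hom_one)

lemma act_inverse_cancel:
  "\<lbrakk>g \<in> carrier G; m \<in> carrier M\<rbrakk> \<Longrightarrow> act (inv g) (act g m) = m"
  "\<lbrakk>g \<in> carrier G; m \<in> carrier M\<rbrakk> \<Longrightarrow> act g (act (inv g) m) = m"
  by (simp_all add: act_one flip: act_mult)

lemma act_inj: "\<lbrakk>g \<in> carrier G; m \<in> carrier M; n \<in> carrier M; act g m = act g n\<rbrakk> \<Longrightarrow> m = n"
  by (metis act_inverse_cancel(1))

lemma cocycle_one: "\<pi> \<one> = \<one>\<^bsub>M\<^esub>"
proof -
  have "\<pi> \<one> = \<pi> \<one> \<otimes>\<^bsub>M\<^esub> \<pi> \<one>"
    using cocycle_mult[of \<one> \<one>] by (simp add: act_one cocycle_closed)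
  then show ?thesis
    using M.l_cancel_one[of "\<pi> \<one>" "\<pi> \<one>"] by (simp add: cocycle_closed)
qed

lemma cocycle_inv: "g \<in> carrier G \<Longrightarrow> act g (\<pi> (inv g)) = inv\<^bsub>M\<^esub> \<pi> g"
  using cocycle_mult[of g "inv g"] cocycle_one M.inv_equality[of "act g (\<pi> (inv g))" "\<pi> g"]
  by (metis G.inv_closed G.r_inv M.inv_comm act_closed cocycle_closed M.inv_equality)

lemma stabilizer_subgroup: "subgroup {g \<in> carrier G. \<pi> g = \<one>\<^bsub>M\<^esub>} G"
proof (rule G.subgroupI)
  fix a assume a: "a \<in> {g \<in> carrier G. \<pi> g = \<one>\<^bsub>M\<^esub>}"
  then have "act a (\<pi> (inv a)) = act a \<one>\<^bsub>M\<^esub>"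
    using cocycle_inv[of a] by simp
  then have "\<pi> (inv a) = \<one>\<^bsub>M\<^esub>"
    by (rule act_inj[rotated 3]) (use a in \<open>auto simp: cocycle_closed\<close>)
  with a show "inv a \<in> {g \<in> carrier G. \<pi> g = \<one>\<^bsub>M\<^esub>}" by simp
qed (auto simp: cocycle_mult cocycle_one)

text \<open>
  The cocycle identity for \<open>h = g \<otimes> (inv g \<otimes> h)\<close>. All fibres are therefore left cosets of the
  subgroup where the cocycle vanishes, so they have the same size.
\<close>

lemma same_value_iff:
  assumes "g \<in> carrier G" "h \<in> carrier G"
  shows "\<pi> g = \<pi> h \<longleftrightarrow> \<pi> (inv g \<otimes> h) = \<one>\<^bsub>M\<^esub>"
proof -
  have h: "h = g \<otimes> (inv g \<otimes> h)"
    using assms by (simp flip: G.m_assoc)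
  have "\<pi> h = \<pi> g \<otimes>\<^bsub>M\<^esub> act g (\<pi> (inv g \<otimes> h))"
    using assms by (subst h) (rule cocycle_mult, auto)
  then have "\<pi> g = \<pi> h \<longleftrightarrow> act g (\<pi> (inv g \<otimes> h)) = \<one>\<^bsub>M\<^esub>"
    using assms M.r_cancel_one' [of "\<pi> g" "act g (\<pi> (inv g \<otimes> h))"] by (simp add: cocycle_closed)
  also have "\<dots> \<longleftrightarrow> \<pi> (inv g \<otimes> h) = \<one>\<^bsub>M\<^esub>"
    using act_inj[of g "\<pi> (inv g \<otimes> h)" "\<one>\<^bsub>M\<^esub>"] assms by (auto simp: cocycle_closed)
  finally show ?thesis .
qed

end

section \<open>From a bijective cocycle to a solution\<close>

text \<open>
  The solution lives on a faithful \<open>G\<close>-set \<open>X\<close> with an equivariant map \<open>\<phi>\<close> onto the module. The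
  brace itself, with \<open>\<phi>\<close> the identity, would do for the Yang--Baxter equation, but \<open>G\<close> need not
  act faithfully on it; keeping \<open>X\<close> separate from the module makes the permutation group all
  of \<open>G\<close> instead of the quotient by the socle of the brace.
\<close>

locale bijective_cocycle_gset = cocycle G M act \<pi>
  for G :: "('g, 'b) monoid_scheme" (structure) and M :: "('m, 'c) monoid_scheme" and act \<pi> +
  fixes X :: "'x set" and \<sigma> :: "'g \<Rightarrow> 'x \<Rightarrow> 'x" and \<phi> :: "'x \<Rightarrow> 'm"
  assumes bij: "bij_betw \<pi> (carrier G) (carrier M)"
    and finite_points: "finite X"
    and \<sigma>_closed [simp]: "\<lbrakk>g \<in> carrier G; x \<in> X\<rbrakk> \<Longrightarrow> \<sigma> g x \<in> X"
    and \<sigma>_mult: "\<lbrakk>g \<in> carrier G; h \<in> carrier G; x \<in> X\<rbrakk> \<Longrightarrow> \<sigma> (g \<otimes> h) x = \<sigma> g (\<sigma> h x)"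
    and \<sigma>_one: "x \<in> X \<Longrightarrow> \<sigma> \<one> x = x"
    and \<sigma>_faithful: "\<lbrakk>g \<in> carrier G; \<And>x. x \<in> X \<Longrightarrow> \<sigma> g x = x\<rbrakk> \<Longrightarrow> g = \<one>"
    and \<phi>_onto: "\<phi> ` X = carrier M"
    and \<phi>_equivariant: "\<lbrakk>g \<in> carrier G; x \<in> X\<rbrakk> \<Longrightarrow> \<phi> (\<sigma> g x) = act g (\<phi> x)"
begin

definition label :: "'x \<Rightarrow> 'g" where "label x = the_inv_into (carrier G) \<pi> (\<phi> x)"

definition sol :: "'x \<times> 'x \<Rightarrow> 'x \<times> 'x" where
  "sol = (\<lambda>(x, y). let u = \<sigma> (label x) y in (u, \<sigma> (inv (label u)) x))"

lemma \<phi>_closed [simp]: "x \<in> X \<Longrightarrow> \<phi> x \<in> carrier M"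
  using \<phi>_onto by auto

lemma label_closed [simp]: "x \<in> X \<Longrightarrow> label x \<in> carrier G"
  unfolding label_def using bij \<phi>_closed
  by (metis bij_betw_def order_refl the_inv_into_into)

lemma \<pi>_label [simp]: "x \<in> X \<Longrightarrow> \<pi> (label x) = \<phi> x"
  unfolding label_def using bij \<phi>_closed
  by (metis bij_betw_def f_the_inv_into_f)

lemma \<pi>_eqD: "\<lbrakk>\<pi> g = \<pi> h; g \<in> carrier G; h \<in> carrier G\<rbrakk> \<Longrightarrow> g = h"
  using bij by (auto simp: bij_betw_def inj_on_def)

lemma \<sigma>_cancel [simp]:
  "\<lbrakk>g \<in> carrier G; x \<in> X\<rbrakk> \<Longrightarrow> \<sigma> (inv g) (\<sigma> g x) = x"
  "\<lbrakk>g \<in> carrier G; x \<in> X\<rbrakk> \<Longrightarrow> \<sigma> g (\<sigma> (inv g) x) = x"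
  by (simp_all add: \<sigma>_one flip: \<sigma>_mult)

lemma \<sigma>_bij: "g \<in> carrier G \<Longrightarrow> bij_betw (\<sigma> g) X X"
  by (rule bij_betw_byWitness[where f' = "\<sigma> (inv g)"]) auto

text \<open>
  Everything about the solution rests on this identity: the product of the two labels corresponds
  to a sum in the module, so it is symmetric in \<open>x\<close> and \<open>y\<close>.
\<close>

lemma label_mult:
  assumes "x \<in> X" "y \<in> X"
  shows "\<pi> (label x \<otimes> label (\<sigma> (inv (label x)) y)) = \<phi> x \<otimes>\<^bsub>M\<^esub> \<phi> y"
  using assms by (simp add: cocycle_mult \<phi>_equivariant act_inverse_cancel)

lemma label_swap:
  assumes "x \<in> X" "y \<in> X"
  shows "label x \<otimes> label (\<sigma> (inv (label x)) y) = label y \<otimes> label (\<sigma> (inv (label y)) x)"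
  by (rule \<pi>_eqD) (use assms in \<open>simp_all add: label_mult M.m_comm\<close>)

lemma label_product:
  assumes "x \<in> X" "y \<in> X"
  shows "label x \<otimes> label y = label (\<sigma> (label x) y) \<otimes> label (\<sigma> (inv (label (\<sigma> (label x) y))) x)"
  using label_swap[of x "\<sigma> (label x) y"] assms by simp

lemma sol_involutive: "p \<in> X \<times> X \<Longrightarrow> sol (sol p) = p"
  by (auto simp: sol_def Let_def)

text \<open>
  Both sides have first component \<open>t\<close>, the image of \<open>z\<close> under \<open>label x \<otimes> label y\<close>, since this product
  equals \<open>label u \<otimes> label v\<close>. The second components agree by the same identity for \<open>x\<close> and \<open>p\<close>. The
  third are images of \<open>x\<close> under the inverses of \<open>label u \<otimes> label v'\<close> and \<open>label t \<otimes> label w\<close>, which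
  are equal by \<open>label_swap\<close> because both correspond to the sum of \<open>\<phi> u\<close> and \<open>\<phi> t\<close>.
\<close>

lemma sol_ybe:
  assumes x: "x \<in> X" and y: "y \<in> X" and z: "z \<in> X"
  shows "r12 sol (r23 sol (r12 sol (x, y, z))) = r23 sol (r12 sol (r23 sol (x, y, z)))"
proof -
  define u where "u = \<sigma> (label x) y"
  define v where "v = \<sigma> (inv (label u)) x"
  define v' where "v' = \<sigma> (label v) z"
  define p where "p = \<sigma> (label y) z"
  define q where "q = \<sigma> (inv (label p)) y"
  define t where "t = \<sigma> (label x) p"
  define s where "s = \<sigma> (inv (label t)) x"
  define w where "w = \<sigma> (label s) q"
  have X [simp]: "u \<in> X" "v \<in> X" "v' \<in> X" "p \<in> X" "q \<in> X" "t \<in> X" "s \<in> X" "w \<in> X"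
    using x y z by (simp_all add: u_def v_def v'_def p_def q_def t_def s_def w_def)
  have xy: "label x \<otimes> label y = label u \<otimes> label v"
    using label_product[OF x y] by (simp add: u_def v_def)
  have xp: "label x \<otimes> label p = label t \<otimes> label s"
    using label_product[OF x, of p] by (simp add: t_def s_def)
  have first: "\<sigma> (label u) v' = t"
  proof -
    have "\<sigma> (label u) v' = \<sigma> (label u \<otimes> label v) z"
      using z by (simp add: v'_def \<sigma>_mult)
    also have "\<dots> = t"
      using x y z by (simp add: \<sigma>_mult p_def t_def flip: xy)
    finally show ?thesis .
  qed
  then have v'_eq: "v' = \<sigma> (inv (label u)) t"
    using \<sigma>_cancel(1)[of "label u" v'] by simp
  have second: "\<sigma> (inv (label t)) u = w"
  proof -
    have "\<sigma> (label t) w = \<sigma> (label t \<otimes> label s) q"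
      by (simp add: w_def \<sigma>_mult)
    also have "\<dots> = \<sigma> (label x) (\<sigma> (label p) q)"
      using x by (simp add: \<sigma>_mult flip: xp)
    also have "\<dots> = u"
      using y by (simp add: q_def u_def)
    finally show ?thesis
      using \<sigma>_cancel(1)[of "label t" w] by simp
  qed
  have third: "\<sigma> (inv (label v')) v = \<sigma> (inv (label w)) s"
  proof -
    have "label u \<otimes> label v' = label t \<otimes> label w"
      using label_swap[of u t] v'_eq second by simp
    then have "inv (label v') \<otimes> inv (label u) = inv (label w) \<otimes> inv (label t)"
      by (simp flip: G.inv_mult_group)
    then show ?thesis
      using x by (simp add: v_def s_def flip: \<sigma>_mult)
  qed
  have "r12 sol (r23 sol (r12 sol (x, y, z))) = (t, w, \<sigma> (inv (label v')) v)"
    by (simp add: r12_def r23_def sol_def Let_def first second flip: u_def v_def v'_def)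
  moreover have "r23 sol (r12 sol (r23 sol (x, y, z))) = (t, w, \<sigma> (inv (label w)) s)"
    by (simp add: r12_def r23_def sol_def Let_def flip: p_def q_def t_def s_def w_def)
  ultimately show ?thesis
    by (simp add: third)
qed

text \<open>
  Let \<open>v\<close> be the value of the right map at \<open>x\<close>. Writing \<open>w = label y \<otimes> inv (label v)\<close>, the
  product formula for labels reads \<open>label u = label x \<otimes> w\<close> with \<open>u = \<sigma> (label x) y\<close>. Applying \<open>\<pi>\<close>
  expresses \<open>\<pi> (inv (label x))\<close> through \<open>y\<close> and \<open>w\<close> alone, so \<open>y\<close> and \<open>v\<close> determine the label of
  \<open>x\<close>, then \<open>u\<close>, and then \<open>x = \<sigma> (label u) v\<close>.
\<close>

lemma right_map_inj:
  assumes y: "y \<in> X"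
  shows "inj_on (right_map sol y) X"
proof (rule inj_onI)
  fix x x' assume x: "x \<in> X" and x': "x' \<in> X" and eq: "right_map sol y x = right_map sol y x'"
  define v where "v = right_map sol y x"
  define w where "w = label y \<otimes> inv (label v)"
  have key: "\<pi> (inv (label a)) = inv\<^bsub>M\<^esub> (\<phi> y \<otimes>\<^bsub>M\<^esub> inv\<^bsub>M\<^esub> \<pi> w) \<and> a = \<sigma> (label (\<sigma> (label a) y)) v"
    if a: "a \<in> X" and va: "v = right_map sol y a" for a
  proof -
    define u where "u = \<sigma> (label a) y"
    have u: "u \<in> X" using a y by (simp add: u_def)
    have v_eq: "v = \<sigma> (inv (label u)) a"
      using va by (simp add: right_map_def sol_def Let_def u_def)
    then have v: "v \<in> X" using a u by simp
    have "label a \<otimes> label y = label u \<otimes> label v"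
      using label_product[OF a y] by (simp add: u_def v_eq)
    then have "label u = label a \<otimes> w"
      using a y u v by (metis G.inv_closed G.inv_solve_right G.m_assoc G.m_closed label_closed w_def)
    moreover have w: "w \<in> carrier G" using y v by (simp add: w_def)
    ultimately have "\<pi> (label u) = \<pi> (label a) \<otimes>\<^bsub>M\<^esub> act (label a) (\<pi> w)"
      using a cocycle_mult by simp
    then have "act (label a) (\<phi> y) = \<pi> (label a) \<otimes>\<^bsub>M\<^esub> act (label a) (\<pi> w)"
      using a y u by (simp add: u_def \<phi>_equivariant)
    also have "\<pi> (label a) = inv\<^bsub>M\<^esub> act (label a) (\<pi> (inv (label a)))"
      using a by (simp add: cocycle_inv)
    finally have "act (label a) (\<pi> (inv (label a)) \<otimes>\<^bsub>M\<^esub> \<phi> y) = act (label a) (\<pi> w)"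
      using a y w by (simp add: act_distrib cocycle_closed M.inv_solve_left flip: M.m_assoc)
    then have "\<pi> (inv (label a)) \<otimes>\<^bsub>M\<^esub> \<phi> y = \<pi> w"
      by (rule act_inj[rotated 3]) (use a y w in \<open>auto simp: cocycle_closed\<close>)
    then have "\<pi> (inv (label a)) = \<pi> w \<otimes>\<^bsub>M\<^esub> inv\<^bsub>M\<^esub> \<phi> y"
      using a y w by (simp add: M.inv_solve_right cocycle_closed)
    then have "\<pi> (inv (label a)) = inv\<^bsub>M\<^esub> (\<phi> y \<otimes>\<^bsub>M\<^esub> inv\<^bsub>M\<^esub> \<pi> w)"
      using y w by (simp add: M.inv_mult_group cocycle_closed)
    moreover have "a = \<sigma> (label u) v"
      using a u by (simp add: v_eq)
    ultimately show ?thesis unfolding u_def by blast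
  qed
  have "\<pi> (inv (label x)) = \<pi> (inv (label x'))"
    using key[OF x] key[OF x'] eq by (simp add: v_def)
  then have "inv (label x) = inv (label x')"
    by (rule \<pi>_eqD) (use x x' in auto)
  then have "label x = label x'"
    using x x' by (metis G.inv_inv label_closed)
  then show "x = x'"
    using key[OF x] key[OF x'] eq by (metis v_def)
qed

lemma sol_closed: "sol \<in> X \<times> X \<rightarrow> X \<times> X"
  by (auto simp: sol_def Let_def)

lemma left_map_sol: "left_map sol x = \<sigma> (label x)"
  by (simp add: fun_eq_iff left_map_def sol_def Let_def)

lemma label_onto: "label ` X = carrier G"
proof
  show "carrier G \<subseteq> label ` X"
  proof
    fix g assume g: "g \<in> carrier G"
    then obtain x where x: "x \<in> X" "\<phi> x = \<pi> g"
      using \<phi>_onto cocycle_closed by (metis imageE)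
    have "label x = g"
      by (rule \<pi>_eqD) (use x g in auto)
    with x show "g \<in> label ` X" by auto
  qed
qed auto

lemma points_nonempty: "X \<noteq> {}"
  using \<phi>_onto M.one_closed by auto

lemma permutation_group_iso: "G \<cong> permutation_group X sol"
proof -
  interpret B: group "BijGroup X" by (rule group_BijGroup)
  define \<theta> where "\<theta> g = restrict (\<sigma> g) X" for g
  have \<theta>_Bij: "\<theta> g \<in> Bij X" if "g \<in> carrier G" for g
    using \<sigma>_bij[OF that] by (auto simp: \<theta>_def Bij_def cong: bij_betw_cong)
  have \<theta>_hom: "\<theta> \<in> hom G (BijGroup X)"
  proof (rule homI)
    fix g h assume gh: "g \<in> carrier G" "h \<in> carrier G"
    then show "\<theta> (g \<otimes> h) = \<theta> g \<otimes>\<^bsub>BijGroup X\<^esub> \<theta> h"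
      using \<theta>_Bij
      by (auto simp: BijGroup_def compose_def \<theta>_def \<sigma>_mult fun_eq_iff)
  qed (simp add: BijGroup_def \<theta>_Bij)
  interpret \<theta>: group_hom G "BijGroup X" \<theta>
    by unfold_locales (rule \<theta>_hom)
  have inj: "inj_on \<theta> (carrier G)"
  proof (rule inj_onI)
    fix g h assume g: "g \<in> carrier G" and h: "h \<in> carrier G" and eq: "\<theta> g = \<theta> h"
    have "inv g \<otimes> h = \<one>"
    proof (rule \<sigma>_faithful)
      fix x assume x: "x \<in> X"
      then have "\<sigma> h x = \<sigma> g x"
        using eq by (metis \<theta>_def restrict_apply')
      then show "\<sigma> (inv g \<otimes> h) x = x"
        using g h x by (simp add: \<sigma>_mult)
    qed (use g h in auto)
    then show "g = h"
      using g h by (metis G.inv_equality G.inv_inv G.inv_closed)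
  qed
  have sub: "subgroup (\<theta> ` carrier G) (BijGroup X)"
    by (rule \<theta>.img_is_subgroup)
  have gens: "(\<lambda>x. restrict (left_map sol x) X) ` X = \<theta> ` carrier G"
    by (simp add: left_map_sol \<theta>_def label_onto[symmetric] image_image)
  have "carrier (permutation_group X sol) = \<theta> ` carrier G"
    unfolding permutation_group_def gens
    by (rule subgroup.carrier_subgroup_generated_subgroup[OF sub])
  then have "\<theta> \<in> iso G (permutation_group X sol)"
    using inj \<theta>_hom
    by (auto simp: iso_def bij_betw_def permutation_group_def hom_def)
  then show ?thesis
    by (auto simp: is_iso_def)
qed

lemma iyb: "iyb_group TYPE('x) G"
proof -
  have "bij_betw (right_map sol y) X X" if "y \<in> X" for y
  proof -
    have "right_map sol y ` X \<subseteq> X"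
      using that sol_closed by (auto simp: right_map_def sol_def Let_def)
    then show ?thesis
      using right_map_inj[OF that] finite_points
      by (simp add: bij_betw_def endo_inj_surj)
  qed
  then have "nondegenerate_solution X sol"
    by (simp add: nondegenerate_solution_def left_map_sol \<sigma>_bij)
  moreover have "ybe_solution X sol"
    using points_nonempty sol_closed sol_ybe by (auto simp: ybe_solution_def)
  moreover have "involutive_solution X sol"
    using sol_involutive by (simp add: involutive_solution_def)
  ultimately show ?thesis
    using permutation_group_iso by (auto simp: iyb_group_def)
qed

end

text \<open>
  The faithful \<open>G\<close>-set is the module times the regular \<open>G\<close>-set, coded by natural numbers.
\<close>

lemma iyb_group_of_bijective_cocycle:
  fixes G :: "nat monoid" and M :: "nat monoid"
  assumes "cocycle G M act \<pi>" and fin: "finite (carrier G)"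
    and bij: "bij_betw \<pi> (carrier G) (carrier M)"
  shows "iyb_group TYPE(nat) G"
proof -
  interpret cocycle G M act \<pi> by fact
  define \<sigma> where "\<sigma> g (n::nat) = (case prod_decode n of (m, h) \<Rightarrow> prod_encode (act g m, g \<otimes>\<^bsub>G\<^esub> h))" for g n
  define \<phi> where "\<phi> n = fst (prod_decode n)" for n :: nat
  define X where "X = prod_encode ` (carrier M \<times> carrier G)"
  have finM: "finite (carrier M)"
    using bij fin bij_betw_finite by blast
  have "\<phi> ` X = carrier M"
    using G.one_closed by (force simp: \<phi>_def X_def image_image)
  moreover have "g = \<one>\<^bsub>G\<^esub>" if "g \<in> carrier G" and id: "\<And>x. x \<in> X \<Longrightarrow> \<sigma> g x = x" for g
    using id[of "prod_encode (\<one>\<^bsub>M\<^esub>, \<one>\<^bsub>G\<^esub>)"] that(1)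
    by (auto simp: X_def \<sigma>_def dest: inj_onD[OF inj_prod_encode])
  ultimately interpret bijective_cocycle_gset G M act \<pi> X \<sigma> \<phi>
    by unfold_locales
      (use bij fin finM in \<open>auto simp: X_def \<sigma>_def \<phi>_def act_mult act_one G.m_assoc\<close>)
  show ?thesis by (rule iyb)
qed


section \<open>Quotients and counting in finite groups\<close>

text \<open>
  Inductions over quotient groups would change the type of the group at every step. Replacing
  each quotient by an isomorphic group on natural numbers keeps the type fixed.
\<close>

lemma finite_group_iso_nat:
  fixes G :: "('a, 'b) monoid_scheme"
  assumes "group G" and "finite (carrier G)"
  shows "\<exists>(K :: nat monoid) f. group K \<and> f \<in> iso G K"
proof -
  obtain e :: "'a \<Rightarrow> nat" where e: "inj_on e (carrier G)"
    using finite_imp_inj_to_nat_seg[OF assms(2)] by blast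
  define K where "K = \<lparr>carrier = e ` carrier G,
      monoid.mult = (\<lambda>x y. e (the_inv_into (carrier G) e x \<otimes>\<^bsub>G\<^esub> the_inv_into (carrier G) e y)), one = e \<one>\<^bsub>G\<^esub>\<rparr>"
  interpret group G by fact
  have iso: "e \<in> iso G K"
    using e by (auto simp: iso_def hom_def bij_betw_def K_def the_inv_into_f_f)
  have "group K"
    using iso_imp_img_group[OF iso] by (simp add: K_def)
  with iso show ?thesis by blast
qed

lemma (in group_hom) card_subgroup_image:
  assumes "finite (carrier G)" and S: "subgroup S G"
  shows "card S = card (h ` S) * card {x \<in> S. h x = \<one>\<^bsub>H\<^esub>}"
proof -
  interpret S: subgroup S G by fact
  have finS: "finite S"
    using assms(1) S.subset finite_subset by blast
  have fibre: "card {x \<in> S. h x = y} = card {x \<in> S. h x = \<one>\<^bsub>H\<^esub>}" if y: "y \<in> h ` S" for y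
  proof -
    obtain s where s: "s \<in> S" "y = h s" using y by auto
    then have sG: "s \<in> carrier G" by (simp add: S.mem_carrier)
    have "bij_betw (\<lambda>x. s \<otimes> x) {x \<in> S. h x = \<one>\<^bsub>H\<^esub>} {x \<in> S. h x = y}"
      by (rule bij_betw_byWitness[where f' = "\<lambda>x. inv s \<otimes> x"])
        (use s sG in \<open>auto simp: S.mem_carrier simp flip: G.m_assoc\<close>)
    then show ?thesis by (simp add: bij_betw_same_card)
  qed
  have "card S = (\<Sum>y\<in>h ` S. card {x \<in> S. h x = y})"
    using sum.group[OF finS finite_imageI[OF finS], of h h "\<lambda>_. 1 :: nat"] by simp
  also have "\<dots> = card (h ` S) * card {x \<in> S. h x = \<one>\<^bsub>H\<^esub>}"
    using fibre by simp
  finally show ?thesis .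
qed

lemma (in group_hom) card_quotient:
  assumes "finite (carrier G)" and S: "subgroup S G"
    and surj: "h ` carrier G = carrier H"
    and ker: "\<And>x. x \<in> carrier G \<Longrightarrow> h x = \<one>\<^bsub>H\<^esub> \<longleftrightarrow> x \<in> N"
  shows "card S = card (h ` S) * card (S \<inter> N)"
proof -
  have "{x \<in> S. h x = \<one>\<^bsub>H\<^esub>} = S \<inter> N"
    using ker subgroup.mem_carrier[OF S] by auto
  then show ?thesis using card_subgroup_image[OF assms(1) S] by simp
qed

lemma (in group) nat_quotient:
  assumes "N \<lhd> G" and "finite (carrier G)"
  obtains K :: "nat monoid" and \<phi> where
    "group_hom G K \<phi>" "\<phi> ` carrier G = carrier K" "finite (carrier K)"
    "\<And>x. x \<in> carrier G \<Longrightarrow> \<phi> x = \<one>\<^bsub>K\<^esub> \<longleftrightarrow> x \<in> N"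
    "order G = order K * card N"
proof -
  interpret N: normal N G by fact
  let ?Q = "G Mod N"
  have fin: "finite (carrier ?Q)"
    using assms(2) by (simp add: FactGroup_def RCOSETS_def)
  obtain K :: "nat monoid" and f where K: "group K" and f: "f \<in> iso ?Q K"
    using finite_group_iso_nat[OF N.factorgroup_is_group fin] by blast
  interpret Q: group ?Q by (rule N.factorgroup_is_group)
  interpret K: group K by fact
  interpret f: group_hom ?Q K f
    using f by unfold_locales (auto simp: iso_def)
  have hom: "group_hom G K (\<lambda>x. f (N #> x))"
  proof (unfold_locales)
    show "(\<lambda>x. f (N #> x)) \<in> hom G K"
      using Group.hom_compose[OF N.r_coset_hom_Mod f.homh] by (simp add: comp_def)
  qed
  have carQ: "carrier ?Q = (\<lambda>x. N #> x) ` carrier G"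
    by (auto simp: FactGroup_def RCOSETS_def)
  have fb: "bij_betw f (carrier ?Q) (carrier K)"
    using f by (simp add: iso_def)
  have img: "(\<lambda>x. f (N #> x)) ` carrier G = carrier K"
    using fb by (simp add: bij_betw_def carQ image_image)
  have ker: "f (N #> x) = \<one>\<^bsub>K\<^esub> \<longleftrightarrow> x \<in> N" if x: "x \<in> carrier G" for x
  proof -
    have "f (N #> x) = \<one>\<^bsub>K\<^esub> \<longleftrightarrow> f (N #> x) = f \<one>\<^bsub>?Q\<^esub>" by (simp only: f.hom_one)
    also have "\<dots> \<longleftrightarrow> N #> x = \<one>\<^bsub>?Q\<^esub>"
      using fb x Q.one_closed by (auto simp: bij_betw_def inj_on_eq_iff carQ)
    also have "\<dots> \<longleftrightarrow> x \<in> N"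
      using x coset_join1[OF _ x N.subgroup_axioms] coset_join2[OF x N.subgroup_axioms]
        N.subset by (auto simp: FactGroup_def)
    finally show ?thesis .
  qed
  have "finite (carrier K)"
    using img assms(2) by (metis finite_imageI)
  moreover have "order G = order K * card N"
    using group_hom.card_quotient[OF hom assms(2) subgroup_self img ker] img N.subset
    by (simp add: order_def Int_absorb1)
  ultimately show thesis
    using that[OF hom img] ker by blast
qed

lemma (in group) card_subgroup_dvd:
  assumes "finite (carrier G)" "subgroup A G" "subgroup B G" "A \<subseteq> B"
  shows "card A dvd card B"
proof -
  have "subgroup A (G\<lparr>carrier := B\<rparr>)"
    using assms subgroup_incl by blast
  then show ?thesis
    using group.lagrange[OF subgroup.subgroup_is_group[OF assms(3) group_axioms]]
    by (metis dvd_triv_right order_def partial_object.select_convs(1) partial_object.update_convs(1) partial_object.surjective)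
qed

lemma (in group) subgroup_pow_card:
  assumes "finite (carrier G)" "subgroup A G" "x \<in> A"
  shows "x [^] card A = \<one>"
proof -
  have "group (G\<lparr>carrier := A\<rparr>)"
    using assms(2) subgroup.subgroup_is_group group_axioms by blast
  then have "x [^]\<^bsub>G\<lparr>carrier := A\<rparr>\<^esub> card A = \<one>\<^bsub>G\<lparr>carrier := A\<rparr>\<^esub>"
    using group.pow_order_eq_1[of "G\<lparr>carrier := A\<rparr>" x] assms(3) by (simp add: order_def)
  then show ?thesis
    using nat_pow_consistent[of x "card A" A] by simp
qed

lemma (in group) pow_coprime_eq_one:
  assumes x: "x \<in> carrier G" and "x [^] (m::nat) = \<one>" "x [^] (n::nat) = \<one>" and "coprime m n"
  shows "x = \<one>"
  using assms by (metis coprime_common_divisor_nat ord_eq_1 pow_eq_id)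

section \<open>Sylow conjugacy and the Frattini argument\<close>

text \<open>
  Orbits of a \<open>q\<close>-group have \<open>q\<close>-power length, so if all of them were nontrivial, \<open>q\<close> would
  divide the number of points.
\<close>

lemma (in group_action) fixed_point:
  assumes q: "prime q" and ord: "order G = q ^ j" and fin: "finite E" and ndvd: "\<not> q dvd card E"
  shows "\<exists>x\<in>E. \<forall>g\<in>carrier G. \<phi> g x = x"
proof -
  interpret G: group G using group_hom group_hom_def by blast
  have "card E = (\<Sum>orb\<in>orbits G E \<phi>. card orb)"
    using disjoint_sum[OF fin, of "\<lambda>_. 1 :: nat"] by simp
  with ndvd obtain orb where orb: "orb \<in> orbits G E \<phi>" "\<not> q dvd card orb"
    by (metis dvd_sum)
  then obtain x where x: "x \<in> E" "orb = orbit G \<phi> x"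
    by (auto simp: orbits_def)
  have "card orb dvd q ^ j"
    using orbit_stabilizer_theorem[OF x(1)] ord x(2) by (metis dvd_triv_left)
  then obtain i where "card orb = q ^ i"
    using q divides_primepow_nat by blast
  with orb(2) have "card orb = 1"
    by (cases i) auto
  then obtain z where z: "orbit G \<phi> x = {z}"
    using x(2) by (auto simp: card_1_singleton_iff)
  have "\<phi> g x \<in> orbit G \<phi> x" if "g \<in> carrier G" for g
    using that by (auto simp: orbit_def)
  moreover have "x \<in> orbit G \<phi> x"
    using x(1) orbit_refl by blast
  ultimately show ?thesis using x(1) z by auto
qed

text \<open>
  The \<open>q\<close>-group \<open>R\<close> acts on the cosets of \<open>Q\<close>, whose number is prime to \<open>q\<close>; a fixed coset
  conjugates \<open>R\<close> into \<open>Q\<close>.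
\<close>

lemma (in group) sylow_conjugate:
  assumes fin: "finite (carrier G)" and q: "prime q"
    and Q: "subgroup Q G" and cG: "order G = card Q * m" and m: "\<not> q dvd m"
    and R: "subgroup R G" and cR: "card R = q ^ j"
  shows "\<exists>g\<in>carrier G. \<forall>r\<in>R. g \<otimes> r \<otimes> inv g \<in> Q"
proof -
  interpret Q: subgroup Q G by fact
  interpret R: subgroup R G by fact
  let ?R = "G\<lparr>carrier := R\<rparr>" and ?E = "rcosets Q"
  define \<phi> where "\<phi> r = (\<lambda>C\<in>?E. C #> inv r)" for r
  have coset: "C #> r \<in> ?E" if C: "C \<in> ?E" and r: "r \<in> carrier G" for C r
  proof -
    obtain g where g: "g \<in> carrier G" "C = Q #> g"
      using C by (auto simp: RCOSETS_def)
    then have "C #> r = Q #> (g \<otimes> r)"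
      using r Q.subset by (simp add: coset_mult_assoc)
    then show ?thesis using g r by (auto simp: RCOSETS_def)
  qed
  have inE: "C \<subseteq> carrier G" if "C \<in> ?E" for C
    using that Q.subset by (auto simp: RCOSETS_def r_coset_def)
  have step: "(C #> x) #> y = C #> (x \<otimes> y)" if "C \<in> ?E" "x \<in> carrier G" "y \<in> carrier G" for C x y
    using that inE by (simp add: coset_mult_assoc)
  have Bij: "\<phi> r \<in> Bij ?E" if r: "r \<in> R" for r
  proof -
    have "bij_betw (\<lambda>C. C #> inv r) ?E ?E"
      by (rule bij_betw_byWitness[where f' = "\<lambda>C. C #> r"])
        (use r coset in \<open>auto simp: step inE\<close>)
    then show ?thesis
      by (auto simp: Bij_def \<phi>_def cong: bij_betw_cong)
  qed
  have "group_hom ?R (BijGroup ?E) \<phi>"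
  proof (intro group_hom.intro group_hom_axioms.intro)
    show "group ?R" by (rule R.subgroup_is_group) (rule group_axioms)
    show "group (BijGroup ?E)" by (rule group_BijGroup)
    show "\<phi> \<in> hom ?R (BijGroup ?E)"
    proof (rule homI)
      fix x y assume "x \<in> carrier ?R" "y \<in> carrier ?R"
      then show "\<phi> (x \<otimes>\<^bsub>?R\<^esub> y) = \<phi> x \<otimes>\<^bsub>BijGroup ?E\<^esub> \<phi> y"
        using Bij coset
        by (auto simp: BijGroup_def compose_def \<phi>_def fun_eq_iff step inv_mult_group)
    qed (use Bij in \<open>simp add: BijGroup_def\<close>)
  qed
  then interpret act: group_action ?R ?E \<phi> by (rule group_action.intro)
  have "card ?E * card Q = m * card Q"
    using lagrange[OF Q] cG by (simp add: mult.commute)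
  moreover have "card Q > 0"
    using fin Q.subset Q.one_closed by (metis card_gt_0_iff empty_iff finite_subset)
  ultimately have "card ?E = m" by simp
  moreover have "finite ?E"
    using fin by (simp add: RCOSETS_def)
  moreover have "order ?R = q ^ j"
    using cR by (simp add: order_def)
  ultimately obtain C where C: "C \<in> ?E" "\<And>r. r \<in> R \<Longrightarrow> \<phi> r C = C"
    using act.fixed_point[OF q] m by force
  then obtain g where g: "g \<in> carrier G" "C = Q #> g"
    by (auto simp: RCOSETS_def)
  have "g \<otimes> r \<otimes> inv g \<in> Q" if r: "r \<in> R" for r
  proof -
    have "\<phi> (inv r) C = C" using r C(2) by simp
    then have "Q #> (g \<otimes> r) = Q #> g"
      using C(1) g r Q.subset by (simp add: \<phi>_def coset_mult_assoc)
    then have "g \<otimes> r \<in> Q #> g"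
      using g r rcos_self[OF _ Q, of "g \<otimes> r"] by simp
    then obtain y where "y \<in> Q" "g \<otimes> r = y \<otimes> g"
      by (auto simp: r_coset_def)
    then show ?thesis using g r by (simp add: m_assoc Q.mem_carrier)
  qed
  then show ?thesis using g by blast
qed

lemma (in group) pow_commutes:
  assumes "x \<in> carrier G" "w \<in> carrier G" and xw: "x \<otimes> w = w \<otimes> x"
  shows "x [^] (n::nat) \<otimes> w = w \<otimes> x [^] n"
proof (induction n)
  case (Suc n)
  have "x [^] Suc n \<otimes> w = x [^] n \<otimes> (x \<otimes> w)" using assms(1,2) by (simp add: m_assoc)
  also have "\<dots> = (x [^] n \<otimes> w) \<otimes> x" unfolding xw using assms(1,2) by (simp add: m_assoc)
  also have "\<dots> = w \<otimes> x [^] Suc n" unfolding Suc using assms(1,2) by (simp add: m_assoc)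
  finally show ?case .
qed (use assms(1,2) in simp)

text \<open>
  Only one inclusion is required, which for a finite subgroup \<open>Q\<close> amounts to equality; for such
  \<open>Q\<close> this is the usual normalizer.
\<close>

definition conj_normalizer :: "('a, 'b) monoid_scheme \<Rightarrow> 'a set \<Rightarrow> 'a set" where
  "conj_normalizer G Q = {g \<in> carrier G. \<forall>y\<in>Q. g \<otimes>\<^bsub>G\<^esub> y \<otimes>\<^bsub>G\<^esub> inv\<^bsub>G\<^esub> g \<in> Q}"

lemma (in group) inv_mult_cancel:
  "\<lbrakk>x \<in> carrier G; y \<in> carrier G\<rbrakk> \<Longrightarrow> inv x \<otimes> (x \<otimes> y) = y"
  "\<lbrakk>x \<in> carrier G; y \<in> carrier G\<rbrakk> \<Longrightarrow> x \<otimes> (inv x \<otimes> y) = y"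
  by (simp_all flip: m_assoc)

lemma (in group) conj_mult:
  "\<lbrakk>g \<in> carrier G; x \<in> carrier G; y \<in> carrier G\<rbrakk>
    \<Longrightarrow> g \<otimes> (x \<otimes> y) \<otimes> inv g = (g \<otimes> x \<otimes> inv g) \<otimes> (g \<otimes> y \<otimes> inv g)"
  by (simp add: m_assoc inv_mult_cancel)

lemma (in group) conj_conj:
  "\<lbrakk>g \<in> carrier G; h \<in> carrier G; x \<in> carrier G\<rbrakk>
    \<Longrightarrow> (g \<otimes> h) \<otimes> x \<otimes> inv (g \<otimes> h) = g \<otimes> (h \<otimes> x \<otimes> inv h) \<otimes> inv g"
  by (simp add: m_assoc inv_mult_group)

lemma (in group) conj_cancel:
  "\<lbrakk>g \<in> carrier G; x \<in> carrier G\<rbrakk> \<Longrightarrow> inv g \<otimes> (g \<otimes> x \<otimes> inv g) \<otimes> g = x"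
  "\<lbrakk>g \<in> carrier G; x \<in> carrier G\<rbrakk> \<Longrightarrow> g \<otimes> (inv g \<otimes> x \<otimes> g) \<otimes> inv g = x"
  by (simp_all add: m_assoc inv_mult_cancel)

lemma (in group) conj_inj:
  "\<lbrakk>g \<in> carrier G; x \<in> carrier G; y \<in> carrier G; g \<otimes> x \<otimes> inv g = g \<otimes> y \<otimes> inv g\<rbrakk> \<Longrightarrow> x = y"
  by simp

lemma (in group) conj_inv:
  "\<lbrakk>g \<in> carrier G; x \<in> carrier G\<rbrakk> \<Longrightarrow> inv (g \<otimes> x \<otimes> inv g) = g \<otimes> inv x \<otimes> inv g"
  by (simp add: m_assoc inv_mult_group)

lemma (in group) centralizer_normal:
  assumes U: "U \<lhd> G"
  shows "{z \<in> carrier G. \<forall>w\<in>U. z \<otimes> w = w \<otimes> z} \<lhd> G"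
proof -
  interpret U: normal U G by fact
  have UG [simp]: "x \<in> carrier G" if "x \<in> U" for x using that by (rule U.mem_carrier)
  define Z where "Z = {z \<in> carrier G. \<forall>w\<in>U. z \<otimes> w = w \<otimes> z}"
  have ZG: "z \<in> carrier G" if "z \<in> Z" for z using that by (simp add: Z_def)
  have Z: "subgroup Z G"
  proof (rule subgroupI)
    fix a assume a: "a \<in> Z"
    have aG: "a \<in> carrier G" using a ZG by blast
    have "inv a \<otimes> w = w \<otimes> inv a" if w: "w \<in> U" for w
    proof -
      have aw: "a \<otimes> w = w \<otimes> a" using a w unfolding Z_def by blast
      have "inv a \<otimes> w = inv a \<otimes> (w \<otimes> a) \<otimes> inv a" using aG w by (simp add: m_assoc)
      also have "\<dots> = w \<otimes> inv a" using aG w by (simp add: inv_mult_cancel flip: aw)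
      finally show ?thesis .
    qed
    with aG show "inv a \<in> Z" unfolding Z_def by blast
    fix b assume b: "b \<in> Z"
    have bG: "b \<in> carrier G" using b ZG by blast
    have "a \<otimes> b \<otimes> w = w \<otimes> (a \<otimes> b)" if w: "w \<in> U" for w
    proof -
      have aw: "a \<otimes> w = w \<otimes> a" and bw: "b \<otimes> w = w \<otimes> b" using a b w unfolding Z_def by blast+
      have "a \<otimes> b \<otimes> w = a \<otimes> (b \<otimes> w)" using aG bG w by (simp add: m_assoc)
      also have "\<dots> = (a \<otimes> w) \<otimes> b" unfolding bw using aG bG w by (simp add: m_assoc)
      also have "\<dots> = w \<otimes> (a \<otimes> b)" unfolding aw using aG bG w by (simp add: m_assoc)
      finally show ?thesis .
    qed
    then show "a \<otimes> b \<in> Z" using aG bG unfolding Z_def by blast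
  next
    have "\<one> \<in> Z" by (simp add: Z_def)
    then show "Z \<noteq> {}" by blast
  qed (auto simp: Z_def)
  have Zconj: "g \<otimes> z \<otimes> inv g \<in> Z" if g: "g \<in> carrier G" and z: "z \<in> Z" for g z
  proof -
    have zG: "z \<in> carrier G" using z ZG by blast
    have "(g \<otimes> z \<otimes> inv g) \<otimes> w = w \<otimes> (g \<otimes> z \<otimes> inv g)" if w: "w \<in> U" for w
    proof -
      let ?w = "inv g \<otimes> w \<otimes> g"
      have wU: "?w \<in> U" using U.inv_op_closed1 g w by blast
      have ww: "w = g \<otimes> ?w \<otimes> inv g" using g w by (simp add: conj_cancel)
      have "z \<otimes> ?w = ?w \<otimes> z" using z wU unfolding Z_def by blast
      then have "g \<otimes> (z \<otimes> ?w) \<otimes> inv g = g \<otimes> (?w \<otimes> z) \<otimes> inv g" by simp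
      then show ?thesis
        by (subst (1 2) ww) (simp only: conj_mult[OF g] zG UG[OF wU])
    qed
    moreover have "g \<otimes> z \<otimes> inv g \<in> carrier G" using g zG by simp
    ultimately show ?thesis unfolding Z_def by blast
  qed
  with Z have "Z \<lhd> G" unfolding normal_inv_iff by blast
  then show ?thesis by (simp add: Z_def)
qed

lemma (in group) conj_normalizer_bij:
  assumes "finite (carrier G)" "subgroup Q G" "h \<in> conj_normalizer G Q"
  shows "bij_betw (\<lambda>y. h \<otimes> y \<otimes> inv h) Q Q"
proof -
  have "inj_on (\<lambda>y. h \<otimes> y \<otimes> inv h) Q"
    using assms(3) subgroup.mem_carrier[OF assms(2)]
    by (auto simp: inj_on_def conj_normalizer_def)
  moreover have "finite Q"
    using assms finite_subset subgroup.subset by blast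
  moreover have "(\<lambda>y. h \<otimes> y \<otimes> inv h) ` Q \<subseteq> Q"
    using assms(3) by (auto simp: conj_normalizer_def)
  ultimately show ?thesis
    by (simp add: bij_betw_def endo_inj_surj)
qed

lemma (in group) conj_normalizer_subgroup:
  assumes "finite (carrier G)" "subgroup Q G"
  shows "subgroup (conj_normalizer G Q) G"
proof (rule subgroupI)
  interpret Q: subgroup Q G by fact
  show "conj_normalizer G Q \<noteq> {}"
    using Q.mem_carrier by (force simp: conj_normalizer_def intro: exI[of _ \<one>])
  fix a assume a: "a \<in> conj_normalizer G Q"
  then have aG: "a \<in> carrier G" by (simp add: conj_normalizer_def)
  have "inv a \<otimes> y \<otimes> inv (inv a) \<in> Q" if y: "y \<in> Q" for y
  proof -
    obtain x where x: "x \<in> Q" "y = a \<otimes> x \<otimes> inv a"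
      using conj_normalizer_bij[OF assms a] y by (auto simp: bij_betw_def)
    then show ?thesis using aG by (simp add: conj_cancel Q.mem_carrier)
  qed
  with aG show "inv a \<in> conj_normalizer G Q" by (simp add: conj_normalizer_def)
  fix b assume b: "b \<in> conj_normalizer G Q"
  show "a \<otimes> b \<in> conj_normalizer G Q"
    using a b Q.mem_carrier by (auto simp: conj_normalizer_def conj_conj)
qed (auto simp: conj_normalizer_def)

lemma (in group) conj_subgroup:
  assumes Q: "subgroup Q G" and g: "g \<in> carrier G"
  shows "subgroup ((\<lambda>y. g \<otimes> y \<otimes> inv g) ` Q) G"
    and "card ((\<lambda>y. g \<otimes> y \<otimes> inv g) ` Q) = card Q"
proof -
  interpret Q: subgroup Q G by fact
  show "subgroup ((\<lambda>y. g \<otimes> y \<otimes> inv g) ` Q) G"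
  proof (rule subgroupI)
    fix a b assume "a \<in> (\<lambda>y. g \<otimes> y \<otimes> inv g) ` Q" "b \<in> (\<lambda>y. g \<otimes> y \<otimes> inv g) ` Q"
    then show "a \<otimes> b \<in> (\<lambda>y. g \<otimes> y \<otimes> inv g) ` Q"
      using g Q.mem_carrier Q.m_closed conj_mult by (auto simp flip: conj_mult)
  next
    fix a assume "a \<in> (\<lambda>y. g \<otimes> y \<otimes> inv g) ` Q"
    then show "inv a \<in> (\<lambda>y. g \<otimes> y \<otimes> inv g) ` Q"
      using g Q.mem_carrier conj_inv by auto
  next
    show "(\<lambda>y. g \<otimes> y \<otimes> inv g) ` Q \<noteq> {}" using Q.one_closed by blast
  qed (use g Q.mem_carrier in auto)
  have "inj_on (\<lambda>y. g \<otimes> y \<otimes> inv g) Q"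
    using g Q.mem_carrier by (auto simp: inj_on_def)
  then show "card ((\<lambda>y. g \<otimes> y \<otimes> inv g) ` Q) = card Q"
    by (rule card_image)
qed

text \<open>
  For \<open>g\<close> in \<open>G\<close> the conjugate of \<open>Q\<close> by \<open>g\<close> is again a Sylow \<open>q\<close>-subgroup of \<open>T\<close>, hence conjugate
  to \<open>Q\<close> inside \<open>T = U Q\<close>; the factor from \<open>Q\<close> normalizes \<open>Q\<close>, so an element of \<open>U\<close> suffices.
\<close>

lemma (in group) frattini:
  assumes fin: "finite (carrier G)" and q: "prime q"
    and T: "T \<lhd> G" and U: "U \<lhd> G" and UT: "U \<subseteq> T"
    and Q: "subgroup Q G" and QT: "Q \<subseteq> T"
    and cQ: "card Q = q ^ k" and cT: "card T = card U * q ^ k" and ndvd: "\<not> q dvd card U"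
  shows "Q \<inter> U = {\<one>}"
    and "\<And>t. t \<in> T \<Longrightarrow> \<exists>u\<in>U. \<exists>y\<in>Q. t = u \<otimes> y"
    and "\<And>g. g \<in> carrier G \<Longrightarrow> \<exists>u\<in>U. \<exists>h\<in>conj_normalizer G Q. g = u \<otimes> h"
proof -
  interpret T: normal T G by fact
  interpret U: normal U G by fact
  interpret Q: subgroup Q G by fact
  have QU: "subgroup (Q \<inter> U) G"
    using Q U.subgroup_axioms subgroups_Inter_pair by blast
  have "card (Q \<inter> U) dvd q ^ k" "card (Q \<inter> U) dvd card U"
    using card_subgroup_dvd[OF fin QU Q] card_subgroup_dvd[OF fin QU U.subgroup_axioms] cQ by auto
  moreover have "coprime (q ^ k) (card U)"
    using q ndvd by (simp add: prime_imp_coprime)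
  ultimately have card1: "card (Q \<inter> U) = 1"
    by (metis coprime_common_divisor_nat)
  then show QU1: "Q \<inter> U = {\<one>}"
    using U.one_closed Q.one_closed by (metis IntI card_1_singletonE singletonD)
  obtain K :: "nat monoid" and \<phi> where "group_hom G K \<phi>"
    and surj: "\<phi> ` carrier G = carrier K"
    and ker: "\<And>x. x \<in> carrier G \<Longrightarrow> \<phi> x = \<one>\<^bsub>K\<^esub> \<longleftrightarrow> x \<in> U"
    using nat_quotient[OF U fin] by metis
  then interpret \<phi>: group_hom G K \<phi> by simp
  have cU: "card U > 0"
    using ndvd by (metis dvd_0_right gr0I)
  have "T \<inter> U = U" using UT by blast
  then have "card (\<phi> ` T) = q ^ k"
    using \<phi>.card_quotient[OF fin T.subgroup_axioms surj ker] cT cU by simp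
  moreover have "card (\<phi> ` Q) = q ^ k"
    using \<phi>.card_quotient[OF fin Q surj ker] cQ card1 by simp
  moreover have "finite (\<phi> ` T)"
    using fin T.subset finite_subset by blast
  ultimately have img: "\<phi> ` Q = \<phi> ` T"
    using QT by (intro card_subset_eq) auto
  show prod: "\<exists>u\<in>U. \<exists>y\<in>Q. t = u \<otimes> y" if t: "t \<in> T" for t
  proof -
    obtain y where y: "y \<in> Q" "\<phi> t = \<phi> y" using img t by (metis imageE imageI)
    have "\<phi> (t \<otimes> inv y) = \<one>\<^bsub>K\<^esub>"
      using y t by (simp add: T.mem_carrier Q.mem_carrier)
    then have "t \<otimes> inv y \<in> U"
      using ker[of "t \<otimes> inv y"] y t T.mem_carrier Q.mem_carrier by simp
    then show ?thesis
      using y t by (intro bexI[of _ "t \<otimes> inv y"] bexI[of _ y]) (auto simp: T.mem_carrier Q.mem_carrier m_assoc)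
  qed
  fix g assume g: "g \<in> carrier G"
  let ?R = "(\<lambda>y. g \<otimes> y \<otimes> inv g) ` Q"
  let ?T = "G\<lparr>carrier := T\<rparr>"
  have RT: "?R \<subseteq> T"
    using g QT T.inv_op_closed2 by auto
  interpret GT: group ?T
    by (rule T.subgroup_is_group) (rule group_axioms)
  have "finite T" using fin T.subset finite_subset by blast
  then obtain t where t: "t \<in> T" and tQ: "\<And>r. r \<in> ?R \<Longrightarrow> t \<otimes> r \<otimes> inv\<^bsub>?T\<^esub> t \<in> Q"
    using GT.sylow_conjugate[of q Q "card U" ?R k] q cT cQ ndvd
      subgroup_incl[OF Q T.subgroup_axioms QT]
      subgroup_incl[OF conj_subgroup(1)[OF Q g] T.subgroup_axioms RT]
      conj_subgroup(2)[OF Q g]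
    by (auto simp: order_def)
  have tG: "t \<in> carrier G" using t T.mem_carrier by blast
  have inv_t: "inv\<^bsub>?T\<^esub> t = inv t"
    using m_inv_consistent[OF T.subgroup_axioms t] by simp
  have "(t \<otimes> g) \<otimes> y \<otimes> inv (t \<otimes> g) \<in> Q" if "y \<in> Q" for y
    using tQ[OF imageI[OF that]]
    by (simp only: conj_conj[OF tG g Q.mem_carrier[OF that]] inv_t)
  then have tg: "t \<otimes> g \<in> conj_normalizer G Q"
    using g tG by (simp add: conj_normalizer_def)
  obtain u y where u: "u \<in> U" and y: "y \<in> Q" and ty: "inv t = u \<otimes> y"
    using prod[of "inv t"] t by auto
  interpret N: subgroup "conj_normalizer G Q" G
    by (rule conj_normalizer_subgroup[OF fin Q])
  have "y \<in> conj_normalizer G Q"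
    unfolding conj_normalizer_def
    using y by (intro CollectI conjI ballI Q.m_closed Q.m_inv_closed Q.mem_carrier)
  then have "y \<otimes> (t \<otimes> g) \<in> conj_normalizer G Q"
    using tg by blast
  moreover have "g = u \<otimes> (y \<otimes> (t \<otimes> g))"
  proof -
    have "u \<otimes> (y \<otimes> (t \<otimes> g)) = (u \<otimes> y) \<otimes> t \<otimes> g"
      using u y g tG by (simp add: m_assoc U.mem_carrier Q.mem_carrier)
    also have "\<dots> = g" using g tG by (simp flip: ty)
    finally show ?thesis by simp
  qed
  ultimately show "\<exists>u\<in>U. \<exists>h\<in>conj_normalizer G Q. g = u \<otimes> h"
    using u by blast
qed


lemma (in group) frattini_sylow:
  assumes fin: "finite (carrier G)" and q: "prime q"
    and T: "T \<lhd> G" and U: "U \<lhd> G" and UT: "U \<subseteq> T"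
    and cT: "card T = card U * q ^ k" and ndvd: "\<not> q dvd card U"
  obtains Q where "subgroup Q G" "Q \<subseteq> T" "card Q = q ^ k" "Q \<inter> U = {\<one>}"
    "\<And>t. t \<in> T \<Longrightarrow> \<exists>u\<in>U. \<exists>y\<in>Q. t = u \<otimes> y"
    "\<And>g. g \<in> carrier G \<Longrightarrow> \<exists>u\<in>U. \<exists>h\<in>conj_normalizer G Q. g = u \<otimes> h"
proof -
  interpret T: normal T G by fact
  let ?T = "G\<lparr>carrier := T\<rparr>"
  have "group ?T" by (rule T.subgroup_is_group) (rule group_axioms)
  moreover have "order ?T = q ^ k * card U" using cT by (simp add: order_def)
  moreover have "finite T" using fin T.subset finite_subset by blast
  ultimately obtain Q where Q: "subgroup Q ?T" "card Q = q ^ k"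
    using sylow_thm[OF q, of ?T k "card U"] by auto
  have QG: "subgroup Q G" using incl_subgroup[OF T.subgroup_axioms Q(1)] .
  have QT: "Q \<subseteq> T" using Q(1) subgroup.subset by fastforce
  show thesis
    using that[OF QG QT Q(2)] frattini[OF fin q T U UT QG QT Q(2) cT ndvd] by blast
qed

section \<open>Normal series and complements in soluble groups\<close>

text \<open>
  A prime \<open>r \<noteq> q\<close> dividing the order would give a nontrivial Sylow \<open>r\<close>-subgroup, whose elements
  have order both a power of \<open>r\<close> and a power of \<open>q\<close>.
\<close>

lemma (in group) subgroup_with_prime_power_exponent:
  assumes fin: "finite (carrier G)" and T: "subgroup T G" and q: "prime q"
    and exp: "\<And>x. x \<in> T \<Longrightarrow> x [^] (q ^ n) = \<one>"
  shows "\<exists>k. card T = q ^ k"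
proof -
  interpret T: subgroup T G by fact
  let ?T = "G\<lparr>carrier := T\<rparr>"
  interpret GT: group ?T by (rule T.subgroup_is_group) (rule group_axioms)
  have finT: "finite T" using fin T.subset finite_subset by blast
  have cT: "card T \<noteq> 0" using finT T.one_closed by (metis card_0_eq empty_iff)
  have "r = q" if r: "prime r" "r dvd card T" for r
  proof -
    have "order ?T = r ^ multiplicity r (card T) * (card T div r ^ multiplicity r (card T))"
      by (simp add: order_def multiplicity_dvd)
    then obtain R where R: "subgroup R ?T" "card R = r ^ multiplicity r (card T)"
      using sylow_thm[OF r(1) GT.group_axioms] finT by auto
    have RT: "R \<subseteq> T" using R(1) subgroup.subset by fastforce
    have "multiplicity r (card T) > 0"
      using r cT by (simp add: prime_multiplicity_gt_zero_iff)
    then have "card R > 1"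
      using R(2) one_less_power[OF prime_gt_1_nat[OF r(1)]] by simp
    then have "\<not> R \<subseteq> {\<one>}"
      using card_mono[of "{\<one>}" R] by auto
    then obtain x where x: "x \<in> R" "x \<noteq> \<one>" by blast
    have RG: "subgroup R G"
      using incl_subgroup[OF T R(1)] .
    have "x [^] (r ^ multiplicity r (card T)) = \<one>"
      using subgroup_pow_card[OF fin RG x(1)] R(2) by simp
    moreover have "x [^] (q ^ n) = \<one>" using exp x RT by blast
    ultimately have "\<not> coprime (r ^ multiplicity r (card T)) (q ^ n)"
      using pow_coprime_eq_one x subgroup.mem_carrier[OF RG x(1)] by blast
    then show "r = q"
      using r(1) q primes_coprime by (metis coprime_power_left_iff coprime_power_right_iff)
  qed
  then have "prime_factors (card T) \<subseteq> {q}"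
    by (auto simp: in_prime_factors_iff)
  then have "card T = q ^ multiplicity q (card T)"
    using cT prime_factorization_nat[of "card T"] q
    by (cases "prime_factors (card T) = {}") (auto simp: subset_singleton_iff prime_factorization_empty_iff not_dvd_imp_multiplicity_0)
  then show ?thesis by blast
qed

lemma (in group) derived_trivial_imp_commute:
  assumes "derived G H = {\<one>}" "H \<subseteq> carrier G" "x \<in> H" "y \<in> H"
  shows "x \<otimes> y = y \<otimes> x"
proof -
  have "x \<otimes> y \<otimes> inv x \<otimes> inv y \<in> derived G H"
    unfolding derived_def by (rule generate.incl) (use assms in blast)
  then have "x \<otimes> y \<otimes> inv x \<otimes> inv y = \<one>" using assms by simp
  then have "x \<otimes> y \<otimes> inv (y \<otimes> x) = \<one>"
    using assms by (simp add: inv_mult_group m_assoc subset_eq)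
  then show ?thesis
    using assms by (metis inv_equality inv_inv m_closed inv_closed subsetD)
qed

text \<open>
  The last nontrivial term of the derived series of \<open>D\<close> is abelian and normal in \<open>G\<close>; its
  Sylow subgroups consist of the elements of \<open>q\<close>-power order and so are normal in \<open>G\<close> as well.
\<close>

lemma (in group) normal_subgroup_contains_normal_prime_power:
  assumes fin: "finite (carrier G)" and sol: "solvable G"
    and D: "D \<lhd> G" and D1: "D \<noteq> {\<one>}"
  shows "\<exists>T q k. T \<lhd> G \<and> T \<subseteq> D \<and> prime q \<and> k > 0 \<and> card T = q ^ k"
proof -
  let ?d = "\<lambda>n. (derived G ^^ n) D"
  interpret D: normal D G by fact
  obtain n where "(derived G ^^ n) (carrier G) = {\<one>}"
    using sol solvable_iff_trivial_derived_seq by blast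
  then have "?d n \<subseteq> {\<one>}"
    using mono_exp_of_derived[OF D.subset, of n] by simp
  then have ex: "\<exists>n. ?d n \<subseteq> {\<one>}" by blast
  define N where "N = (LEAST n. ?d n \<subseteq> {\<one>})"
  have N: "?d N \<subseteq> {\<one>}" unfolding N_def using ex by (rule LeastI_ex)
  have dN: "?d m \<lhd> G" for m
    by (induction m) (auto intro: D derived_is_normal)
  have "N \<noteq> 0"
    using N D1 D.one_closed by (cases N) auto
  then obtain m where m: "N = Suc m" by (cases N) auto
  define E where "E = ?d m"
  have E: "E \<lhd> G" using dN by (simp add: E_def)
  interpret E: normal E G by fact
  have E1: "\<not> E \<subseteq> {\<one>}"
    using not_less_Least[of m "\<lambda>n. ?d n \<subseteq> {\<one>}"] m by (simp add: E_def N_def)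
  have "derived G E = {\<one>}"
    using N m normal_imp_subgroup[OF derived_is_normal[OF E]] by (auto simp: E_def dest: subgroup.one_closed)
  then have comm: "x \<otimes> y = y \<otimes> x" if "x \<in> E" "y \<in> E" for x y
    using derived_trivial_imp_commute that E.subset by blast
  have ED: "E \<subseteq> D"
  proof -
    have "?d m \<subseteq> D" for m
    proof (induction m)
      case (Suc m)
      then show ?case
        using derived_incl[OF subset_refl normal_imp_subgroup[OF dN[of m]]] by simp
    qed simp
    then show ?thesis by (simp add: E_def)
  qed
  have finE: "finite E" using fin E.subset finite_subset by blast
  have "card E \<noteq> 1"
    using E1 E.one_closed by (metis card_1_singletonE equalityD1 singletonD)
  moreover have cE: "card E \<noteq> 0" using finE E.one_closed by (metis card_0_eq empty_iff)
  ultimately obtain q where q: "prime q" "q dvd card E"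
    using prime_factor_nat by blast
  define a where "a = multiplicity q (card E)"
  define T where "T = {x \<in> E. x [^] (q ^ a) = \<one>}"
  have T: "T \<lhd> G"
    unfolding normal_inv_iff
  proof (intro conjI ballI)
    show "subgroup T G"
    proof (rule subgroupI)
      fix x y assume "x \<in> T" "y \<in> T"
      then show "x \<otimes> y \<in> T"
        using comm by (auto simp: T_def pow_mult_distrib E.mem_carrier)
    qed (auto simp: T_def E.mem_carrier nat_pow_inv intro: E.one_closed)
    fix g x assume g: "g \<in> carrier G" and x: "x \<in> T"
    have "(g \<otimes> x \<otimes> inv g) [^] (n::nat) = g \<otimes> x [^] n \<otimes> inv g" for n
    proof (induction n)
      case (Suc n)
      then show ?case
        using g x by (simp add: T_def E.mem_carrier m_assoc inv_mult_cancel)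
    qed (use g in simp)
    then show "g \<otimes> x \<otimes> inv g \<in> T"
      using g x by (auto simp: T_def E.inv_op_closed2)
  qed
  interpret T: normal T G by fact
  obtain k where k: "card T = q ^ k"
    using subgroup_with_prime_power_exponent[OF fin T.subgroup_axioms q(1), of a]
    by (auto simp: T_def)
  have "k > 0"
  proof -
    let ?E = "G\<lparr>carrier := E\<rparr>"
    have "group ?E" by (rule E.subgroup_is_group) (rule group_axioms)
    moreover have "order ?E = q ^ a * (card E div q ^ a)"
      by (simp add: order_def multiplicity_dvd a_def)
    ultimately obtain R where R: "subgroup R ?E" "card R = q ^ a"
      using sylow_thm[OF q(1), of ?E a "card E div q ^ a"] finE by auto
    have RE: "R \<subseteq> E" using R(1) subgroup.subset by fastforce
    have "R \<subseteq> T"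
    proof
      fix x assume x: "x \<in> R"
      then show "x \<in> T"
        using subgroup_pow_card[OF fin incl_subgroup[OF E.subgroup_axioms R(1)] x] RE R(2)
        by (auto simp: T_def)
    qed
    moreover have "finite T" using finE by (simp add: T_def)
    ultimately have "q ^ a \<le> q ^ k"
      using card_mono R(2) k by metis
    moreover have "a > 0"
      using q cE by (simp add: a_def prime_multiplicity_gt_zero_iff)
    ultimately show ?thesis
      using one_less_power[OF prime_gt_1_nat[OF q(1)], of a] by (cases k) auto
  qed
  moreover have "T \<subseteq> D" using ED by (auto simp: T_def)
  ultimately show ?thesis using T q(1) k by blast
qed

text \<open>
  This is the preceding lemma applied to the image of \<open>C\<close> in \<open>G/U\<close>.
\<close>

lemma (in group) normal_subgroup_prime_power_step:
  assumes fin: "finite (carrier G)" and sol: "solvable G"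
    and U: "U \<lhd> G" and C: "C \<lhd> G" and UC: "U \<subset> C"
  shows "\<exists>T q k. T \<lhd> G \<and> U \<subseteq> T \<and> T \<subseteq> C \<and> prime q \<and> k > 0 \<and> card T = card U * q ^ k"
proof -
  interpret U: normal U G by fact
  interpret C: normal C G by fact
  obtain K :: "nat monoid" and \<phi> where hom: "group_hom G K \<phi>"
    and surj: "\<phi> ` carrier G = carrier K" and finK: "finite (carrier K)"
    and ker: "\<And>x. x \<in> carrier G \<Longrightarrow> \<phi> x = \<one>\<^bsub>K\<^esub> \<longleftrightarrow> x \<in> U"
    using nat_quotient[OF U fin] by metis
  interpret \<phi>: group_hom G K \<phi> by fact
  have "\<phi> ` C \<lhd> K"
    by (rule C.surj_hom_normal_subgroup[OF hom surj])
  moreover have "\<phi> ` C \<noteq> {\<one>\<^bsub>K\<^esub>}"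
    using UC ker C.mem_carrier by blast
  moreover have "solvable K"
    using \<phi>.surj_hom_imp_solvable[OF surj sol] .
  ultimately obtain S q k where S: "S \<lhd> K" "S \<subseteq> \<phi> ` C" "prime q" "k > 0" "card S = q ^ k"
    using \<phi>.H.normal_subgroup_contains_normal_prime_power[OF finK] by metis
  interpret S: normal S K by fact
  define T where "T = {x \<in> carrier G. \<phi> x \<in> S}"
  have T: "T \<lhd> G"
    unfolding normal_inv_iff
  proof (intro conjI ballI)
    show "subgroup T G"
      by (rule subgroupI) (auto simp: T_def intro!: exI[of _ \<one>])
  qed (auto simp: T_def S.inv_op_closed2)
  have UT: "U \<subseteq> T"
  proof
    fix u assume "u \<in> U"
    then have "u \<in> carrier G" "\<phi> u = \<one>\<^bsub>K\<^esub>" using ker by auto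
    then show "u \<in> T" by (simp add: T_def)
  qed
  have TC: "T \<subseteq> C"
  proof
    fix t assume t: "t \<in> T"
    then obtain c where c: "c \<in> C" "\<phi> t = \<phi> c" using S(2) by (auto simp: T_def)
    have tG: "t \<in> carrier G" using t by (simp add: T_def)
    have cG: "c \<in> carrier G" using c C.mem_carrier by simp
    have "\<phi> (t \<otimes> inv c) = \<one>\<^bsub>K\<^esub>" using c tG cG by simp
    then have "t \<otimes> inv c \<in> C" using ker[of "t \<otimes> inv c"] UC tG cG by auto
    then have "(t \<otimes> inv c) \<otimes> c \<in> C" using c by blast
    then show "t \<in> C" using tG cG by (simp add: m_assoc)
  qed
  have "\<phi> ` T = S"
  proof
    show "S \<subseteq> \<phi> ` T"
    proof
      fix s assume s: "s \<in> S"
      then have "s \<in> \<phi> ` carrier G" using surj S.mem_carrier by simp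
      then show "s \<in> \<phi> ` T" using s by (auto simp: T_def)
    qed
  qed (auto simp: T_def)
  then have "card T = q ^ k * card U"
    using \<phi>.card_quotient[OF fin normal_imp_subgroup[OF T] surj ker] S(5) UT
    by (simp add: Int_absorb1)
  then show ?thesis using T UT TC S by (metis mult.commute)
qed


text \<open>
  A Schur--Zassenhaus theorem for soluble groups. Take \<open>T\<close> normal with \<open>T/P\<close> a nontrivial
  \<open>q\<close>-group and a Sylow \<open>q\<close>-subgroup \<open>Q\<close> of \<open>T\<close>, so that \<open>G = P N(Q)\<close>. If \<open>N(Q) \<noteq> G\<close>, a complement
  of \<open>P \<inter> N(Q)\<close> in \<open>N(Q)\<close> is a complement of \<open>P\<close> in \<open>G\<close>. If \<open>Q\<close> is normal, the preimage of a
  complement in \<open>G/Q\<close> works, because \<open>P \<inter> Q = 1\<close>.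
\<close>

lemma normal_sylow_complement:
  fixes G :: "nat monoid"
  assumes "group G" "finite (carrier G)" "solvable G" and p: "prime p"
    and "P \<lhd> G" "card P = p ^ a" "order G = card P * m" "\<not> p dvd m"
  shows "\<exists>H. subgroup H G \<and> H \<inter> P = {\<one>\<^bsub>G\<^esub>} \<and>
    (\<forall>g\<in>carrier G. \<exists>x\<in>P. \<exists>h\<in>H. g = x \<otimes>\<^bsub>G\<^esub> h)"
  using assms
proof (induction "order G" arbitrary: G P a m rule: less_induct)
  case (less G P a m)
  interpret group G by fact
  interpret P: normal P G by fact
  have fin: "finite (carrier G)" by fact
  have cP: "card P = p ^ a" and oG: "order G = card P * m" by fact+
  have oG0: "order G > 0" using fin by (simp add: order_gt_0_iff_finite)
  show ?case
  proof (cases "P = carrier G")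
    case True
    then show ?thesis
      by (intro exI[of _ "{\<one>\<^bsub>G\<^esub>}"]) (auto simp: triv_subgroup)
  next
    case False
    then have "P \<subset> carrier G" using P.subset by blast
    then obtain T q k where T: "T \<lhd> G" "P \<subseteq> T" "prime q" "k > 0" "card T = card P * q ^ k"
      using normal_subgroup_prime_power_step[OF fin \<open>solvable G\<close> \<open>P \<lhd> G\<close> normal_self]
      by blast
    interpret T: normal T G by fact
    have "card P * q ^ k dvd card P * m"
      using card_subgroup_dvd[OF fin T.subgroup_axioms subgroup_self T.subset] oG T(5)
      by (simp add: order_def)
    then have "q ^ k dvd m" using oG0 oG by auto
    then have "q \<noteq> p"
      using \<open>k > 0\<close> \<open>\<not> p dvd m\<close> by (metis dvd_power dvd_trans)
    then have ndvd: "\<not> q dvd card P"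
      using cP p T(3) by (metis prime_dvd_power primes_dvd_imp_eq)
    obtain Q where Q: "subgroup Q G" "Q \<subseteq> T" "card Q = q ^ k" and QP: "Q \<inter> P = {\<one>\<^bsub>G\<^esub>}"
      and fr: "\<And>g. g \<in> carrier G \<Longrightarrow> \<exists>u\<in>P. \<exists>h\<in>conj_normalizer G Q. g = u \<otimes>\<^bsub>G\<^esub> h"
      using frattini_sylow[OF fin T(3,1) \<open>P \<lhd> G\<close> T(2,5) ndvd] by metis
    interpret Q: subgroup Q G by fact
    define N where "N = conj_normalizer G Q"
    have N: "subgroup N G" unfolding N_def by (rule conj_normalizer_subgroup[OF fin Q(1)])
    interpret N: subgroup N G by fact
    show ?thesis
    proof (cases "N = carrier G")
      case False
      let ?N = "G\<lparr>carrier := N\<rparr>"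
      have gN: "group ?N" by (rule N.subgroup_is_group) (rule group_axioms)
      have PN: "P \<inter> N \<lhd> ?N"
      proof -
        have sub: "subgroup (P \<inter> N) ?N"
          using subgroup_incl[OF subgroups_Inter_pair[OF P.subgroup_axioms N] N] by simp
        show ?thesis
          unfolding group.normal_inv_iff[OF gN]
          using sub m_inv_consistent[OF N] P.inv_op_closed2 N.mem_carrier
          by auto
      qed
      have finN: "finite N" using fin N.subset finite_subset by blast
      have oN: "order ?N < order G"
        using False N.subset fin by (auto simp: order_def intro: psubset_card_mono)
      have solN: "solvable ?N"
        using group_hom.inj_hom_imp_solvable[of ?N G id] gN \<open>solvable G\<close> N.subset
        by (auto simp: group_hom_def group_hom_axioms_def hom_def)
      obtain K :: "nat monoid" and \<phi> where hom: "group_hom G K \<phi>"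
        and surj: "\<phi> ` carrier G = carrier K" and finK: "finite (carrier K)"
        and ker: "\<And>x. x \<in> carrier G \<Longrightarrow> \<phi> x = \<one>\<^bsub>K\<^esub> \<longleftrightarrow> x \<in> P"
        and oK: "order G = order K * card P"
        using nat_quotient[OF \<open>P \<lhd> G\<close> fin] by metis
      interpret \<phi>: group_hom G K \<phi> by fact
      have cK: "card (carrier K) = m" using oK oG oG0 by (simp add: order_def)
      have "\<phi> ` N = carrier K"
      proof
        show "carrier K \<subseteq> \<phi> ` N"
        proof
          fix y assume "y \<in> carrier K"
          then obtain g where g: "g \<in> carrier G" "y = \<phi> g" using surj by auto
          then obtain u h where "u \<in> P" "h \<in> N" "g = u \<otimes>\<^bsub>G\<^esub> h" using fr N_def by blast
          then have "y = \<phi> h" using g ker[of u] by (simp add: P.mem_carrier N.mem_carrier)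
          with \<open>h \<in> N\<close> show "y \<in> \<phi> ` N" by blast
        qed
      qed (use surj N.subset in blast)
      then have cN: "card N = m * card (P \<inter> N)"
        using \<phi>.card_quotient[OF fin N surj ker] cK by (simp add: Int_commute)
      have "card (P \<inter> N) dvd p ^ a"
        using card_subgroup_dvd[OF fin subgroups_Inter_pair[OF P.subgroup_axioms N] P.subgroup_axioms] cP by simp
      then obtain b where b: "card (P \<inter> N) = p ^ b"
        using p divides_primepow_nat by blast
      have "\<exists>H. subgroup H ?N \<and> H \<inter> (P \<inter> N) = {\<one>\<^bsub>?N\<^esub>} \<and>
          (\<forall>g\<in>carrier ?N. \<exists>x\<in>P \<inter> N. \<exists>h\<in>H. g = x \<otimes>\<^bsub>?N\<^esub> h)"
        by (rule less.hyps[OF oN gN _ solN p PN b])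
          (use finN cN \<open>\<not> p dvd m\<close> in \<open>simp_all add: order_def\<close>)
      then obtain H where H: "subgroup H ?N" "H \<inter> (P \<inter> N) = {\<one>\<^bsub>G\<^esub>}"
        and HN: "\<And>g. g \<in> N \<Longrightarrow> \<exists>x\<in>P \<inter> N. \<exists>h\<in>H. g = x \<otimes>\<^bsub>G\<^esub> h"
        by auto
      have HG: "subgroup H G" using incl_subgroup[OF N H(1)] .
      have "H \<subseteq> N" using H(1) subgroup.subset by fastforce
      then have "H \<inter> P = {\<one>\<^bsub>G\<^esub>}" using H(2) by blast
      moreover have "\<exists>x\<in>P. \<exists>h\<in>H. g = x \<otimes>\<^bsub>G\<^esub> h" if g: "g \<in> carrier G" for g
      proof -
        obtain u n where u: "u \<in> P" "n \<in> N" "g = u \<otimes>\<^bsub>G\<^esub> n" using fr[OF g] N_def by blast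
        then obtain x h where x: "x \<in> P" "h \<in> H" "n = x \<otimes>\<^bsub>G\<^esub> h" using HN by blast
        then have "g = (u \<otimes>\<^bsub>G\<^esub> x) \<otimes>\<^bsub>G\<^esub> h"
          using u subgroup.mem_carrier[OF HG] by (simp add: m_assoc P.mem_carrier)
        then show ?thesis using u x by blast
      qed
      ultimately show ?thesis using HG by blast
    next
      case True
      have Qn: "Q \<lhd> G"
        unfolding normal_inv_iff
      proof (intro conjI ballI Q(1))
        fix g y assume "g \<in> carrier G" "y \<in> Q"
        then show "g \<otimes>\<^bsub>G\<^esub> y \<otimes>\<^bsub>G\<^esub> inv\<^bsub>G\<^esub> g \<in> Q"
          using True unfolding N_def conj_normalizer_def by blast
      qed
      obtain K :: "nat monoid" and \<phi> where hom: "group_hom G K \<phi>"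
        and surj: "\<phi> ` carrier G = carrier K" and finK: "finite (carrier K)"
        and ker: "\<And>x. x \<in> carrier G \<Longrightarrow> \<phi> x = \<one>\<^bsub>K\<^esub> \<longleftrightarrow> x \<in> Q"
        and oK: "order G = order K * card Q"
        using nat_quotient[OF Qn fin] by metis
      interpret \<phi>: group_hom G K \<phi> by fact
      have "card Q > 1"
        using Q(3) T(4) one_less_power[OF prime_gt_1_nat[OF T(3)]] by simp
      then have less_K: "order K < order G" using oK oG0 by simp
      have "card P = card (\<phi> ` P)"
        using \<phi>.card_quotient[OF fin P.subgroup_axioms surj ker] QP by (simp add: Int_commute)
      then have cK: "card (\<phi> ` P) = p ^ a" using cP by simp
      have "p ^ a dvd order K * q ^ k"
        using oK oG cP Q(3) by (metis dvd_triv_left)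
      moreover have "coprime (p ^ a) (q ^ k)"
        using p T(3) \<open>q \<noteq> p\<close> by (simp add: primes_coprime)
      ultimately have "p ^ a dvd order K" by (simp add: coprime_dvd_mult_left_iff)
      then obtain m' where m': "order K = p ^ a * m'" by blast
      have "p ^ a * m = order G" using oG cP by simp
      also have "\<dots> = p ^ a * (m' * q ^ k)" using oK m' Q(3) by simp
      finally have "p ^ a * m = p ^ a * (m' * q ^ k)" .
      moreover have "p > 0" using p prime_gt_0_nat by blast
      ultimately have "m = m' * q ^ k" by auto
      then have "\<not> p dvd m'" using \<open>\<not> p dvd m\<close> by auto
      have nP: "\<phi> ` P \<lhd> K" by (rule P.surj_hom_normal_subgroup[OF hom surj])
      have solK: "solvable K" using \<phi>.surj_hom_imp_solvable[OF surj \<open>solvable G\<close>] .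
      obtain H' where H': "subgroup H' K" "H' \<inter> \<phi> ` P = {\<one>\<^bsub>K\<^esub>}"
        and fac: "\<And>g. g \<in> carrier K \<Longrightarrow> \<exists>x\<in>\<phi> ` P. \<exists>h\<in>H'. g = x \<otimes>\<^bsub>K\<^esub> h"
        using less.hyps[OF less_K \<phi>.H.group_axioms finK solK p nP cK _ \<open>\<not> p dvd m'\<close>] m' cK by auto
      interpret H': subgroup H' K by fact
      define H where "H = {g \<in> carrier G. \<phi> g \<in> H'}"
      have H: "subgroup H G"
        by (rule subgroupI) (auto simp: H_def intro!: exI[of _ "\<one>\<^bsub>G\<^esub>"])
      have "H \<inter> P = {\<one>\<^bsub>G\<^esub>}"
      proof
        show "H \<inter> P \<subseteq> {\<one>\<^bsub>G\<^esub>}"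
        proof
          fix x assume x: "x \<in> H \<inter> P"
          then have "\<phi> x \<in> H' \<inter> \<phi> ` P" by (auto simp: H_def)
          then have "x \<in> Q" using x H'(2) ker[of x] by (simp add: H_def)
          then show "x \<in> {\<one>\<^bsub>G\<^esub>}" using x QP by blast
        qed
      qed (use subgroup.one_closed[OF H] in simp)
      moreover have "\<exists>x\<in>P. \<exists>h\<in>H. g = x \<otimes>\<^bsub>G\<^esub> h" if g: "g \<in> carrier G" for g
      proof -
        obtain x h where x: "x \<in> P" "h \<in> H'" "\<phi> g = \<phi> x \<otimes>\<^bsub>K\<^esub> h"
          using fac[of "\<phi> g"] g by auto
        have xG: "x \<in> carrier G" using x P.mem_carrier by simp
        have "\<phi> (inv\<^bsub>G\<^esub> x \<otimes>\<^bsub>G\<^esub> g) = h"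
          using x xG g by (simp add: \<phi>.H.inv_mult_cancel)
        then have "inv\<^bsub>G\<^esub> x \<otimes>\<^bsub>G\<^esub> g \<in> H" using x xG g by (simp add: H_def)
        moreover have "g = x \<otimes>\<^bsub>G\<^esub> (inv\<^bsub>G\<^esub> x \<otimes>\<^bsub>G\<^esub> g)" using xG g by (simp add: inv_mult_cancel)
        ultimately show ?thesis using x by blast
      qed
      ultimately show ?thesis using H by blast
    qed
  qed
qed


section \<open>Combining cocycles\<close>

context cocycle
begin

lemma pullback:
  assumes "group_hom K G \<phi>"
  shows "cocycle K M (\<lambda>k. act (\<phi> k)) (\<lambda>k. \<pi> (\<phi> k))"
proof -
  interpret \<phi>: group_hom K G \<phi> by fact
  show ?thesis
    by unfold_locales (auto simp: act_hom act_mult act_one cocycle_closed cocycle_mult)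
qed

lemma card_fibres:
  assumes fin: "finite (carrier G)" and surj: "\<pi> ` carrier G = carrier M"
  shows "order G = card (carrier M) * card {g \<in> carrier G. \<pi> g = \<one>\<^bsub>M\<^esub>}"
proof -
  have fibre: "card {g \<in> carrier G. \<pi> g = m} = card {g \<in> carrier G. \<pi> g = \<one>\<^bsub>M\<^esub>}"
    if m: "m \<in> carrier M" for m
  proof -
    obtain s where s: "s \<in> carrier G" "m = \<pi> s" using m surj by auto
    have "\<pi> (s \<otimes> x) = m \<longleftrightarrow> \<pi> x = \<one>\<^bsub>M\<^esub>" if "x \<in> carrier G" for x
      using same_value_iff[of s "s \<otimes> x"] s that by (auto simp: G.inv_mult_cancel)
    moreover have "\<pi> (inv s \<otimes> x) = \<one>\<^bsub>M\<^esub> \<longleftrightarrow> \<pi> x = m" if "x \<in> carrier G" for x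
      using same_value_iff[of s x] s that by auto
    ultimately have "bij_betw (\<lambda>x. s \<otimes> x) {g \<in> carrier G. \<pi> g = \<one>\<^bsub>M\<^esub>} {g \<in> carrier G. \<pi> g = m}"
      by (intro bij_betw_byWitness[where f' = "\<lambda>x. inv s \<otimes> x"])
        (use s in \<open>auto simp: G.inv_mult_cancel\<close>)
    then show ?thesis by (simp add: bij_betw_same_card)
  qed
  have "finite (carrier M)" using fin surj by (metis finite_imageI)
  then have "order G = (\<Sum>m\<in>carrier M. card {g \<in> carrier G. \<pi> g = m})"
    using sum.group[OF fin, of "carrier M" \<pi> "\<lambda>_. 1 :: nat"] surj
    by (simp add: order_def)
  also have "\<dots> = (\<Sum>m\<in>carrier M. card {g \<in> carrier G. \<pi> g = \<one>\<^bsub>M\<^esub>})"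
    by (intro sum.cong refl fibre)
  finally show ?thesis by simp
qed

lemma transport:
  assumes "group N" and f: "f \<in> iso M N"
  shows "cocycle G N (\<lambda>g n. f (act g (inv_into (carrier M) f n))) (\<lambda>g. f (\<pi> g))"
proof -
  interpret N: group N by fact
  interpret f: group_hom M N f
    using f by unfold_locales (auto simp: iso_def)
  have bij: "bij_betw f (carrier M) (carrier N)" using f by (simp add: iso_def)
  let ?f = "inv_into (carrier M) f"
  have fc: "?f n \<in> carrier M" if "n \<in> carrier N" for n
    using that bij by (metis bij_betw_def inv_into_into)
  have ff: "f (?f n) = n" if "n \<in> carrier N" for n
    using that bij by (metis bij_betw_inv_into_right)
  have ff': "?f (f m) = m" if "m \<in> carrier M" for m
    using that bij by (metis bij_betw_inv_into_left)
  have fm: "?f (n \<otimes>\<^bsub>N\<^esub> n') = ?f n \<otimes>\<^bsub>M\<^esub> ?f n'" if "n \<in> carrier N" "n' \<in> carrier N" for n n'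
    using ff'[of "?f n \<otimes>\<^bsub>M\<^esub> ?f n'"] that by (simp add: fc ff)
  interpret N: comm_group N
    using M.iso_imp_comm_group[of N] f N.is_monoid by (auto simp: is_iso_def)
  show ?thesis
    by unfold_locales
      (auto simp: hom_def fc ff ff' fm act_distrib act_mult act_one cocycle_closed cocycle_mult)
qed

end

lemma cocycle_product:
  assumes "cocycle G M act \<pi>" and "cocycle G N act' \<pi>'"
  shows "cocycle G (M \<times>\<times> N) (\<lambda>g (m, n). (act g m, act' g n)) (\<lambda>g. (\<pi> g, \<pi>' g))"
proof -
  interpret c: cocycle G M act \<pi> by fact
  interpret d: cocycle G N act' \<pi>' by fact
  interpret MN: comm_group "M \<times>\<times> N"
    by (rule group.group_comm_groupI[OF DirProd_group[OF c.M.is_group d.M.is_group]])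
      (auto simp: c.M.m_comm d.M.m_comm)
  show ?thesis
    by unfold_locales
      (auto simp: hom_def c.act_distrib d.act_distrib c.act_mult d.act_mult c.act_one d.act_one
         c.cocycle_closed d.cocycle_closed c.cocycle_mult d.cocycle_mult)
qed

lemma not_dvd_multiplicity_quotient:
  fixes n :: nat
  assumes p: "prime p" and n: "n > 0" and eq: "n = p ^ multiplicity p n * m"
  shows "\<not> p dvd m"
proof
  assume "p dvd m"
  then obtain k where "m = p * k" by blast
  then have "n = p ^ Suc (multiplicity p n) * k" using eq by (simp add: mult_ac)
  then have "p ^ Suc (multiplicity p n) dvd n" by (metis dvd_triv_left)
  then show False
    using p n by (metis Suc_n_not_le_n multiplicity_geI neq0_conv not_prime_unit)
qed

text \<open>
  Any finite module can be transported to natural numbers, so that fixing this type is no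
  restriction; it lets the module vary under the existential quantifier.
\<close>

definition has_onto_cocycle :: "('g, 'b) monoid_scheme \<Rightarrow> nat \<Rightarrow> bool" where
  "has_onto_cocycle G n \<longleftrightarrow> (\<exists>(M :: nat monoid) act \<pi>. cocycle G M act \<pi> \<and>
     finite (carrier M) \<and> card (carrier M) = n \<and> \<pi> ` carrier G = carrier M)"

lemma nat_cocycle:
  fixes M :: "'m monoid"
  assumes "cocycle G M act \<pi>" and fin: "finite (carrier M)"
  obtains N :: "nat monoid" and act' and f where
    "cocycle G N act' (\<lambda>g. f (\<pi> g))" "f \<in> iso M N"
proof -
  interpret cocycle G M act \<pi> by fact
  obtain N :: "nat monoid" and f where N: "group N" "f \<in> iso M N"
    using finite_group_iso_nat[OF M.is_group fin] by blast
  show thesis using that[OF transport[OF N] N(2)] .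
qed

lemma has_onto_cocycleI:
  fixes M :: "'m monoid"
  assumes c: "cocycle G M act \<pi>" and fin: "finite (carrier M)"
    and surj: "\<pi> ` carrier G = carrier M"
  shows "has_onto_cocycle G (card (carrier M))"
proof -
  obtain N :: "nat monoid" and act' and f where
    N: "cocycle G N act' (\<lambda>g. f (\<pi> g))" "f \<in> iso M N"
    using nat_cocycle[OF c fin] by blast
  have b: "bij_betw f (carrier M) (carrier N)" using N(2) by (simp add: iso_def)
  have "(\<lambda>g. f (\<pi> g)) ` carrier G = f ` carrier M" by (simp add: image_image flip: surj)
  then have "(\<lambda>g. f (\<pi> g)) ` carrier G = carrier N" using b by (simp add: bij_betw_def)
  moreover have "finite (carrier N)" "card (carrier N) = card (carrier M)"
    using b fin bij_betw_finite bij_betw_same_card by metis+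
  ultimately show ?thesis using N(1) unfolding has_onto_cocycle_def by blast
qed

lemma has_onto_cocycle_pullback:
  assumes "group_hom G K \<phi>" "\<phi> ` carrier G = carrier K" "has_onto_cocycle K n"
  shows "has_onto_cocycle G n"
proof -
  obtain M :: "nat monoid" and act \<pi> where c: "cocycle K M act \<pi>"
    and M: "finite (carrier M)" "card (carrier M) = n" "\<pi> ` carrier K = carrier M"
    using assms(3) by (auto simp: has_onto_cocycle_def)
  have "(\<lambda>g. \<pi> (\<phi> g)) ` carrier G = carrier M"
    using M(3) assms(2) by (simp flip: image_image[of \<pi> \<phi>])
  then show ?thesis
    using cocycle.pullback[OF c assms(1)] M unfolding has_onto_cocycle_def by blast
qed

text \<open>
  Pairing a cocycle \<open>\<delta>\<close> onto \<open>A\<close> with one pulled back along \<open>\<phi>\<close> stays surjective if \<open>\<delta>\<close> is already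
  onto on \<open>N\<close>: a preimage of the second component may be multiplied by elements of \<open>N\<close>, and as
  these act trivially on \<open>A\<close>, this shifts the first component by an arbitrary amount.
\<close>

lemma has_onto_cocycle_extend:
  fixes A :: "'m monoid"
  assumes c: "cocycle G A act \<delta>" and finA: "finite (carrier A)"
    and hom: "group_hom G K \<phi>" and surj: "\<phi> ` carrier G = carrier K"
    and N: "N \<subseteq> carrier G" and \<delta>N: "\<delta> ` N = carrier A"
    and triv: "\<And>a m. \<lbrakk>a \<in> N; m \<in> carrier A\<rbrakk> \<Longrightarrow> act a m = m"
    and ker: "\<And>a. a \<in> N \<Longrightarrow> \<phi> a = \<one>\<^bsub>K\<^esub>"
    and K: "has_onto_cocycle K n"
  shows "has_onto_cocycle G (card (carrier A) * n)"
proof -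
  obtain M :: "nat monoid" and act' \<pi> where c': "cocycle K M act' \<pi>"
    and M: "finite (carrier M)" "card (carrier M) = n" "\<pi> ` carrier K = carrier M"
    using K by (auto simp: has_onto_cocycle_def)
  interpret \<phi>: group_hom G K \<phi> by fact
  interpret c: cocycle G A act \<delta> by fact
  interpret d: cocycle G M "\<lambda>g. act' (\<phi> g)" "\<lambda>g. \<pi> (\<phi> g)"
    using cocycle.pullback[OF c' hom] .
  have "(\<lambda>g. (\<delta> g, \<pi> (\<phi> g))) ` carrier G = carrier (A \<times>\<times> M)"
  proof
    show "carrier (A \<times>\<times> M) \<subseteq> (\<lambda>g. (\<delta> g, \<pi> (\<phi> g))) ` carrier G"
    proof (clarsimp)
      fix a m assume a: "a \<in> carrier A" and m: "m \<in> carrier M"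
      then obtain g where g: "g \<in> carrier G" "m = \<pi> (\<phi> g)"
        using M(3) surj by (metis (no_types, lifting) imageE)
      have "a \<otimes>\<^bsub>A\<^esub> inv\<^bsub>A\<^esub> \<delta> g \<in> \<delta> ` N" using a g \<delta>N c.cocycle_closed by simp
      then obtain b where b: "b \<in> N" "a \<otimes>\<^bsub>A\<^esub> inv\<^bsub>A\<^esub> \<delta> g = \<delta> b" by blast
      then have bG: "b \<in> carrier G" using N by blast
      have "\<delta> (b \<otimes>\<^bsub>G\<^esub> g) = a"
        using a b bG g triv c.cocycle_closed
        by (simp add: c.cocycle_mult c.M.m_assoc flip: b(2))
      moreover have "\<phi> (b \<otimes>\<^bsub>G\<^esub> g) = \<phi> g" using b bG g ker by simp
      ultimately show "(a, m) \<in> (\<lambda>g. (\<delta> g, \<pi> (\<phi> g))) ` carrier G"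
        using g bG by (intro image_eqI[of _ _ "b \<otimes>\<^bsub>G\<^esub> g"]) auto
    qed
  qed (auto simp: c.cocycle_closed d.cocycle_closed)
  then show ?thesis
    using has_onto_cocycleI[OF cocycle_product[OF c.cocycle_axioms d.cocycle_axioms]] finA M(1,2)
    by (simp add: card_cartesian_product)
qed

text \<open>
  The product over a set of primes is built up one prime at a time. What has to be remembered
  about it is the order of the target and that no prime of the set divides the order of the
  subgroup where the cocycle vanishes.
\<close>

lemma bijective_cocycle_from_prime_parts:
  assumes G: "group G" and fin: "finite (carrier G)"
    and prime_part: "\<And>p. \<lbrakk>prime p; p dvd order G\<rbrakk> \<Longrightarrow> has_onto_cocycle G (p ^ multiplicity p (order G))"
  shows "\<exists>(M :: nat monoid) act \<pi>. cocycle G M act \<pi> \<and> bij_betw \<pi> (carrier G) (carrier M)"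
proof -
  interpret G: group G by fact
  have oG: "order G > 0" using fin G.order_gt_0_iff_finite by blast
  let ?S = "\<lambda>M \<pi>. {g \<in> carrier G. \<pi> g = \<one>\<^bsub>M\<^esub>}"
  have "\<exists>(M :: nat monoid) act \<pi>. cocycle G M act \<pi> \<and> finite (carrier M) \<and>
      card (carrier M) = (\<Prod>p\<in>F. p ^ multiplicity p (order G)) \<and> (\<forall>p\<in>F. \<not> p dvd card (?S M \<pi>))"
    if "finite F" "F \<subseteq> prime_factors (order G)" for F
    using that
  proof (induction F rule: finite_induct)
    case empty
    interpret T: comm_group "singleton_group (0 :: nat)"
      by (rule comm_groupI) (auto simp: singleton_group_def)
    have "cocycle G (singleton_group (0 :: nat)) (\<lambda>_ m. m) (\<lambda>_. 0)"
      by unfold_locales (auto simp: hom_def singleton_group_def)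
    then show ?case
      by (intro exI[of _ "singleton_group (0 :: nat)"] exI conjI) auto
  next
    case (insert p F)
    then obtain M :: "nat monoid" and act \<pi> where M: "cocycle G M act \<pi>" "finite (carrier M)"
        "card (carrier M) = (\<Prod>p\<in>F. p ^ multiplicity p (order G))"
        "\<forall>p\<in>F. \<not> p dvd card (?S M \<pi>)"
      by auto
    have p: "prime p" "p dvd order G" using insert.prems by auto
    obtain N :: "nat monoid" and act' \<pi>' where N: "cocycle G N act' \<pi>'" "finite (carrier N)"
        "card (carrier N) = p ^ multiplicity p (order G)" "\<pi>' ` carrier G = carrier N"
      using prime_part[OF p] by (auto simp: has_onto_cocycle_def)
    interpret c: cocycle G M act \<pi> by fact
    interpret d: cocycle G N act' \<pi>' by fact
    have "order G = p ^ multiplicity p (order G) * card (?S N \<pi>')"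
      using d.card_fibres[OF fin N(4)] N(3) by simp
    then have ndvd: "\<not> p dvd card (?S N \<pi>')"
      by (rule not_dvd_multiplicity_quotient[OF p(1) oG])
    define MN where "MN = M \<times>\<times> N"
    define \<rho> where "\<rho> = (\<lambda>g. (\<pi> g, \<pi>' g))"
    have "cocycle G MN (\<lambda>g (m, n). (act g m, act' g n)) \<rho>"
      unfolding MN_def \<rho>_def using cocycle_product[OF M(1) N(1)] .
    moreover have finMN: "finite (carrier MN)" using M(2) N(2) by (simp add: MN_def)
    ultimately obtain R :: "nat monoid" and act'' and f where
      R: "cocycle G R act'' (\<lambda>g. f (\<rho> g))" "f \<in> iso MN R"
      using nat_cocycle by blast
    interpret e: cocycle G MN "\<lambda>g (m, n). (act g m, act' g n)" \<rho> by fact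
    interpret r: cocycle G R act'' "\<lambda>g. f (\<rho> g)" by fact
    interpret f: group_hom MN R f
      using R(2) by unfold_locales (simp add: iso_def)
    have bij: "bij_betw f (carrier MN) (carrier R)" using R(2) by (simp add: iso_def)
    have S: "?S R (\<lambda>g. f (\<rho> g)) = ?S M \<pi> \<inter> ?S N \<pi>'"
    proof -
      have "f (\<rho> g) = \<one>\<^bsub>R\<^esub> \<longleftrightarrow> \<rho> g = \<one>\<^bsub>MN\<^esub>" if "g \<in> carrier G" for g
        using bij that e.cocycle_closed
        by (metis bij_betw_def f.hom_one inj_onD e.M.one_closed)
      then show ?thesis by (auto simp: MN_def \<rho>_def)
    qed
    have sub: "subgroup (?S R (\<lambda>g. f (\<rho> g))) G" by (rule r.stabilizer_subgroup)
    have dvds: "card (?S R (\<lambda>g. f (\<rho> g))) dvd card (?S M \<pi>)"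
      "card (?S R (\<lambda>g. f (\<rho> g))) dvd card (?S N \<pi>')"
      by (rule G.card_subgroup_dvd[OF fin sub c.stabilizer_subgroup]; simp add: S)
        (rule G.card_subgroup_dvd[OF fin sub d.stabilizer_subgroup]; simp add: S)
    have "\<forall>q\<in>insert p F. \<not> q dvd card (?S R (\<lambda>g. f (\<rho> g)))"
      using M(4) ndvd dvd_trans[OF _ dvds(1)] dvd_trans[OF _ dvds(2)] by auto
    moreover have "finite (carrier R)" "card (carrier R) = card (carrier MN)"
      using bij_betw_finite[OF bij] bij_betw_same_card[OF bij] finMN by simp_all
    moreover have "card (carrier MN) = (\<Prod>p\<in>insert p F. p ^ multiplicity p (order G))"
      using M(3) N(3) insert.hyps by (simp add: MN_def card_cartesian_product mult.commute)
    ultimately show ?case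
      using R(1) by (intro exI[of _ R] exI[of _ act''] exI[of _ "\<lambda>g. f (\<rho> g)"]) simp
  qed
  from this[of "prime_factors (order G)"]
  obtain M :: "nat monoid" and act \<pi> where M: "cocycle G M act \<pi>" "finite (carrier M)"
      "card (carrier M) = (\<Prod>p\<in>prime_factors (order G). p ^ multiplicity p (order G))"
      "\<forall>p\<in>prime_factors (order G). \<not> p dvd card (?S M \<pi>)"
    by auto
  interpret c: cocycle G M act \<pi> by fact
  have card_eq: "card (carrier M) = order G"
    using M(3) prime_factorization_nat[OF oG] by simp
  have dvd: "card (?S M \<pi>) dvd order G"
    using G.card_subgroup_dvd[OF fin c.stabilizer_subgroup G.subgroup_self] by (auto simp: order_def)
  have "card (?S M \<pi>) = 1"
  proof (rule ccontr)
    assume "card (?S M \<pi>) \<noteq> 1"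
    then obtain q where q: "prime q" "q dvd card (?S M \<pi>)" using prime_factor_nat by blast
    then have "q \<in> prime_factors (order G)"
      using dvd_trans[OF q(2) dvd] oG by (simp add: in_prime_factors_iff)
    with M(4) q(2) show False by blast
  qed
  then obtain s where "?S M \<pi> = {s}" by (auto simp: card_1_singleton_iff)
  moreover have "\<one>\<^bsub>G\<^esub> \<in> ?S M \<pi>" using c.cocycle_one by simp
  ultimately have S: "?S M \<pi> = {\<one>\<^bsub>G\<^esub>}" by auto
  have inj: "inj_on \<pi> (carrier G)"
  proof (rule inj_onI)
    fix g h assume gh: "g \<in> carrier G" "h \<in> carrier G" "\<pi> g = \<pi> h"
    then have "inv\<^bsub>G\<^esub> g \<otimes>\<^bsub>G\<^esub> h \<in> ?S M \<pi>" using c.same_value_iff by simp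
    then have "inv\<^bsub>G\<^esub> g \<otimes>\<^bsub>G\<^esub> h = \<one>\<^bsub>G\<^esub>" using S by blast
    then show "g = h" using gh by (metis G.inv_closed G.inv_equality G.inv_inv)
  qed
  have "\<pi> ` carrier G = carrier M"
    by (rule card_subset_eq)
      (use M(2) c.cocycle_closed card_image[OF inj] card_eq in \<open>auto simp: order_def\<close>)
  then show ?thesis using M(1) inj by (auto simp: bij_betw_def)
qed


section \<open>Cocycles from central bimultiplicative forms\<close>

text \<open>
  A form \<open>b\<close> with these properties makes \<open>x y b(x,y)\<close> a commutative group law on \<open>P\<close>: the
  commutator of \<open>P\<close> is exactly the antisymmetrization of \<open>b\<close>. Since \<open>b\<close> vanishes on its own
  values, bimultiplicativity yields associativity. Together with the product of \<open>P\<close> the new law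
  forms a left brace.
\<close>

locale central_form = group G + P: subgroup P G
  for G :: "('a, 'c) monoid_scheme" (structure) and P +
  fixes b :: "'a \<Rightarrow> 'a \<Rightarrow> 'a"
  assumes b_closed [simp]: "\<lbrakk>x \<in> P; y \<in> P\<rbrakk> \<Longrightarrow> b x y \<in> P"
    and b_central: "\<lbrakk>x \<in> P; y \<in> P; w \<in> P\<rbrakk> \<Longrightarrow> b x y \<otimes> w = w \<otimes> b x y"
    and b_left: "\<lbrakk>x \<in> P; x' \<in> P; y \<in> P\<rbrakk> \<Longrightarrow> b (x \<otimes> x') y = b x y \<otimes> b x' y"
    and b_right: "\<lbrakk>x \<in> P; y \<in> P; y' \<in> P\<rbrakk> \<Longrightarrow> b x (y \<otimes> y') = b x y \<otimes> b x y'"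
    and b_b_left [simp]: "\<lbrakk>x \<in> P; y \<in> P; w \<in> P\<rbrakk> \<Longrightarrow> b (b x y) w = \<one>"
    and b_b_right [simp]: "\<lbrakk>x \<in> P; y \<in> P; w \<in> P\<rbrakk> \<Longrightarrow> b w (b x y) = \<one>"
    and b_commutes: "\<lbrakk>x \<in> P; y \<in> P\<rbrakk> \<Longrightarrow> x \<otimes> y \<otimes> b x y = y \<otimes> x \<otimes> b y x"
begin

lemma P_carrier [simp]: "x \<in> P \<Longrightarrow> x \<in> carrier G"
  by (rule P.mem_carrier)

lemma b_one_left [simp]: "y \<in> P \<Longrightarrow> b \<one> y = \<one>"
  using b_left[of \<one> \<one> y] by (simp add: l_cancel_one' )

lemma b_one_right [simp]: "y \<in> P \<Longrightarrow> b y \<one> = \<one>"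
  using b_right[of y \<one> \<one>] by (simp add: l_cancel_one')

lemma b_inv_left: "\<lbrakk>x \<in> P; y \<in> P\<rbrakk> \<Longrightarrow> b (inv x) y = inv (b x y)"
  using b_left[of "inv x" x y] inv_equality[of "b (inv x) y" "b x y"] by simp

lemma b_inv_right: "\<lbrakk>x \<in> P; y \<in> P\<rbrakk> \<Longrightarrow> b x (inv y) = inv (b x y)"
  using b_right[of x "inv y" y] inv_equality[of "b x (inv y)" "b x y"] by simp

definition plus :: "'a \<Rightarrow> 'a \<Rightarrow> 'a" where "plus x y = x \<otimes> y \<otimes> b x y"

definition plus_group :: "'a monoid" where
  "plus_group = \<lparr>carrier = P, monoid.mult = plus, one = \<one>\<rparr>"

lemma inv_b_central: "\<lbrakk>x \<in> P; y \<in> P; w \<in> P\<rbrakk> \<Longrightarrow> inv (b x y) \<otimes> w = w \<otimes> inv (b x y)"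
  using b_central[of "inv x" y w] by (simp add: b_inv_left)

lemma plus_assoc:
  assumes "x \<in> P" "y \<in> P" "w \<in> P"
  shows "plus (plus x y) w = plus x (plus y w)"
proof -
  have "plus (plus x y) w = x \<otimes> y \<otimes> (b x y \<otimes> w) \<otimes> (b x w \<otimes> b y w)"
    using assms by (simp add: plus_def b_left m_assoc)
  also have "\<dots> = x \<otimes> y \<otimes> w \<otimes> (b x y \<otimes> b x w \<otimes> b y w)"
    using assms by (simp add: b_central[of x y w] m_assoc)
  also have "b x y \<otimes> b x w \<otimes> b y w = b y w \<otimes> (b x y \<otimes> b x w)"
    using assms by (simp add: b_central[of y w])
  finally show ?thesis
    using assms by (simp add: plus_def b_right m_assoc)
qed

lemma comm_group_plus_group: "comm_group plus_group"
proof (rule comm_groupI)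
  fix x assume "x \<in> carrier plus_group"
  then have x: "x \<in> P" by (simp add: plus_group_def)
  have "plus (inv x \<otimes> b x x) x = inv x \<otimes> (b x x \<otimes> x) \<otimes> inv (b x x)"
    using x by (simp add: plus_def b_left b_inv_left m_assoc)
  also have "\<dots> = \<one>"
    using x by (simp add: b_central[of x x x] m_assoc inv_mult_cancel)
  finally show "\<exists>y\<in>carrier plus_group. y \<otimes>\<^bsub>plus_group\<^esub> x = \<one>\<^bsub>plus_group\<^esub>"
    using x by (intro bexI[of _ "inv x \<otimes> b x x"]) (simp_all add: plus_group_def)
qed (auto simp: plus_group_def plus_assoc, auto simp: plus_def b_commutes)

text \<open>
  The brace action of \<open>x\<close> on the additive group, \<open>twist x y = - x + x y\<close>.
\<close>

definition twist :: "'a \<Rightarrow> 'a \<Rightarrow> 'a" where "twist x y = y \<otimes> inv (b x y)"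

lemma plus_closed [simp]: "\<lbrakk>x \<in> P; y \<in> P\<rbrakk> \<Longrightarrow> plus x y \<in> P"
  by (simp add: plus_def)

lemma twist_closed [simp]: "\<lbrakk>x \<in> P; y \<in> P\<rbrakk> \<Longrightarrow> twist x y \<in> P"
  by (simp add: twist_def)

lemma b_twist [simp]: "\<lbrakk>x \<in> P; y \<in> P; w \<in> P\<rbrakk> \<Longrightarrow> b w (twist x y) = b w y"
  by (simp add: twist_def b_right b_inv_right)

lemma b_twist_left [simp]: "\<lbrakk>x \<in> P; y \<in> P; w \<in> P\<rbrakk> \<Longrightarrow> b (twist x y) w = b y w"
  by (simp add: twist_def b_left b_inv_left)

lemma plus_twist: "\<lbrakk>x \<in> P; y \<in> P\<rbrakk> \<Longrightarrow> plus x (twist x y) = x \<otimes> y"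
  by (simp add: plus_def) (simp add: twist_def m_assoc)

lemma twist_mult: "\<lbrakk>x \<in> P; x' \<in> P; y \<in> P\<rbrakk> \<Longrightarrow> twist (x \<otimes> x') y = twist x (twist x' y)"
  by (subst (1 2) twist_def) (simp add: b_left b_right b_inv_right inv_mult_group twist_def m_assoc)

lemma twist_one: "y \<in> P \<Longrightarrow> twist \<one> y = y"
  by (simp add: twist_def)

lemma twist_plus:
  assumes "x \<in> P" "y \<in> P" "w \<in> P"
  shows "twist x (plus y w) = plus (twist x y) (twist x w)"
proof -
  have "plus (twist x y) (twist x w) = y \<otimes> (inv (b x y) \<otimes> w) \<otimes> inv (b x w) \<otimes> b y w"
    using assms by (simp add: plus_def) (simp add: twist_def m_assoc)
  also have "\<dots> = y \<otimes> w \<otimes> (inv (b x y) \<otimes> inv (b x w) \<otimes> b y w)"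
    using assms by (simp add: inv_b_central[of x y w] m_assoc)
  also have "inv (b x y) \<otimes> inv (b x w) \<otimes> b y w = b y w \<otimes> (inv (b x y) \<otimes> inv (b x w))"
    using assms by (simp add: b_central[of y w])
  also have "inv (b x y) \<otimes> inv (b x w) = inv (b x w) \<otimes> inv (b x y)"
    using assms by (intro inv_b_central) auto
  finally show ?thesis
    using assms by (simp add: twist_def plus_def b_right inv_mult_group m_assoc)
qed

text \<open>
  Every \<open>g\<close> is uniquely \<open>x h\<close> with \<open>x \<in> P\<close> and \<open>h \<in> H\<close>. The cocycle is \<open>x h \<mapsto> x\<close>, where \<open>x h\<close> acts by
  conjugation with \<open>h\<close> followed by the brace action of \<open>x\<close>. Equivariance of the form makes \<open>H\<close>
  act by automorphisms of the brace.
\<close>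

lemma has_onto_cocycle_of_complement:
  assumes fin: "finite (carrier G)" and normal: "P \<lhd> G"
    and H: "subgroup H G" and HP: "H \<inter> P = {\<one>}"
    and fac: "\<And>g. g \<in> carrier G \<Longrightarrow> \<exists>x\<in>P. \<exists>h\<in>H. g = x \<otimes> h"
    and equiv: "\<And>h x y. \<lbrakk>h \<in> H; x \<in> P; y \<in> P\<rbrakk>
      \<Longrightarrow> h \<otimes> b x y \<otimes> inv h = b (h \<otimes> x \<otimes> inv h) (h \<otimes> y \<otimes> inv h)"
  shows "has_onto_cocycle G (card P)"
proof -
  interpret N: normal P G by fact
  interpret H: subgroup H G by fact
  interpret M: comm_group plus_group by (rule comm_group_plus_group)
  define part where "part g = (SOME x. x \<in> P \<and> inv x \<otimes> g \<in> H)" for g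
  define rest where "rest g = inv (part g) \<otimes> g" for g
  have part_ex: "\<exists>x. x \<in> P \<and> inv x \<otimes> g \<in> H" if "g \<in> carrier G" for g
    using fac[OF that] by (metis H.mem_carrier P_carrier inv_mult_cancel(1))
  have part [simp]: "part g \<in> P" and rest [simp]: "rest g \<in> H" if "g \<in> carrier G" for g
    using someI_ex[OF part_ex[OF that]] by (auto simp: part_def rest_def)
  have dec: "g = part g \<otimes> rest g" if "g \<in> carrier G" for g
    using that by (simp add: rest_def inv_mult_cancel)
  have uniq: "part (x \<otimes> h) = x \<and> rest (x \<otimes> h) = h" if x: "x \<in> P" and h: "h \<in> H" for x h
  proof -
    let ?g = "x \<otimes> h"
    have g: "?g \<in> carrier G" using x h by (simp add: H.mem_carrier)
    have p: "part ?g \<in> carrier G" and r: "rest ?g \<in> carrier G"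
      using g part rest by (simp_all add: H.mem_carrier)
    have eq: "x \<otimes> h = part ?g \<otimes> rest ?g" by (rule dec[OF g])
    have "inv (part ?g) \<otimes> x = rest ?g \<otimes> inv h"
    proof -
      have "inv (part ?g) \<otimes> x = inv (part ?g) \<otimes> (x \<otimes> h) \<otimes> inv h"
        using x h p by (simp add: H.mem_carrier m_assoc)
      also have "\<dots> = rest ?g \<otimes> inv h"
        using p r h by (subst eq) (simp add: H.mem_carrier inv_mult_cancel)
      finally show ?thesis .
    qed
    moreover have "inv (part ?g) \<otimes> x \<in> P" "rest ?g \<otimes> inv h \<in> H"
      using x h g part rest by simp_all
    ultimately have "inv (part ?g) \<otimes> x = \<one>" "rest ?g \<otimes> inv h = \<one>"
      using HP by auto
    then show ?thesis
      using x h p r H.mem_carrier by (metis P_carrier inv_equality inv_inv inv_closed)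
  qed
  have conj_P [simp]: "g \<otimes> x \<otimes> inv g \<in> P" if "g \<in> carrier G" "x \<in> P" for g x
    using that N.inv_op_closed2 by simp
  have mult: "part (g \<otimes> k) = part g \<otimes> (rest g \<otimes> part k \<otimes> inv (rest g)) \<and>
      rest (g \<otimes> k) = rest g \<otimes> rest k"
    if g: "g \<in> carrier G" and k: "k \<in> carrier G" for g k
  proof -
    have c: "part g \<in> carrier G" "rest g \<in> carrier G" "part k \<in> carrier G" "rest k \<in> carrier G"
      using g k by (simp_all add: H.mem_carrier)
    have "g \<otimes> k = (part g \<otimes> rest g) \<otimes> (part k \<otimes> rest k)"
      using dec[OF g] dec[OF k] by simp
    also have "\<dots> = (part g \<otimes> (rest g \<otimes> part k \<otimes> inv (rest g))) \<otimes> (rest g \<otimes> rest k)"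
      using c by (simp add: m_assoc inv_mult_cancel)
    finally show ?thesis
      using uniq[of "part g \<otimes> (rest g \<otimes> part k \<otimes> inv (rest g))" "rest g \<otimes> rest k"] g k c
      by simp
  qed
  define act where "act g m = twist (part g) (rest g \<otimes> m \<otimes> inv (rest g))" for g m
  have restG [simp]: "rest g \<in> carrier G" if "g \<in> carrier G" for g
    using that rest H.mem_carrier by blast
  have twist_conj: "h \<otimes> twist x y \<otimes> inv h = twist (h \<otimes> x \<otimes> inv h) (h \<otimes> y \<otimes> inv h)"
    if "h \<in> H" "x \<in> P" "y \<in> P" for h x y
    using that by (simp add: twist_def conj_mult H.mem_carrier flip: conj_inv equiv)
  have plus_conj: "h \<otimes> plus x y \<otimes> inv h = plus (h \<otimes> x \<otimes> inv h) (h \<otimes> y \<otimes> inv h)"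
    if "h \<in> H" "x \<in> P" "y \<in> P" for h x y
    using that by (simp add: plus_def conj_mult H.mem_carrier flip: equiv)
  have "part \<one> = \<one>" "rest \<one> = \<one>" using uniq[of \<one> \<one>] by simp_all
  then have act_one: "act \<one> m = m" if "m \<in> P" for m
    using that by (simp add: act_def twist_one)
  have "cocycle G plus_group act part"
  proof unfold_locales
    fix g assume g: "g \<in> carrier G"
    then show "act g \<in> hom plus_group plus_group"
      by (auto simp: hom_def plus_group_def act_def plus_conj twist_plus)
    show "part g \<in> carrier plus_group" using g by (simp add: plus_group_def)
    fix k assume k: "k \<in> carrier G"
    show "part (g \<otimes> k) = part g \<otimes>\<^bsub>plus_group\<^esub> act g (part k)"
      using g k mult by (simp add: plus_group_def act_def plus_twist)
    fix m assume "m \<in> carrier plus_group"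
    then have m: "m \<in> P" by (simp add: plus_group_def)
    show "act (g \<otimes> k) m = act g (act k m)"
      using g k m by (simp add: act_def mult twist_conj twist_mult conj_conj)
  qed (simp add: plus_group_def act_one)
  moreover have "part ` carrier G = carrier plus_group"
  proof
    show "carrier plus_group \<subseteq> part ` carrier G"
    proof
      fix x assume "x \<in> carrier plus_group"
      then have "x \<in> P" by (simp add: plus_group_def)
      then have "part x = x" "x \<in> carrier G" using uniq[of x \<one>] by simp_all
      then show "x \<in> part ` carrier G" by (metis imageI)
    qed
  qed (auto simp: plus_group_def)
  moreover have "finite (carrier plus_group)"
    using fin P.subset finite_subset by (auto simp: plus_group_def)
  ultimately show ?thesis
    using has_onto_cocycleI[of G plus_group act part] by (simp add: plus_group_def)
qed

end


section \<open>Averaging central commutators\<close>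

lemma (in comm_group) hom_finprod:
  assumes f: "f \<in> hom G G" and fin: "finite Q" and g: "g \<in> Q \<rightarrow> carrier G"
  shows "f (finprod G g Q) = finprod G (\<lambda>y. f (g y)) Q"
  using fin g
proof (induction Q rule: finite_induct)
  case empty
  interpret f: group_hom G G f using f by unfold_locales
  show ?case by simp
next
  case (insert y Q)
  then have "g y \<in> carrier G" "g \<in> Q \<rightarrow> carrier G" "finprod G g Q \<in> carrier G" by auto
  moreover have "f (g z) \<in> carrier G" if "z \<in> insert y Q" for z
    using f insert.prems that by (auto simp: hom_def)
  ultimately show ?case
    using insert f by (simp add: hom_mult[OF f] Pi_def)
qed

text \<open>
  With \<open>c u y = [u,y]\<close> the product \<open>\<nu> u\<close> of all \<open>c u y\<close>, \<open>y \<in> Q\<close>, is multiplicative in \<open>u\<close> because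
  the commutators are central in \<open>U\<close>, and it commutes with conjugation by \<open>N(Q)\<close>, which permutes
  \<open>Q\<close>. The conjugates of \<open>c u y0\<close> under \<open>Q\<close> have product \<open>1\<close>, since the conjugate by \<open>y\<close> is
  \<open>inv (c u y) \<otimes> c u (y \<otimes> y0)\<close> and the product over \<open>y\<close> telescopes. Hence \<open>\<nu>\<close> raises the
  commutators, and then all elements of its image \<open>A\<close>, to the power \<open>|Q|\<close>; this power map is a
  permutation of the \<open>p\<close>-group \<open>A\<close>. If \<open>A\<close> is trivial, the same formula shows that all the
  commutators are trivial.
\<close>

lemma (in group) central_commutator_cocycle:
  assumes fin: "finite (carrier G)" and U: "U \<lhd> G" and p: "prime p" and cU: "card U = p ^ e"
    and Q: "subgroup Q G" and pQ: "\<not> p dvd card Q"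
    and fac: "\<And>g. g \<in> carrier G \<Longrightarrow> \<exists>u\<in>U. \<exists>h\<in>conj_normalizer G Q. g = u \<otimes> h"
    and QU: "Q \<inter> U = {\<one>}"
    and cen: "\<And>u y w. \<lbrakk>u \<in> U; y \<in> Q; w \<in> U\<rbrakk>
      \<Longrightarrow> (u \<otimes> (y \<otimes> inv u \<otimes> inv y)) \<otimes> w = w \<otimes> (u \<otimes> (y \<otimes> inv u \<otimes> inv y))"
  obtains A act \<delta> where "A \<lhd> G" "A \<subseteq> U" "cocycle G (G\<lparr>carrier := A\<rparr>) act \<delta>" "\<delta> ` A = A"
    "\<And>a m. \<lbrakk>a \<in> A; m \<in> A\<rbrakk> \<Longrightarrow> act a m = m"
    "\<And>u y. \<lbrakk>A = {\<one>}; u \<in> U; y \<in> Q\<rbrakk> \<Longrightarrow> u \<otimes> y = y \<otimes> u"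
proof -
  interpret U: normal U G by fact
  interpret Q: subgroup Q G by fact
  have UG [simp]: "u \<in> carrier G" if "u \<in> U" for u using that by (rule U.mem_carrier)
  have QG [simp]: "u \<in> carrier G" if "u \<in> Q" for u using that by (rule Q.mem_carrier)
  have conjU [simp]: "g \<otimes> u \<otimes> inv g \<in> U" if "g \<in> carrier G" "u \<in> U" for g u
    using that U.inv_op_closed2 by simp
  define Z where "Z = U \<inter> {z \<in> carrier G. \<forall>w\<in>U. z \<otimes> w = w \<otimes> z}"
  note C = centralizer_normal[OF U]
  have Z: "subgroup Z G"
    unfolding Z_def by (rule subgroups_Inter_pair[OF U.subgroup_axioms normal_imp_subgroup[OF C]])
  interpret Z: subgroup Z G by fact
  have ZU: "Z \<subseteq> U" unfolding Z_def by blast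
  have Zcomm: "z \<otimes> w = w \<otimes> z" if "z \<in> Z" "w \<in> U" for z w
    using that unfolding Z_def by blast
  let ?Z = "G\<lparr>carrier := Z\<rparr>"
  interpret ZG: comm_group ?Z
    by (rule group.group_comm_groupI[OF Z.subgroup_is_group[OF group_axioms]])
      (use ZU in \<open>simp, intro Zcomm, auto\<close>)
  have finQ: "finite Q" using fin Q.subset finite_subset by blast
  have finU: "finite U" using fin U.subset finite_subset by blast
  have ZG [simp]: "z \<in> carrier G" if "z \<in> Z" for z using that by (rule Z.mem_carrier)
  define c where "c u y = u \<otimes> (y \<otimes> inv u \<otimes> inv y)" for u y
  have cZ [simp]: "c u y \<in> Z" if "u \<in> U" "y \<in> Q" for u y
    unfolding Z_def
  proof (intro IntI CollectI conjI ballI)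
    show "c u y \<in> U" "c u y \<in> carrier G" using that by (simp_all add: c_def)
    fix w assume "w \<in> U"
    then show "c u y \<otimes> w = w \<otimes> c u y" unfolding c_def by (rule cen[OF that])
  qed
  have c_mult: "c (u \<otimes> v) y = c u y \<otimes> c v y" if "u \<in> U" "v \<in> U" "y \<in> Q" for u v y
  proof -
    have "c (u \<otimes> v) y = u \<otimes> c v y \<otimes> (y \<otimes> inv u \<otimes> inv y)"
      using that by (simp add: c_def inv_mult_group m_assoc inv_mult_cancel)
    also have "u \<otimes> c v y = c v y \<otimes> u" using cZ[of v y] that by (intro Zcomm[symmetric])
    also have "c v y \<otimes> u \<otimes> (y \<otimes> inv u \<otimes> inv y) = c v y \<otimes> c u y"
      using that cZ[of v y] by (simp add: c_def m_assoc)
    also have "\<dots> = c u y \<otimes> c v y"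
      using that cZ[of v y] cZ[of u y] ZU by (intro Zcomm) auto
    finally show ?thesis .
  qed
  define \<nu> where "\<nu> u = finprod ?Z (c u) Q" for u
  have \<nu>Z [simp]: "\<nu> u \<in> Z" if "u \<in> U" for u
    using ZG.finprod_closed[of "c u" Q] that by (auto simp: \<nu>_def)
  have \<nu>_mult: "\<nu> (u \<otimes> v) = \<nu> u \<otimes> \<nu> v" if "u \<in> U" "v \<in> U" for u v
  proof -
    have "\<nu> (u \<otimes> v) = finprod ?Z (\<lambda>y. c u y \<otimes>\<^bsub>?Z\<^esub> c v y) Q"
      unfolding \<nu>_def by (rule ZG.finprod_cong') (use that in \<open>auto simp: c_mult\<close>)
    also have "\<dots> = \<nu> u \<otimes>\<^bsub>?Z\<^esub> \<nu> v"
      unfolding \<nu>_def by (rule ZG.finprod_multf) (use that in auto)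
    finally show ?thesis by simp
  qed
  have \<nu>_conj: "h \<otimes> \<nu> u \<otimes> inv h = \<nu> (h \<otimes> u \<otimes> inv h)"
    if h: "h \<in> conj_normalizer G Q" and u: "u \<in> U" for h u
  proof -
    have hG [simp]: "h \<in> carrier G" using h by (simp add: conj_normalizer_def)
    have hZ: "h \<otimes> z \<otimes> inv h \<in> Z" if z: "z \<in> Z" for z
      unfolding Z_def
      by (rule IntI[OF U.inv_op_closed2[OF hG] normal.inv_op_closed2[OF C hG]]) (use z in \<open>simp_all only: Z_def Int_iff\<close>)
    have hom: "(\<lambda>z. h \<otimes> z \<otimes> inv h) \<in> hom ?Z ?Z"
      by (auto simp: hom_def hZ conj_mult)
    have bij: "bij_betw (\<lambda>y. h \<otimes> y \<otimes> inv h) Q Q" by (rule conj_normalizer_bij[OF fin Q h])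
    have hQ: "h \<otimes> y \<otimes> inv h \<in> Q" if "y \<in> Q" for y
      using h that by (simp add: conj_normalizer_def)
    have h_c: "h \<otimes> c u y \<otimes> inv h = c (h \<otimes> u \<otimes> inv h) (h \<otimes> y \<otimes> inv h)" if "y \<in> Q" for y
      using u that by (simp add: c_def m_assoc inv_mult_group inv_mult_cancel)
    have huU: "h \<otimes> u \<otimes> inv h \<in> U" using u by simp
    have "h \<otimes> \<nu> u \<otimes> inv h = finprod ?Z (\<lambda>y. h \<otimes> c u y \<otimes> inv h) Q"
      unfolding \<nu>_def by (rule ZG.hom_finprod[OF hom finQ]) (use u in auto)
    also have "\<dots> = finprod ?Z (\<lambda>y. c (h \<otimes> u \<otimes> inv h) (h \<otimes> y \<otimes> inv h)) Q"
      by (rule ZG.finprod_cong')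
        (use cZ[OF huU hQ] in \<open>auto simp: h_c\<close>)
    also have "\<dots> = finprod ?Z (c (h \<otimes> u \<otimes> inv h)) ((\<lambda>y. h \<otimes> y \<otimes> inv h) ` Q)"
      by (rule ZG.finprod_reindex[symmetric]) (use cZ[OF huU] bij in \<open>auto simp: bij_betw_def\<close>)
    also have "\<dots> = \<nu> (h \<otimes> u \<otimes> inv h)"
      using bij by (simp add: \<nu>_def bij_betw_def)
    finally show ?thesis .
  qed
  have \<nu>_fixed: "\<nu> u = \<one>" if "u \<in> U" and comm: "\<And>y. y \<in> Q \<Longrightarrow> u \<otimes> y = y \<otimes> u" for u
  proof -
    have "c u y = \<one>" if y: "y \<in> Q" for y
    proof -
      have "c u y = (u \<otimes> y) \<otimes> (inv u \<otimes> inv y)" using \<open>u \<in> U\<close> y by (simp add: c_def m_assoc)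
      also have "\<dots> = \<one>" unfolding comm[OF y] using \<open>u \<in> U\<close> y by (simp add: m_assoc inv_mult_cancel)
      finally show ?thesis .
    qed
    then show ?thesis
      using ZG.finprod_one_eqI[of Q "c u"] by (simp add: \<nu>_def)
  qed
  have \<nu>_c: "\<nu> (c u y0) = c u y0 [^] card Q" if u: "u \<in> U" and y0: "y0 \<in> Q" for u y0
  proof -
    let ?a = "c u y0"
    \<comment> \<open>Inverses of the conjugates of \<open>?a\<close>; multiplied by \<open>c u (y \<otimes> y0)\<close> they give \<open>c u y\<close>,
        and \<open>y \<mapsto> y \<otimes> y0\<close> permutes \<open>Q\<close>, so their product is \<open>1\<close>.\<close>
    define d where "d y = y \<otimes> inv ?a \<otimes> inv y" for y
    have aZ: "?a \<in> Z" using u y0 by simp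
    have cd: "c u (y \<otimes> y0) \<otimes> d y = c u y" if "y \<in> Q" for y
      using that u y0 by (simp add: d_def c_def m_assoc inv_mult_group inv_mult_cancel)
    have dZ: "d y \<in> Z" if y: "y \<in> Q" for y
    proof -
      have yy0: "y \<otimes> y0 \<in> Q" using y y0 by simp
      have "d y \<in> carrier G" using y aZ by (simp add: d_def)
      then have "d y = inv (c u (y \<otimes> y0)) \<otimes> c u y"
        unfolding cd[OF y, symmetric] using cZ[OF u yy0] by (simp add: inv_mult_cancel)
      then show ?thesis using cZ[OF u yy0] cZ[OF u y] by simp
    qed
    have dd: "d y \<otimes> c u (y \<otimes> y0) = c u y" if y: "y \<in> Q" for y
    proof -
      have "c u (y \<otimes> y0) \<in> U" using ZU cZ[of u "y \<otimes> y0"] u y y0 by auto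
      then show ?thesis using Zcomm[OF dZ[OF y]] cd[OF y] by simp
    qed
    have bij: "bij_betw (\<lambda>y. y \<otimes> y0) Q Q"
      by (rule bij_betw_byWitness[where f' = "\<lambda>y. y \<otimes> inv y0"]) (use y0 in \<open>auto simp: m_assoc\<close>)
    have "finprod ?Z d Q \<otimes> finprod ?Z (\<lambda>y. c u (y \<otimes> y0)) Q = finprod ?Z (\<lambda>y. d y \<otimes>\<^bsub>?Z\<^esub> c u (y \<otimes> y0)) Q"
      using ZG.finprod_multf[of d Q "\<lambda>y. c u (y \<otimes> y0)"] dZ u y0 by simp
    also have "\<dots> = \<nu> u"
      unfolding \<nu>_def by (rule ZG.finprod_cong') (use dd u in auto)
    also have "finprod ?Z (\<lambda>y. c u (y \<otimes> y0)) Q = finprod ?Z (c u) ((\<lambda>y. y \<otimes> y0) ` Q)"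
      by (rule ZG.finprod_reindex[symmetric]) (use u y0 bij in \<open>auto simp: bij_betw_def\<close>)
    also have "\<dots> = \<nu> u" using bij by (simp add: \<nu>_def bij_betw_def)
    finally have "finprod ?Z d Q \<otimes> \<nu> u = \<nu> u" .
    moreover have "finprod ?Z d Q \<in> Z" using ZG.finprod_closed[of d Q] dZ by auto
    ultimately have d1: "finprod ?Z d Q = \<one>" using u by (simp add: r_cancel_one')
    have "\<nu> ?a = finprod ?Z (\<lambda>y. ?a \<otimes>\<^bsub>?Z\<^esub> d y) Q"
      unfolding \<nu>_def by (rule ZG.finprod_cong') (use aZ dZ in \<open>auto simp: c_def[of ?a] d_def\<close>)
    also have "\<dots> = finprod ?Z (\<lambda>_. ?a) Q \<otimes>\<^bsub>?Z\<^esub> finprod ?Z d Q"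
      by (rule ZG.finprod_multf) (use aZ dZ in auto)
    also have "finprod ?Z (\<lambda>_. ?a) Q = ?a [^]\<^bsub>?Z\<^esub> card Q"
      using aZ by (intro ZG.finprod_const) auto
    finally show ?thesis
      using d1 aZ by (simp flip: nat_pow_consistent)
  qed
  have Zpow [simp]: "z [^] n \<in> Z" if "z \<in> Z" for z and n :: nat
    using that by (induction n) auto
  have \<nu>\<nu>: "\<nu> (\<nu> u) = \<nu> u [^] card Q" if u: "u \<in> U" for u
  proof -
    have "\<nu> \<in> hom ?Z ?Z"
    proof (rule homI)
      fix x y assume "x \<in> carrier ?Z" "y \<in> carrier ?Z"
      then have "x \<in> U" "y \<in> U" using ZU by auto
      then show "\<nu> (x \<otimes>\<^bsub>?Z\<^esub> y) = \<nu> x \<otimes>\<^bsub>?Z\<^esub> \<nu> y" by (simp add: \<nu>_mult)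
    next
      fix x assume "x \<in> carrier ?Z"
      then have "x \<in> U" using ZU by auto
      then show "\<nu> x \<in> carrier ?Z" by simp
    qed
    then have "\<nu> (\<nu> u) = finprod ?Z (\<lambda>y. \<nu> (c u y)) Q"
      using ZG.hom_finprod[of \<nu> Q "c u"] finQ u by (simp add: \<nu>_def[of u])
    also have "\<dots> = finprod ?Z (\<lambda>y. c u y [^]\<^bsub>?Z\<^esub> card Q) Q"
      by (rule ZG.finprod_cong')
        (use u in \<open>auto simp: \<nu>_c simp flip: nat_pow_consistent\<close>)
    also have "\<dots> = (finprod ?Z (c u) Q) [^]\<^bsub>?Z\<^esub> card Q"
    proof -
      have "(\<lambda>z. z [^]\<^bsub>?Z\<^esub> card Q) \<in> hom ?Z ?Z"
      proof (rule homI)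
        fix x y assume "x \<in> carrier ?Z" "y \<in> carrier ?Z"
        then have "x \<in> Z" "y \<in> Z" by auto
        then have "(x \<otimes> y) [^] card Q = x [^] card Q \<otimes> y [^] card Q"
          using ZU by (intro pow_mult_distrib Zcomm) auto
        then show "(x \<otimes>\<^bsub>?Z\<^esub> y) [^]\<^bsub>?Z\<^esub> card Q = x [^]\<^bsub>?Z\<^esub> card Q \<otimes>\<^bsub>?Z\<^esub> y [^]\<^bsub>?Z\<^esub> card Q"
          by (simp flip: nat_pow_consistent)
      qed (auto simp flip: nat_pow_consistent)
      from ZG.hom_finprod[OF this finQ, of "c u"] u show ?thesis by simp
    qed
    finally show ?thesis by (simp add: \<nu>_def[of u] flip: nat_pow_consistent)
  qed
  have power_inj: "z = \<one>" if "z \<in> U" "z [^] card Q = \<one>" for z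
  proof (rule pow_coprime_eq_one[of z "card Q" "p ^ e"])
    show "z [^] (p ^ e) = \<one>" using subgroup_pow_card[OF fin U.subgroup_axioms that(1)] cU by simp
    show "coprime (card Q) (p ^ e)"
      using p pQ by (simp add: prime_imp_coprime coprime_commute)
  qed (use that in auto)
  define A where "A = \<nu> ` U"
  have AZ: "A \<subseteq> Z" by (auto simp: A_def)
  have \<nu>one: "\<nu> \<one> = \<one>" by (rule \<nu>_fixed) auto
  have \<nu>inv: "\<nu> (inv u) = inv (\<nu> u)" if "u \<in> U" for u
    using \<nu>_mult[of "inv u" u] \<nu>one that inv_equality[of "\<nu> (inv u)" "\<nu> u"] by simp
  have Asub: "subgroup A G"
  proof (rule subgroupI)
    fix a b assume "a \<in> A" "b \<in> A"
    then obtain u v where "u \<in> U" "v \<in> U" "a = \<nu> u" "b = \<nu> v" by (auto simp: A_def)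
    then show "a \<otimes> b \<in> A" unfolding A_def by (intro image_eqI[of _ _ "u \<otimes> v"]) (auto simp: \<nu>_mult)
  next
    fix a assume "a \<in> A"
    then obtain u where "u \<in> U" "a = \<nu> u" by (auto simp: A_def)
    then show "inv a \<in> A" unfolding A_def by (intro image_eqI[of _ _ "inv u"]) (auto simp: \<nu>inv)
  next
    show "A \<noteq> {}" using U.one_closed by (auto simp only: A_def)
    show "A \<subseteq> carrier G" using AZ Z.subset by blast
  qed
  interpret A: subgroup A G by fact
  have A_central: "w \<otimes> a \<otimes> inv w = a" if "a \<in> A" "w \<in> U" for a w
  proof -
    have "w \<otimes> a = a \<otimes> w" using that AZ by (intro Zcomm[symmetric]) auto
    then have "w \<otimes> a \<otimes> inv w = a \<otimes> w \<otimes> inv w" by simp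
    then show ?thesis using that AZ by (simp add: m_assoc subset_eq)
  qed
  have AU: "A \<subseteq> U" using AZ ZU by blast
  have conj_\<nu>: "(w \<otimes> h) \<otimes> \<nu> u \<otimes> inv (w \<otimes> h) = \<nu> (h \<otimes> u \<otimes> inv h)"
    if "w \<in> U" "h \<in> conj_normalizer G Q" "u \<in> U" for w h u
  proof -
    have hG: "h \<in> carrier G" using that(2) by (simp add: conj_normalizer_def)
    have "(w \<otimes> h) \<otimes> \<nu> u \<otimes> inv (w \<otimes> h) = w \<otimes> \<nu> (h \<otimes> u \<otimes> inv h) \<otimes> inv w"
      using that hG by (simp add: conj_conj \<nu>_conj)
    also have "\<dots> = \<nu> (h \<otimes> u \<otimes> inv h)"
      by (rule A_central) (use that hG in \<open>auto simp: A_def\<close>)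
    finally show ?thesis .
  qed
  have An: "A \<lhd> G"
    unfolding normal_inv_iff
  proof (intro conjI ballI Asub)
    fix g a assume g: "g \<in> carrier G" and a: "a \<in> A"
    obtain u where u: "u \<in> U" "a = \<nu> u" using a by (auto simp: A_def)
    obtain w h where w: "w \<in> U" "h \<in> conj_normalizer G Q" "g = w \<otimes> h" using fac[OF g] by blast
    have "h \<in> carrier G" using w(2) by (simp add: conj_normalizer_def)
    then show "g \<otimes> a \<otimes> inv g \<in> A"
      unfolding w(3) u(2) conj_\<nu>[OF w(1,2) u(1)] A_def using u(1) by (intro imageI conjU)
  qed
  interpret An: normal A G by fact
  define \<delta> where "\<delta> g = \<nu> (SOME u. u \<in> U \<and> (\<exists>h\<in>conj_normalizer G Q. g = u \<otimes> h))" for g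
  interpret N: subgroup "conj_normalizer G Q" G by (rule conj_normalizer_subgroup[OF fin Q])
  have NG [simp]: "h \<in> carrier G" if "h \<in> conj_normalizer G Q" for h
    using that by (rule N.mem_carrier)
  have \<delta>: "\<delta> (u \<otimes> h) = \<nu> u" if u: "u \<in> U" and h: "h \<in> conj_normalizer G Q" for u h
  proof -
    let ?P = "\<lambda>v. v \<in> U \<and> (\<exists>k\<in>conj_normalizer G Q. u \<otimes> h = v \<otimes> k)"
    have "?P u" using u h by blast
    then have "?P (SOME v. ?P v)" by (rule someI)
    then obtain v k where v: "v \<in> U" "k \<in> conj_normalizer G Q" "u \<otimes> h = v \<otimes> k"
      and dv: "\<delta> (u \<otimes> h) = \<nu> v" by (auto simp: \<delta>_def)
    \<comment> \<open>Two factorizations of the same element differ by some \<open>t\<close> in \<open>U \<inter> N(Q)\<close>. Such a \<open>t\<close>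
        centralizes \<open>Q\<close>, as \<open>[t,y]\<close> lies in \<open>Q \<inter> U\<close>, and so \<open>\<nu> t = 1\<close>.\<close>
    define t where "t = inv v \<otimes> u"
    have t: "t \<in> U" using u v by (simp add: t_def)
    have "t = k \<otimes> inv h"
    proof -
      have "t = inv v \<otimes> (u \<otimes> h) \<otimes> inv h" using u v(1) h by (simp add: t_def m_assoc)
      also have "\<dots> = k \<otimes> inv h" unfolding v(3) using v(1,2) h by (simp add: m_assoc inv_mult_cancel)
      finally show ?thesis .
    qed
    then have tN: "t \<in> conj_normalizer G Q" using v h by simp
    have "t \<otimes> y = y \<otimes> t" if y: "y \<in> Q" for y
    proof -
      let ?x = "t \<otimes> y \<otimes> inv t \<otimes> inv y"
      have "t \<otimes> y \<otimes> inv t \<in> Q" using tN y unfolding conj_normalizer_def by blast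
      then have "?x \<in> Q" using y by blast
      moreover have "?x \<in> U"
      proof -
        have "?x = t \<otimes> (y \<otimes> inv t \<otimes> inv y)" using t y by (simp add: m_assoc)
        then show ?thesis using t y by simp
      qed
      ultimately have "?x = \<one>" using QU by blast
      then have "?x \<otimes> y \<otimes> t = y \<otimes> t" using t y by simp
      then show ?thesis using t y by (simp add: m_assoc inv_mult_cancel)
    qed
    then have "\<nu> t = \<one>" using \<nu>_fixed t by blast
    then have "inv (\<nu> v) \<otimes> \<nu> u = \<one>" using u v by (simp add: t_def \<nu>_mult \<nu>inv)
    then have "\<nu> v \<otimes> (inv (\<nu> v) \<otimes> \<nu> u) = \<nu> v" using v by simp
    then show ?thesis using dv u v by (simp add: inv_mult_cancel)
  qed
  let ?A = "G\<lparr>carrier := A\<rparr>"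
  interpret AG: comm_group ?A
    by (rule group.group_comm_groupI[OF A.subgroup_is_group[OF group_axioms]])
      (use AZ ZU in \<open>simp, intro Zcomm, auto\<close>)
  have \<delta>A: "\<delta> a = a [^] card Q" if a: "a \<in> A" for a
  proof -
    obtain u where u: "u \<in> U" "a = \<nu> u" using a by (auto simp: A_def)
    have aU: "a \<in> U" using a AU by blast
    then have "\<delta> (a \<otimes> \<one>) = \<nu> a" by (rule \<delta>) simp
    then show ?thesis using u aU \<nu>\<nu>[OF u(1)] by simp
  qed
  have cocyc: "cocycle G ?A (\<lambda>g a. g \<otimes> a \<otimes> inv g) \<delta>"
  proof unfold_locales
    fix g assume g: "g \<in> carrier G"
    then show "(\<lambda>a. g \<otimes> a \<otimes> inv g) \<in> hom ?A ?A"
      by (auto simp: hom_def An.inv_op_closed2 conj_mult A.mem_carrier)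
    obtain w h where w: "w \<in> U" "h \<in> conj_normalizer G Q" "g = w \<otimes> h" using fac[OF g] by blast
    show "\<delta> g \<in> carrier ?A" using w \<delta> by (simp add: A_def)
    fix k assume k: "k \<in> carrier G"
    obtain v l where v: "v \<in> U" "l \<in> conj_normalizer G Q" "k = v \<otimes> l" using fac[OF k] by blast
    have "g \<otimes> k = (w \<otimes> (h \<otimes> v \<otimes> inv h)) \<otimes> (h \<otimes> l)"
      using w v by (simp add: m_assoc inv_mult_cancel)
    then have "\<delta> (g \<otimes> k) = \<nu> (w \<otimes> (h \<otimes> v \<otimes> inv h))"
      using \<delta>[of "w \<otimes> (h \<otimes> v \<otimes> inv h)" "h \<otimes> l"] w v by simp
    also have "\<dots> = \<nu> w \<otimes> \<nu> (h \<otimes> v \<otimes> inv h)" using w v by (intro \<nu>_mult) auto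
    also have "\<dots> = \<delta> g \<otimes> (g \<otimes> \<delta> k \<otimes> inv g)"
      using conj_\<nu>[OF w(1,2) v(1)] \<delta>[OF w(1,2)] \<delta>[OF v(1,2)] w(3) v(3) by simp
    finally show "\<delta> (g \<otimes> k) = \<delta> g \<otimes>\<^bsub>?A\<^esub> (g \<otimes> \<delta> k \<otimes> inv g)" by simp
    fix a assume "a \<in> carrier ?A"
    then have "a \<in> carrier G" by (simp add: A.mem_carrier)
    then show "(g \<otimes> k) \<otimes> a \<otimes> inv (g \<otimes> k) = g \<otimes> (k \<otimes> a \<otimes> inv k) \<otimes> inv g"
      using g k by (rule conj_conj[rotated 2])
  qed (simp add: A.mem_carrier)
  have "\<delta> ` A = A"
  proof -
    have "inj_on \<delta> A"
    proof (rule inj_onI)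
      fix a a' assume a: "a \<in> A" "a' \<in> A" "\<delta> a = \<delta> a'"
      have aU: "a \<in> U" "a' \<in> U" using a AU by auto
      have comm: "a \<otimes> inv a' = inv a' \<otimes> a"
        using a(1,2) AZ aU by (intro Zcomm) auto
      have "(a \<otimes> inv a') [^] card Q = a [^] card Q \<otimes> inv (a' [^] card Q)"
        using pow_mult_distrib[OF comm, of "card Q"] aU by (simp add: nat_pow_inv)
      also have "a [^] card Q = a' [^] card Q" using a(3) by (simp only: \<delta>A[OF a(1)] \<delta>A[OF a(2)])
      also have "a' [^] card Q \<otimes> inv (a' [^] card Q) = \<one>" using aU(2) by simp
      finally have pow1: "(a \<otimes> inv a') [^] card Q = \<one>" .
      have "a \<otimes> inv a' = \<one>"
        by (rule power_inj[OF _ pow1]) (use aU in simp)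
      then have "a \<otimes> inv a' \<otimes> a' = \<one> \<otimes> a'" by (simp only:)
      then show "a = a'" using aU by (simp add: m_assoc)
    qed
    moreover have "finite A" using finU AU finite_subset by blast
    moreover have "\<delta> ` A \<subseteq> A"
    proof -
      have "a [^] (n::nat) \<in> A" if "a \<in> A" for a n
        by (induction n) (use that in auto)
      then show ?thesis using \<delta>A by auto
    qed
    ultimately show ?thesis by (simp add: endo_inj_surj)
  qed
  moreover have "u \<otimes> y = y \<otimes> u" if A1: "A = {\<one>}" and u: "u \<in> U" and y: "y \<in> Q" for u y
  proof -
    have cyU: "c u y \<in> U" using ZU cZ[OF u y] by blast
    then have "\<nu> (c u y) \<in> A" unfolding A_def by (rule imageI)
    then have "c u y [^] card Q = \<one>" using A1 \<nu>_c[OF u y] by simp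
    then have "c u y = \<one>" using power_inj cyU by blast
    then have "c u y \<otimes> y \<otimes> u = y \<otimes> u" using u y by simp
    then show ?thesis using u y by (simp add: c_def m_assoc inv_mult_cancel)
  qed
  moreover have "a \<otimes> m \<otimes> inv a = m" if "a \<in> A" "m \<in> A" for a m
    using A_central that AU by blast
  ultimately show thesis using that[OF An AU cocyc] by blast
qed


section \<open>Invariant forms on Sylow subgroups\<close>

text \<open>
  Quotients of \<open>Q\<^sub>8\<close> have to be covered as well. All proper ones are abelian, so the abelian
  alternative makes the condition stable under homomorphic images.
\<close>

definition brace_type :: "('a, 'b) monoid_scheme \<Rightarrow> nat \<Rightarrow> 'a set \<Rightarrow> bool" where
  "brace_type G p P \<longleftrightarrow>
     (\<forall>x\<in>P. \<forall>y\<in>P. \<forall>w\<in>P. (x \<otimes>\<^bsub>G\<^esub> y \<otimes>\<^bsub>G\<^esub> inv\<^bsub>G\<^esub> x \<otimes>\<^bsub>G\<^esub> inv\<^bsub>G\<^esub> y) \<otimes>\<^bsub>G\<^esub> w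
        = w \<otimes>\<^bsub>G\<^esub> (x \<otimes>\<^bsub>G\<^esub> y \<otimes>\<^bsub>G\<^esub> inv\<^bsub>G\<^esub> x \<otimes>\<^bsub>G\<^esub> inv\<^bsub>G\<^esub> y)) \<and>
     (odd p \<or> (\<forall>x\<in>P. \<forall>y\<in>P. x \<otimes>\<^bsub>G\<^esub> y = y \<otimes>\<^bsub>G\<^esub> x) \<or> G\<lparr>carrier := P\<rparr> \<cong> quaternion_group)"

text \<open>
  Commutators of \<open>Q\<^sub>8\<close> are \<open>1\<close> or \<open>-1\<close>, and \<open>-1\<close> is a power of every \<open>x \<noteq> 1\<close>. So a homomorphism
  which kills some \<open>x \<noteq> 1\<close> has commutative image.
\<close>

lemma quaternion_commutator:
  "\<forall>a\<in>carrier quaternion_group. \<forall>b\<in>carrier quaternion_group. \<forall>x\<in>carrier quaternion_group.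
     x \<noteq> \<one>\<^bsub>quaternion_group\<^esub> \<longrightarrow>
       a \<otimes>\<^bsub>quaternion_group\<^esub> b = b \<otimes>\<^bsub>quaternion_group\<^esub> a \<or>
       a \<otimes>\<^bsub>quaternion_group\<^esub> b = x \<otimes>\<^bsub>quaternion_group\<^esub> (b \<otimes>\<^bsub>quaternion_group\<^esub> a) \<or>
       a \<otimes>\<^bsub>quaternion_group\<^esub> b = x \<otimes>\<^bsub>quaternion_group\<^esub> (x \<otimes>\<^bsub>quaternion_group\<^esub> (b \<otimes>\<^bsub>quaternion_group\<^esub> a))"
  by (simp add: quaternion_group_def)

abbreviation "quaternion_neg \<equiv> hamilton_mult (-1, 0, 0, 0)"

text \<open>
  The function \<open>e\<close> picks one element out of each pair \<open>{q, -q}\<close>, and the form is its coboundary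
  \<open>e x + e y + e (x y)\<close> modulo 2, written with equalities of truth values. It is bilinear for
  each of the eight choices of \<open>e\<close>: if \<open>x\<close> and \<open>y\<close> are independent modulo \<open>{1, -1}\<close>, the three
  nontrivial classes are those of \<open>x\<close>, \<open>y\<close> and \<open>x y\<close>, and \<open>x x = -1\<close> together with
  \<open>e (-y) = e y + 1\<close> gives the value at \<open>(x, x y)\<close> as the sum of the values at \<open>(x, x)\<close> and \<open>(x, y)\<close>.
\<close>

lemma quaternion_sign_form:
  fixes e :: "int_quaternion \<Rightarrow> bool"
  defines "\<beta> \<equiv> \<lambda>x y. (e x = (e y = e (hamilton_mult x y)))"
  assumes one: "\<not> e (1, 0, 0, 0)"
    and neg: "\<forall>x\<in>carrier quaternion_group. e (quaternion_neg x) \<longleftrightarrow> \<not> e x"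
  shows "\<forall>x\<in>carrier quaternion_group. \<forall>x'\<in>carrier quaternion_group. \<forall>y\<in>carrier quaternion_group.
      \<beta> (hamilton_mult x x') y = (\<beta> x y \<noteq> \<beta> x' y)"
    and "\<forall>x\<in>carrier quaternion_group. \<forall>y\<in>carrier quaternion_group. \<forall>y'\<in>carrier quaternion_group.
      \<beta> x (hamilton_mult y y') = (\<beta> x y \<noteq> \<beta> x y')"
    and "\<forall>x\<in>carrier quaternion_group. \<not> \<beta> (-1, 0, 0, 0) x \<and> \<not> \<beta> x (-1, 0, 0, 0) \<and>
      \<not> \<beta> (1, 0, 0, 0) x \<and> \<not> \<beta> x (1, 0, 0, 0)"
    and "\<forall>x\<in>carrier quaternion_group. \<forall>y\<in>carrier quaternion_group.
      (if \<beta> x y then quaternion_neg (hamilton_mult x y) else hamilton_mult x y) = (if \<beta> y x then quaternion_neg (hamilton_mult y x) else hamilton_mult y x)"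
proof -
  have e: "e (1, 0, 0, 0) = False" "e (-1, 0, 0, 0) = True"
    "e (0, -1, 0, 0) = (\<not> e (0, 1, 0, 0))" "e (0, 0, -1, 0) = (\<not> e (0, 0, 1, 0))"
    "e (0, 0, 0, -1) = (\<not> e (0, 0, 0, 1))"
    using one bspec[OF neg, of "(1, 0, 0, 0)"] bspec[OF neg, of "(0, 1, 0, 0)"]
      bspec[OF neg, of "(0, 0, 1, 0)"] bspec[OF neg, of "(0, 0, 0, 1)"]
    by (simp_all add: quaternion_group_def)
  show "\<forall>x\<in>carrier quaternion_group. \<forall>x'\<in>carrier quaternion_group. \<forall>y\<in>carrier quaternion_group.
      \<beta> (hamilton_mult x x') y = (\<beta> x y \<noteq> \<beta> x' y)"
    by (cases "e (0, 1, 0, 0)"; cases "e (0, 0, 1, 0)"; cases "e (0, 0, 0, 1)")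
      (simp_all add: \<beta>_def quaternion_group_def e)
  show "\<forall>x\<in>carrier quaternion_group. \<forall>y\<in>carrier quaternion_group. \<forall>y'\<in>carrier quaternion_group.
      \<beta> x (hamilton_mult y y') = (\<beta> x y \<noteq> \<beta> x y')"
    by (cases "e (0, 1, 0, 0)"; cases "e (0, 0, 1, 0)"; cases "e (0, 0, 0, 1)")
      (simp_all add: \<beta>_def quaternion_group_def e)
  show "\<forall>x\<in>carrier quaternion_group. \<not> \<beta> (-1, 0, 0, 0) x \<and> \<not> \<beta> x (-1, 0, 0, 0) \<and>
      \<not> \<beta> (1, 0, 0, 0) x \<and> \<not> \<beta> x (1, 0, 0, 0)"
    by (cases "e (0, 1, 0, 0)"; cases "e (0, 0, 1, 0)"; cases "e (0, 0, 0, 1)")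
      (simp_all add: \<beta>_def quaternion_group_def e)
  show "\<forall>x\<in>carrier quaternion_group. \<forall>y\<in>carrier quaternion_group.
      (if \<beta> x y then quaternion_neg (hamilton_mult x y) else hamilton_mult x y) = (if \<beta> y x then quaternion_neg (hamilton_mult y x) else hamilton_mult y x)"
    by (cases "e (0, 1, 0, 0)"; cases "e (0, 0, 1, 0)"; cases "e (0, 0, 0, 1)")
      (simp_all add: \<beta>_def quaternion_group_def e)
qed

lemma brace_type_image:
  assumes "group_hom G K \<phi>" and P: "subgroup P G" and g: "brace_type G p P"
  shows "brace_type K p (\<phi> ` P)"
proof -
  interpret \<phi>: group_hom G K \<phi> by fact
  interpret P: subgroup P G by fact
  have PG [simp]: "x \<in> carrier G" if "x \<in> P" for x using that by (rule P.mem_carrier)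
  have "(\<phi> x \<otimes>\<^bsub>K\<^esub> \<phi> y \<otimes>\<^bsub>K\<^esub> inv\<^bsub>K\<^esub> \<phi> x \<otimes>\<^bsub>K\<^esub> inv\<^bsub>K\<^esub> \<phi> y) \<otimes>\<^bsub>K\<^esub> \<phi> w
     = \<phi> w \<otimes>\<^bsub>K\<^esub> (\<phi> x \<otimes>\<^bsub>K\<^esub> \<phi> y \<otimes>\<^bsub>K\<^esub> inv\<^bsub>K\<^esub> \<phi> x \<otimes>\<^bsub>K\<^esub> inv\<^bsub>K\<^esub> \<phi> y)"
    if "x \<in> P" "y \<in> P" "w \<in> P" for x y w
  proof -
    have "\<phi> ((x \<otimes>\<^bsub>G\<^esub> y \<otimes>\<^bsub>G\<^esub> inv\<^bsub>G\<^esub> x \<otimes>\<^bsub>G\<^esub> inv\<^bsub>G\<^esub> y) \<otimes>\<^bsub>G\<^esub> w)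
        = \<phi> (w \<otimes>\<^bsub>G\<^esub> (x \<otimes>\<^bsub>G\<^esub> y \<otimes>\<^bsub>G\<^esub> inv\<^bsub>G\<^esub> x \<otimes>\<^bsub>G\<^esub> inv\<^bsub>G\<^esub> y))"
      using g that unfolding brace_type_def by metis
    then show ?thesis using that by simp
  qed
  moreover have "odd p \<or> (\<forall>x\<in>\<phi> ` P. \<forall>y\<in>\<phi> ` P. x \<otimes>\<^bsub>K\<^esub> y = y \<otimes>\<^bsub>K\<^esub> x) \<or>
      K\<lparr>carrier := \<phi> ` P\<rparr> \<cong> quaternion_group"
  proof -
    consider "odd p" | "\<forall>x\<in>P. \<forall>y\<in>P. x \<otimes>\<^bsub>G\<^esub> y = y \<otimes>\<^bsub>G\<^esub> x"
      | "G\<lparr>carrier := P\<rparr> \<cong> quaternion_group"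
      using g unfolding brace_type_def by blast
    then show ?thesis
    proof cases
      case 2
      have "\<phi> x \<otimes>\<^bsub>K\<^esub> \<phi> y = \<phi> y \<otimes>\<^bsub>K\<^esub> \<phi> x" if "x \<in> P" "y \<in> P" for x y
        using 2 that \<phi>.hom_mult PG by metis
      then show ?thesis by auto
    next
      case 3
      let ?P = "G\<lparr>carrier := P\<rparr>"
      obtain \<psi> where \<psi>: "\<psi> \<in> iso ?P quaternion_group" using 3 by (auto simp: is_iso_def)
      have bij: "bij_betw \<psi> P (carrier quaternion_group)" using \<psi> by (simp add: iso_def)
      have \<psi>m: "\<psi> (x \<otimes>\<^bsub>G\<^esub> y) = \<psi> x \<otimes>\<^bsub>quaternion_group\<^esub> \<psi> y" if "x \<in> P" "y \<in> P" for x y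
        using \<psi> that by (auto simp: iso_def hom_def)
      have \<psi>c: "\<psi> x \<in> carrier quaternion_group" if "x \<in> P" for x
        using bij that bij_betwE by blast
      show ?thesis
      proof (cases "inj_on \<phi> P")
        case True
        have "\<phi> \<in> iso ?P (K\<lparr>carrier := \<phi> ` P\<rparr>)"
          using True by (auto simp: iso_def hom_def bij_betw_def)
        then have "?P \<cong> K\<lparr>carrier := \<phi> ` P\<rparr>" by (auto simp: is_iso_def)
        then have "K\<lparr>carrier := \<phi> ` P\<rparr> \<cong> ?P"
          using group.iso_sym P.subgroup_is_group[OF \<phi>.G.group_axioms] by blast
        then show ?thesis using 3 iso_trans by blast
      next
        case False
        have PK: "group_hom ?P K \<phi>" by (rule \<phi>.induced_group_hom'[OF P])
        then obtain x where x: "x \<in> P" "\<phi> x = \<one>\<^bsub>K\<^esub>" "x \<noteq> \<one>\<^bsub>G\<^esub>"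
          using False group_hom.inj_on_one_iff[OF PK] by auto
        have "\<psi> x \<noteq> \<one>\<^bsub>quaternion_group\<^esub>"
        proof -
          have "\<psi> \<one>\<^bsub>G\<^esub> = \<one>\<^bsub>quaternion_group\<^esub>"
            using hom_one[of \<psi> ?P quaternion_group] \<psi> group_quaternion_group
              P.subgroup_is_group[OF \<phi>.G.group_axioms] by (simp add: iso_def)
          then show ?thesis using bij x P.one_closed by (metis bij_betw_def inj_onD)
        qed
        have "\<phi> a \<otimes>\<^bsub>K\<^esub> \<phi> b = \<phi> b \<otimes>\<^bsub>K\<^esub> \<phi> a" if a: "a \<in> P" and b: "b \<in> P" for a b
        proof -
          have "a \<otimes>\<^bsub>G\<^esub> b = b \<otimes>\<^bsub>G\<^esub> a \<or> a \<otimes>\<^bsub>G\<^esub> b = x \<otimes>\<^bsub>G\<^esub> (b \<otimes>\<^bsub>G\<^esub> a) \<or>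
              a \<otimes>\<^bsub>G\<^esub> b = x \<otimes>\<^bsub>G\<^esub> (x \<otimes>\<^bsub>G\<^esub> (b \<otimes>\<^bsub>G\<^esub> a))"
          proof -
            have inj: "s = t" if "\<psi> s = \<psi> t" "s \<in> P" "t \<in> P" for s t
              using bij that by (metis bij_betw_def inj_onD)
            have "\<psi> (a \<otimes>\<^bsub>G\<^esub> b) = \<psi> (b \<otimes>\<^bsub>G\<^esub> a) \<or> \<psi> (a \<otimes>\<^bsub>G\<^esub> b) = \<psi> (x \<otimes>\<^bsub>G\<^esub> (b \<otimes>\<^bsub>G\<^esub> a)) \<or>
                \<psi> (a \<otimes>\<^bsub>G\<^esub> b) = \<psi> (x \<otimes>\<^bsub>G\<^esub> (x \<otimes>\<^bsub>G\<^esub> (b \<otimes>\<^bsub>G\<^esub> a)))"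
              using quaternion_commutator[rule_format, OF \<psi>c[OF a] \<psi>c[OF b] \<psi>c[OF x(1)]]
                \<open>\<psi> x \<noteq> \<one>\<^bsub>quaternion_group\<^esub>\<close> a b x(1) by (simp add: \<psi>m)
            then show ?thesis using inj a b x(1) by (meson P.m_closed)
          qed
          moreover have "\<phi> (x \<otimes>\<^bsub>G\<^esub> (b \<otimes>\<^bsub>G\<^esub> a)) = \<phi> (b \<otimes>\<^bsub>G\<^esub> a)"
            "\<phi> (x \<otimes>\<^bsub>G\<^esub> (x \<otimes>\<^bsub>G\<^esub> (b \<otimes>\<^bsub>G\<^esub> a))) = \<phi> (b \<otimes>\<^bsub>G\<^esub> a)"
            using a b x(1,2) by simp_all
          ultimately have "\<phi> (a \<otimes>\<^bsub>G\<^esub> b) = \<phi> (b \<otimes>\<^bsub>G\<^esub> a)" by metis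
          then show ?thesis using a b by simp
        qed
        then show ?thesis by auto
      qed
    qed simp
  qed
  ultimately show ?thesis unfolding brace_type_def by blast
qed


lemma (in group) central_form_abelian:
  assumes P: "subgroup P G" and comm: "\<forall>x\<in>P. \<forall>y\<in>P. x \<otimes> y = y \<otimes> x"
  shows "central_form G P (\<lambda>_ _. \<one>)"
proof -
  interpret P: subgroup P G by fact
  show ?thesis
    by unfold_locales (use comm P.mem_carrier in auto)
qed

lemma (in group) commutator_class_two:
  assumes P: "subgroup P G"
    and class2: "\<forall>x\<in>P. \<forall>y\<in>P. \<forall>w\<in>P. (x \<otimes> y \<otimes> inv x \<otimes> inv y) \<otimes> w = w \<otimes> (x \<otimes> y \<otimes> inv x \<otimes> inv y)"
    and P': "x \<in> P" "x' \<in> P" "y \<in> P"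
  shows "(x \<otimes> x') \<otimes> y \<otimes> inv (x \<otimes> x') \<otimes> inv y = (x \<otimes> y \<otimes> inv x \<otimes> inv y) \<otimes> (x' \<otimes> y \<otimes> inv x' \<otimes> inv y)"
proof -
  interpret P: subgroup P G by fact
  let ?c = "x' \<otimes> y \<otimes> inv x' \<otimes> inv y"
  have G: "x \<in> carrier G" "x' \<in> carrier G" "y \<in> carrier G" using P' by (auto intro: P.mem_carrier)
  have "(x \<otimes> x') \<otimes> y \<otimes> inv (x \<otimes> x') \<otimes> inv y = x \<otimes> (?c \<otimes> (y \<otimes> inv x \<otimes> inv y))"
    using G by (simp add: m_assoc inv_mult_group inv_mult_cancel)
  also have "?c \<otimes> (y \<otimes> inv x \<otimes> inv y) = (y \<otimes> inv x \<otimes> inv y) \<otimes> ?c"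
    using class2 P' by (metis P.m_closed P.m_inv_closed)
  also have "x \<otimes> \<dots> = (x \<otimes> y \<otimes> inv x \<otimes> inv y) \<otimes> ?c"
    using G by (simp add: m_assoc)
  finally show ?thesis .
qed

text \<open>
  In class two the commutator is bimultiplicative. Its square root, the power with exponent
  \<open>(|P| + 1) / 2\<close>, splits the commutator symmetrically between \<open>x y\<close> and \<open>y x\<close>.
\<close>

lemma (in group) central_form_odd:
  assumes fin: "finite (carrier G)" and P: "subgroup P G" and odd: "odd (card P)"
    and class2: "\<forall>x\<in>P. \<forall>y\<in>P. \<forall>w\<in>P. (x \<otimes> y \<otimes> inv x \<otimes> inv y) \<otimes> w = w \<otimes> (x \<otimes> y \<otimes> inv x \<otimes> inv y)"
  shows "central_form G P (\<lambda>x y. (y \<otimes> x \<otimes> inv y \<otimes> inv x) [^] ((card P + 1) div 2))"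
proof -
  interpret P: subgroup P G by fact
  have PG [simp]: "x \<in> carrier G" if "x \<in> P" for x using that by (rule P.mem_carrier)
  define m where "m = (card P + 1) div 2"
  have m2: "m + m = card P + 1" using odd by (auto simp: m_def elim!: oddE)
  define c where "c x y = y \<otimes> x \<otimes> inv y \<otimes> inv x" for x y
  have cP [simp]: "c x y \<in> P" if "x \<in> P" "y \<in> P" for x y using that by (simp add: c_def)
  have c_central: "c x y \<otimes> w = w \<otimes> c x y" if "x \<in> P" "y \<in> P" "w \<in> P" for x y w
    using class2 that unfolding c_def by blast
  have c_inv: "inv (c x y) = c y x" if "x \<in> P" "y \<in> P" for x y
    using that by (simp add: c_def inv_mult_group m_assoc)
  have c_right: "c x (y \<otimes> y') = c x y \<otimes> c x y'" if "x \<in> P" "y \<in> P" "y' \<in> P" for x y y'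
    unfolding c_def by (rule commutator_class_two[OF P class2]) (use that in auto)
  have c_left: "c (x \<otimes> x') y = c x y \<otimes> c x' y" if "x \<in> P" "x' \<in> P" "y \<in> P" for x x' y
  proof -
    have "c (x \<otimes> x') y = inv (c y (x \<otimes> x'))" using that by (simp add: c_inv)
    also have "\<dots> = inv (c y x') \<otimes> inv (c y x)" using that by (simp add: c_right inv_mult_group)
    also have "\<dots> = c x' y \<otimes> c x y" using that by (simp add: c_inv)
    also have "\<dots> = c x y \<otimes> c x' y" using that by (intro c_central) auto
    finally show ?thesis .
  qed
  have pow_P [simp]: "x [^] (n::nat) \<in> P" if "x \<in> P" for x n
    using that by (induction n) auto
  have central_c: "c z w = \<one> \<and> c w z = \<one>" if z: "z \<in> P" "w \<in> P" "z \<otimes> w = w \<otimes> z" for z w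
  proof -
    have "c z w = (z \<otimes> w) \<otimes> inv w \<otimes> inv z" unfolding c_def z(3) ..
    moreover have "c w z = (w \<otimes> z) \<otimes> inv z \<otimes> inv w" unfolding c_def z(3) ..
    ultimately show ?thesis using z(1,2) by (simp add: m_assoc inv_mult_cancel)
  qed
  have "central_form G P (\<lambda>x y. c x y [^] m)"
  proof unfold_locales
    fix x y assume xy: "x \<in> P" "y \<in> P"
    show "c x y [^] m \<in> P" using xy by simp
    fix w assume w: "w \<in> P"
    show b_central: "c x y [^] m \<otimes> w = w \<otimes> c x y [^] m"
      using xy w by (intro pow_commutes c_central) auto
    show "c (x \<otimes> w) y [^] m = c x y [^] m \<otimes> c w y [^] m"
      unfolding c_left[OF xy(1) w xy(2)] by (rule pow_mult_distrib, rule c_central) (use xy w in auto)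
    show "c x (y \<otimes> w) [^] m = c x y [^] m \<otimes> c x w [^] m"
      unfolding c_right[OF xy w] by (rule pow_mult_distrib, rule c_central) (use xy w in auto)
    show "c (c x y [^] m) w [^] m = \<one>" "c w (c x y [^] m) [^] m = \<one>"
      using central_c[OF _ w b_central] xy by simp_all
  next
    fix x y assume xy: "x \<in> P" "y \<in> P"
    let ?z = "c x y"
    have zP: "?z \<in> P" using xy by simp
    have "?z [^] card P = \<one>" by (rule subgroup_pow_card[OF fin P zP])
    then have "?z [^] (m + m) = ?z"
      unfolding m2 using xy by simp
    then have zz: "?z [^] m \<otimes> ?z [^] m = ?z" using xy by (simp add: nat_pow_mult)
    have "c y x [^] m = inv (?z [^] m)"
      using xy by (simp add: nat_pow_inv flip: c_inv[OF xy])
    then have "?z \<otimes> c y x [^] m = (?z [^] m \<otimes> ?z [^] m) \<otimes> inv (?z [^] m)"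
      by (simp only: zz)
    then have key: "?z \<otimes> c y x [^] m = ?z [^] m"
      using xy by (simp add: m_assoc)
    have "y \<otimes> x = ?z \<otimes> (x \<otimes> y)"
      using xy by (simp add: c_def m_assoc inv_mult_cancel)
    also have "\<dots> = x \<otimes> y \<otimes> ?z" using xy by (intro c_central) auto
    finally have "y \<otimes> x \<otimes> c y x [^] m = x \<otimes> y \<otimes> (?z \<otimes> c y x [^] m)"
      using xy by (simp add: m_assoc)
    then show "x \<otimes> y \<otimes> c x y [^] m = y \<otimes> x \<otimes> c y x [^] m" by (simp add: key)
  qed
  then show ?thesis by (simp add: c_def m_def)
qed

text \<open>
  An element of odd order is a power of its square.
\<close>

lemma (in group) odd_order_commutes_with_square:
  assumes fin: "finite (carrier G)" and H: "subgroup H G" and odd: "odd (card H)"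
    and h: "h \<in> H" and x: "x \<in> carrier G" and comm: "(h \<otimes> h) \<otimes> x = x \<otimes> (h \<otimes> h)"
  shows "h \<otimes> x = x \<otimes> h"
proof -
  have hG: "h \<in> carrier G" using H h subgroup.mem_carrier by fast
  define k where "k = (card H + 1) div 2"
  have k: "2 * k = card H + 1" using odd by (auto simp: k_def elim!: oddE)
  have pow: "(h \<otimes> h) [^] k \<otimes> x = x \<otimes> (h \<otimes> h) [^] k"
    by (rule pow_commutes) (use hG x comm in auto)
  have "(h \<otimes> h) [^] k = h [^] (2 * k)"
    using hG nat_pow_pow[of h 2 k] by (simp add: numeral_2_eq_2)
  also have "\<dots> = h" unfolding k using subgroup_pow_card[OF fin H h] hG by simp
  finally show ?thesis using pow by simp
qed

text \<open>
  The task is to choose one element out of each pair \<open>{x, z x}\<close>, where \<open>z\<close> is the involution of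
  \<open>P\<close>, in a way that \<open>H\<close> preserves; the coboundary of the resulting sign function is the form. No
  \<open>h \<in> H\<close> takes \<open>x\<close> to \<open>z x\<close>: otherwise \<open>h h\<close> would fix \<open>x\<close>, and so would \<open>h\<close>, having odd order.
  Hence the orbits of \<open>x\<close> and \<open>z x\<close> are disjoint, and comparing their least elements decides
  between \<open>x\<close> and \<open>z x\<close> invariantly.
\<close>

lemma central_form_quaternion:
  fixes G :: "nat monoid" (structure)
  assumes "group G" and fin: "finite (carrier G)" and P: "P \<lhd> G"
    and Q8: "G\<lparr>carrier := P\<rparr> \<cong> quaternion_group"
    and H: "subgroup H G" and odd: "odd (card H)"
  shows "\<exists>b. central_form G P b \<and> (\<forall>h\<in>H. \<forall>x\<in>P. \<forall>y\<in>P.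
      h \<otimes> b x y \<otimes> inv h = b (h \<otimes> x \<otimes> inv h) (h \<otimes> y \<otimes> inv h))"
proof -
  interpret group G by fact
  interpret P: normal P G by fact
  interpret H: subgroup H G by fact
  let ?P = "G\<lparr>carrier := P\<rparr>" and ?Q = quaternion_group
  have PG [simp]: "x \<in> carrier G" if "x \<in> P" for x using that by (rule P.mem_carrier)
  have HG [simp]: "x \<in> carrier G" if "x \<in> H" for x using that by (rule H.mem_carrier)
  have finP: "finite P" using fin P.subset finite_subset by blast
  have conjP [simp]: "h \<otimes> x \<otimes> inv h \<in> P" if "h \<in> H" "x \<in> P" for h x
    using that by (intro P.inv_op_closed2) auto
  obtain \<psi> where \<psi>: "\<psi> \<in> iso ?P ?Q" using Q8 by (auto simp: is_iso_def)
  have bij: "bij_betw \<psi> P (carrier ?Q)" using \<psi> by (simp add: iso_def)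
  have \<psi>m: "\<psi> (x \<otimes> y) = hamilton_mult (\<psi> x) (\<psi> y)" if "x \<in> P" "y \<in> P" for x y
    using \<psi> that by (auto simp: iso_def hom_def quaternion_group_def)
  have \<psi>c: "\<psi> x \<in> carrier ?Q" if "x \<in> P" for x
    using bij that bij_betwE by blast
  have \<psi>inj: "s = t" if "\<psi> s = \<psi> t" "s \<in> P" "t \<in> P" for s t
    using bij that by (metis bij_betw_def inj_onD)
  have \<psi>1: "\<psi> \<one> = (1, 0, 0, 0)"
    using hom_one[of \<psi> ?P ?Q] \<psi> group_quaternion_group
      P.subgroup_is_group[OF group_axioms] by (simp add: iso_def quaternion_group_def)
  have "(-1, 0, 0, 0) \<in> carrier ?Q" by (simp add: quaternion_group_def)
  then obtain z where z [simp]: "z \<in> P" and \<psi>z: "\<psi> z = (-1, 0, 0, 0)"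
    using bij by (metis bij_betw_def imageE)
  have z1: "z \<noteq> \<one>" using \<psi>1 \<psi>z by auto
  have zz: "z \<otimes> z = \<one>" by (rule \<psi>inj) (auto simp: \<psi>m \<psi>z \<psi>1)
  have q_comm: "\<forall>q\<in>carrier ?Q. hamilton_mult (-1, 0, 0, 0) q = hamilton_mult q (-1, 0, 0, 0)"
    and q_sq: "\<forall>q\<in>carrier ?Q. hamilton_mult q q = (1, 0, 0, 0) \<longrightarrow> q = (1, 0, 0, 0) \<or> q = (-1, 0, 0, 0)"
    by (simp_all add: quaternion_group_def)
  have z_comm: "z \<otimes> x = x \<otimes> z" if "x \<in> P" for x
    by (rule \<psi>inj) (use that q_comm \<psi>c in \<open>auto simp: \<psi>m \<psi>z\<close>)
  have z_uniq: "x = z" if x: "x \<in> P" "x \<otimes> x = \<one>" "x \<noteq> \<one>" for x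
  proof -
    have "hamilton_mult (\<psi> x) (\<psi> x) = (1, 0, 0, 0)" using x \<psi>m[of x x] \<psi>1 by simp
    moreover have "\<psi> x \<noteq> (1, 0, 0, 0)" using x \<psi>1 \<psi>inj[of x "\<one>"] by auto
    ultimately have "\<psi> x = \<psi> z" using q_sq \<psi>c x \<psi>z by auto
    then show ?thesis using \<psi>inj x by simp
  qed
  have z_conj: "h \<otimes> z \<otimes> inv h = z" if h: "h \<in> H" for h
  proof (rule z_uniq)
    show "(h \<otimes> z \<otimes> inv h) \<otimes> (h \<otimes> z \<otimes> inv h) = \<one>"
      using h zz by (simp flip: conj_mult)
    show "h \<otimes> z \<otimes> inv h \<noteq> \<one>"
    proof
      assume "h \<otimes> z \<otimes> inv h = \<one>"
      then have "h \<otimes> z \<otimes> inv h = h \<otimes> \<one> \<otimes> inv h" using h by simp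
      then have "z = \<one>" using h by (intro conj_inj[of h z "\<one>"]) auto
      then show False using z1 by simp
    qed
  qed (use h in simp)
  have no_flip: "h \<otimes> x \<otimes> inv h \<noteq> z \<otimes> x" if h: "h \<in> H" and x: "x \<in> P" for h x
  proof
    assume eq: "h \<otimes> x \<otimes> inv h = z \<otimes> x"
    have "(h \<otimes> h) \<otimes> x \<otimes> inv (h \<otimes> h) = h \<otimes> (z \<otimes> x) \<otimes> inv h"
      using h x by (simp add: conj_conj eq)
    also have "\<dots> = z \<otimes> (z \<otimes> x)" using h x by (simp add: conj_mult z_conj eq)
    also have "\<dots> = x" using x zz by (simp flip: m_assoc)
    finally have "(h \<otimes> h) \<otimes> x \<otimes> inv (h \<otimes> h) \<otimes> (h \<otimes> h) = x \<otimes> (h \<otimes> h)" by simp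
    then have "(h \<otimes> h) \<otimes> x = x \<otimes> (h \<otimes> h)"
      using h x by (simp add: m_assoc inv_mult_group inv_mult_cancel)
    then have "h \<otimes> x = x \<otimes> h"
      using odd_order_commutes_with_square[OF fin H odd h] x by simp
    then have "h \<otimes> x \<otimes> inv h = x \<otimes> h \<otimes> inv h" by simp
    then have "z \<otimes> x = x" using eq h x by (simp add: m_assoc)
    then show False using z1 x by simp
  qed
  define orb where "orb x = (\<lambda>h. h \<otimes> x \<otimes> inv h) ` H" for x
  \<comment> \<open>Points are natural numbers, so orbits can be compared by their least elements.\<close>
  define \<mu> where "\<mu> x = Min (orb x)" for x
  have fin_orb: "finite (orb x)" for x
    using fin H.subset finite_subset by (auto simp: orb_def)
  have orb_ne: "orb x \<noteq> {}" for x unfolding orb_def using H.one_closed by blast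
  have orb_conj: "orb (h \<otimes> x \<otimes> inv h) = orb x" if h: "h \<in> H" and x: "x \<in> P" for h x
  proof -
    have "orb (k \<otimes> y \<otimes> inv k) \<subseteq> orb y" if k: "k \<in> H" and y: "y \<in> P" for k y
    proof
      fix w assume "w \<in> orb (k \<otimes> y \<otimes> inv k)"
      then obtain l where l: "l \<in> H" "w = l \<otimes> (k \<otimes> y \<otimes> inv k) \<otimes> inv l" by (auto simp: orb_def)
      then have "w = (l \<otimes> k) \<otimes> y \<otimes> inv (l \<otimes> k)" using k y by (simp add: conj_conj)
      then show "w \<in> orb y" using l k by (auto simp: orb_def)
    qed
    note sub = this
    have "orb x = orb (inv h \<otimes> (h \<otimes> x \<otimes> inv h) \<otimes> inv (inv h))"
      using h x by (simp add: conj_cancel)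
    also have "\<dots> \<subseteq> orb (h \<otimes> x \<otimes> inv h)" using h x by (intro sub) auto
    finally show ?thesis using sub[OF h x] by blast
  qed
  have \<mu>_ne: "\<mu> x \<noteq> \<mu> (z \<otimes> x)" if x: "x \<in> P" for x
  proof
    assume "\<mu> x = \<mu> (z \<otimes> x)"
    moreover have mem: "\<mu> w \<in> orb w" for w
      unfolding \<mu>_def by (rule Min_in[OF fin_orb orb_ne])
    ultimately have "\<mu> x \<in> orb x" "\<mu> x \<in> orb (z \<otimes> x)"
      using mem[of x] mem[of "z \<otimes> x"] by simp_all
    then obtain h k where h: "h \<in> H" and k: "k \<in> H"
      and eq: "h \<otimes> x \<otimes> inv h = k \<otimes> (z \<otimes> x) \<otimes> inv k" by (auto simp: orb_def)
    have "(inv k \<otimes> h) \<otimes> x \<otimes> inv (inv k \<otimes> h) = inv k \<otimes> (h \<otimes> x \<otimes> inv h) \<otimes> inv (inv k)"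
      using h k x by (intro conj_conj) auto
    also have "\<dots> = z \<otimes> x" unfolding eq using k x by (simp add: conj_cancel)
    finally show False using no_flip[of "inv k \<otimes> h" x] h k x by simp
  qed
  \<comment> \<open>The second comparison normalizes the sign of the identity to \<open>False\<close>.\<close>
  define \<epsilon> where "\<epsilon> x = ((\<mu> (z \<otimes> x) < \<mu> x) \<noteq> (\<mu> z < \<mu> \<one>))" for x
  have \<epsilon>1: "\<not> \<epsilon> \<one>" by (simp add: \<epsilon>_def)
  have \<epsilon>z: "\<epsilon> (z \<otimes> x) \<longleftrightarrow> \<not> \<epsilon> x" if x: "x \<in> P" for x
  proof -
    have "z \<otimes> (z \<otimes> x) = x" using x zz by (simp flip: m_assoc)
    then show ?thesis using \<mu>_ne[OF x] by (auto simp: \<epsilon>_def)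
  qed
  have \<epsilon>_conj: "\<epsilon> (h \<otimes> x \<otimes> inv h) = \<epsilon> x" if h: "h \<in> H" and x: "x \<in> P" for h x
  proof -
    have "z \<otimes> (h \<otimes> x \<otimes> inv h) = h \<otimes> (z \<otimes> x) \<otimes> inv h"
      using h x by (simp add: conj_mult z_conj)
    then show ?thesis using h x by (simp add: \<epsilon>_def \<mu>_def orb_conj)
  qed
  define e where "e q = \<epsilon> (inv_into P \<psi> q)" for q
  have e\<psi> [simp]: "e (\<psi> x) = \<epsilon> x" if "x \<in> P" for x
    using bij that by (simp add: e_def bij_betw_def)
  have e1: "\<not> e (1, 0, 0, 0)" using e\<psi>[of "\<one>"] \<psi>1 \<epsilon>1 by simp
  have eneg: "\<forall>q\<in>carrier ?Q. e (quaternion_neg q) \<longleftrightarrow> \<not> e q"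
  proof
    fix q assume "q \<in> carrier ?Q"
    then have "q \<in> \<psi> ` P" using bij unfolding bij_betw_def by blast
    then obtain x where x: "x \<in> P" "q = \<psi> x" by blast
    then have "quaternion_neg q = \<psi> (z \<otimes> x)" by (simp add: \<psi>m \<psi>z)
    then show "e (quaternion_neg q) \<longleftrightarrow> \<not> e q" using x \<epsilon>z e\<psi> by simp
  qed
  note form = quaternion_sign_form[OF e1 eneg]
  define \<beta> where "\<beta> x y = (\<epsilon> x = (\<epsilon> y = \<epsilon> (x \<otimes> y)))" for x y
  have \<beta>_left: "\<beta> (x \<otimes> x') y = (\<beta> x y \<noteq> \<beta> x' y)" if "x \<in> P" "x' \<in> P" "y \<in> P" for x x' y
    using form(1)[rule_format, OF that[THEN \<psi>c]] that
    by (simp only: \<beta>_def e\<psi> P.m_closed flip: \<psi>m)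
  have \<beta>_right: "\<beta> x (y \<otimes> y') = (\<beta> x y \<noteq> \<beta> x y')" if "x \<in> P" "y \<in> P" "y' \<in> P" for x y y'
    using form(2)[rule_format, OF that[THEN \<psi>c]] that
    by (simp only: \<beta>_def e\<psi> P.m_closed flip: \<psi>m)
  have \<beta>_central: "\<not> \<beta> z x \<and> \<not> \<beta> x z \<and> \<not> \<beta> \<one> x \<and> \<not> \<beta> x \<one>" if x: "x \<in> P" for x
    using form(3)[rule_format, OF \<psi>c[OF x]] x
    by (simp only: \<beta>_def e\<psi> P.m_closed P.one_closed z flip: \<psi>z \<psi>1 \<psi>m) blast
  define b where "b x y = (if \<beta> x y then z else \<one>)" for x y
  have bP [simp]: "b x y \<in> P" for x y by (simp add: b_def)
  have "x \<otimes> y \<otimes> b x y = y \<otimes> x \<otimes> b y x" if x: "x \<in> P" and y: "y \<in> P" for x y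
  proof -
    have "(if \<beta> x y then \<psi> (z \<otimes> (x \<otimes> y)) else \<psi> (x \<otimes> y))
        = (if \<beta> y x then \<psi> (z \<otimes> (y \<otimes> x)) else \<psi> (y \<otimes> x))"
      using form(4)[rule_format, OF \<psi>c[OF x] \<psi>c[OF y]] x y
      by (simp only: \<beta>_def e\<psi> P.m_closed z flip: \<psi>m \<psi>z)
    then have "\<psi> (if \<beta> x y then z \<otimes> (x \<otimes> y) else x \<otimes> y)
        = \<psi> (if \<beta> y x then z \<otimes> (y \<otimes> x) else y \<otimes> x)"
      by (simp only: if_distrib[of \<psi>])
    then have "(if \<beta> x y then z \<otimes> (x \<otimes> y) else x \<otimes> y) = (if \<beta> y x then z \<otimes> (y \<otimes> x) else y \<otimes> x)"
      by (rule \<psi>inj) (use x y in auto)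
    moreover have "z \<otimes> (x \<otimes> y) = x \<otimes> y \<otimes> z" "z \<otimes> (y \<otimes> x) = y \<otimes> x \<otimes> z"
      using x y by (auto intro!: z_comm)
    ultimately show ?thesis using x y by (simp add: b_def split: if_splits)
  qed
  then have "central_form G P b"
    by unfold_locales
      (auto simp: b_def \<beta>_left \<beta>_right \<beta>_central zz z_comm)
  moreover have "h \<otimes> b x y \<otimes> inv h = b (h \<otimes> x \<otimes> inv h) (h \<otimes> y \<otimes> inv h)"
    if h: "h \<in> H" and x: "x \<in> P" and y: "y \<in> P" for h x y
  proof -
    have "\<beta> (h \<otimes> x \<otimes> inv h) (h \<otimes> y \<otimes> inv h) = \<beta> x y"
      using h x y by (simp add: \<beta>_def \<epsilon>_conj flip: conj_mult)
    then show ?thesis using h by (simp add: b_def z_conj)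
  qed
  ultimately show ?thesis by blast
qed


lemma (in group) conj_commutator:
  assumes "h \<in> carrier G" "x \<in> carrier G" "y \<in> carrier G"
  shows "h \<otimes> (y \<otimes> x \<otimes> inv y \<otimes> inv x) \<otimes> inv h =
    (let x' = h \<otimes> x \<otimes> inv h; y' = h \<otimes> y \<otimes> inv h in y' \<otimes> x' \<otimes> inv y' \<otimes> inv x')"
  using assms by (simp add: Let_def m_assoc inv_mult_group inv_mult_cancel)

lemma (in group) conj_pow:
  assumes "h \<in> carrier G" "x \<in> carrier G"
  shows "h \<otimes> x [^] (n::nat) \<otimes> inv h = (h \<otimes> x \<otimes> inv h) [^] n"
proof (induction n)
  case (Suc n)
  then show ?case using assms by (simp add: conj_mult)
qed (use assms in simp)

section \<open>A cocycle for one prime\<close>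

lemma has_onto_cocycle_normal_sylow:
  fixes G :: "nat monoid" (structure)
  assumes "group G" and fin: "finite (carrier G)" and sol: "solvable G" and p: "prime p"
    and P: "P \<lhd> G" and cP: "card P = p ^ a" and oG: "order G = card P * m" and m: "\<not> p dvd m"
    and type: "brace_type G p P"
  shows "has_onto_cocycle G (card P)"
proof -
  interpret group G by fact
  interpret P: normal P G by fact
  obtain H where H: "subgroup H G" "H \<inter> P = {\<one>}"
    and fac: "\<And>g. g \<in> carrier G \<Longrightarrow> \<exists>x\<in>P. \<exists>h\<in>H. g = x \<otimes> h"
    using normal_sylow_complement[OF assms(1-8)] by blast
  interpret H: subgroup H G by fact
  have class2: "\<forall>x\<in>P. \<forall>y\<in>P. \<forall>w\<in>P.
      (x \<otimes> y \<otimes> inv x \<otimes> inv y) \<otimes> w = w \<otimes> (x \<otimes> y \<otimes> inv x \<otimes> inv y)"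
    using type unfolding brace_type_def by blast
  have "\<exists>b. central_form G P b \<and> (\<forall>h\<in>H. \<forall>x\<in>P. \<forall>y\<in>P.
      h \<otimes> b x y \<otimes> inv h = b (h \<otimes> x \<otimes> inv h) (h \<otimes> y \<otimes> inv h))"
  proof -
    consider "\<forall>x\<in>P. \<forall>y\<in>P. x \<otimes> y = y \<otimes> x" | "odd p" | "G\<lparr>carrier := P\<rparr> \<cong> quaternion_group" "even p"
      using type unfolding brace_type_def by blast
    then show ?thesis
    proof cases
      case 1
      show ?thesis
        using central_form_abelian[OF P.subgroup_axioms 1]
        by (intro exI[of _ "\<lambda>_ _. \<one>"]) (simp add: H.mem_carrier)
    next
      case 2
      then have "odd (card P)" using cP by simp
      from central_form_odd[OF fin P.subgroup_axioms this class2] show ?thesis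
        by (intro exI conjI ballI)
          (assumption, simp only: conj_pow conj_commutator Let_def H.mem_carrier P.mem_carrier m_closed inv_closed)
    next
      case 3
      have "p = 2" using 3(2) p primes_dvd_imp_eq two_is_prime_nat by blast
      obtain K :: "nat monoid" and \<phi> where hom: "group_hom G K \<phi>"
        and surj: "\<phi> ` carrier G = carrier K" and finK: "finite (carrier K)"
        and ker: "\<And>x. x \<in> carrier G \<Longrightarrow> \<phi> x = \<one>\<^bsub>K\<^esub> \<longleftrightarrow> x \<in> P"
        and oGK: "order G = order K * card P"
        using nat_quotient[OF P fin] by metis
      interpret \<phi>: group_hom G K \<phi> by fact
      have "order G > 0" using fin by (simp add: order_gt_0_iff_finite)
      then have oK: "order K = m" using oG oGK by simp
      have "card H = card (\<phi> ` H)"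
        using \<phi>.card_quotient[OF fin H(1) surj ker] H(2) by simp
      also have "\<dots> dvd order K"
        using \<phi>.H.card_subgroup_dvd[OF finK \<phi>.subgroup_img_is_subgroup[OF H(1)] \<phi>.H.subgroup_self]
          surj H.subset by (auto simp: order_def)
      finally have "odd (card H)" using m oK \<open>p = 2\<close> by (metis dvd_trans)
      then show ?thesis
        using central_form_quaternion[OF group_axioms fin P 3(1) H(1)] by blast
    qed
  qed
  then obtain b where b: "central_form G P b"
    and equiv: "\<And>h x y. \<lbrakk>h \<in> H; x \<in> P; y \<in> P\<rbrakk> \<Longrightarrow>
      h \<otimes> b x y \<otimes> inv h = b (h \<otimes> x \<otimes> inv h) (h \<otimes> y \<otimes> inv h)" by blast
  show ?thesis
    by (rule central_form.has_onto_cocycle_of_complement[OF b fin P H fac equiv])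
qed

text \<open>
  This is the kernel of the action of \<open>G\<close> by conjugation on \<open>U\<close> modulo the centre of \<open>U\<close>.
\<close>

lemma (in group) centralizer_mod_center_normal:
  assumes U: "U \<lhd> G"
  shows "{g \<in> carrier G. \<forall>u\<in>U. \<forall>w\<in>U. (u \<otimes> (g \<otimes> inv u \<otimes> inv g)) \<otimes> w = w \<otimes> (u \<otimes> (g \<otimes> inv u \<otimes> inv g))} \<lhd> G"
    (is "?C \<lhd> G")
proof -
  interpret U: normal U G by fact
  have UG [simp]: "x \<in> carrier G" if "x \<in> U" for x using that by (rule U.mem_carrier)
  define Z where "Z = {z \<in> carrier G. \<forall>w\<in>U. z \<otimes> w = w \<otimes> z}"
  interpret Z: normal Z G unfolding Z_def by (rule centralizer_normal[OF U])
  have C_eq: "?C = {g \<in> carrier G. \<forall>u\<in>U. u \<otimes> (g \<otimes> inv u \<otimes> inv g) \<in> Z}"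
    unfolding Z_def by auto
  show ?thesis
    unfolding C_eq normal_inv_iff
  proof (intro conjI ballI)
    show "subgroup {g \<in> carrier G. \<forall>u\<in>U. u \<otimes> (g \<otimes> inv u \<otimes> inv g) \<in> Z} G" (is "subgroup ?D G")
    proof (rule subgroupI)
      fix g assume g: "g \<in> ?D"
      then have gG: "g \<in> carrier G" by simp
      have "u \<otimes> (inv g \<otimes> inv u \<otimes> inv (inv g)) \<in> Z" if u: "u \<in> U" for u
      proof -
        have "inv g \<otimes> inv (u \<otimes> (g \<otimes> inv u \<otimes> inv g)) \<otimes> inv (inv g) \<in> Z"
          using g gG u by (intro Z.inv_op_closed2) auto
        moreover have "inv g \<otimes> inv (u \<otimes> (g \<otimes> inv u \<otimes> inv g)) \<otimes> inv (inv g)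
            = u \<otimes> (inv g \<otimes> inv u \<otimes> inv (inv g))"
          using gG u by (simp add: m_assoc inv_mult_group inv_mult_cancel)
        ultimately show ?thesis by simp
      qed
      then show "inv g \<in> ?D" using gG by blast
      fix h assume h: "h \<in> ?D"
      then have hG: "h \<in> carrier G" by simp
      have "u \<otimes> ((g \<otimes> h) \<otimes> inv u \<otimes> inv (g \<otimes> h)) \<in> Z" if u: "u \<in> U" for u
      proof -
        have "(u \<otimes> (g \<otimes> inv u \<otimes> inv g)) \<otimes> (g \<otimes> (u \<otimes> (h \<otimes> inv u \<otimes> inv h)) \<otimes> inv g) \<in> Z"
          by (rule Z.m_closed[OF _ Z.inv_op_closed2]) (use g h u in auto)
        moreover have "(u \<otimes> (g \<otimes> inv u \<otimes> inv g)) \<otimes> (g \<otimes> (u \<otimes> (h \<otimes> inv u \<otimes> inv h)) \<otimes> inv g)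
            = u \<otimes> ((g \<otimes> h) \<otimes> inv u \<otimes> inv (g \<otimes> h))"
          using gG hG u by (simp add: m_assoc inv_mult_group inv_mult_cancel)
        ultimately show ?thesis by simp
      qed
      then show "g \<otimes> h \<in> ?D" using gG hG by blast
    next
      have "\<one> \<in> ?D" using Z.one_closed by simp
      then show "?D \<noteq> {}" by blast
    qed auto
    fix k g assume k: "k \<in> carrier G" and g: "g \<in> ?D"
    then have gG: "g \<in> carrier G" by simp
    have "u \<otimes> ((k \<otimes> g \<otimes> inv k) \<otimes> inv u \<otimes> inv (k \<otimes> g \<otimes> inv k)) \<in> Z" if u: "u \<in> U" for u
    proof -
      let ?u = "inv k \<otimes> u \<otimes> k"
      have "?u \<in> U" using U.inv_op_closed1 k u by blast
      then have "k \<otimes> (?u \<otimes> (g \<otimes> inv ?u \<otimes> inv g)) \<otimes> inv k \<in> Z"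
        using g k by (intro Z.inv_op_closed2) auto
      moreover have "k \<otimes> (?u \<otimes> (g \<otimes> inv ?u \<otimes> inv g)) \<otimes> inv k
          = u \<otimes> ((k \<otimes> g \<otimes> inv k) \<otimes> inv u \<otimes> inv (k \<otimes> g \<otimes> inv k))"
        using gG k u by (simp add: m_assoc inv_mult_group inv_mult_cancel)
      ultimately show ?thesis by simp
    qed
    then show "k \<otimes> g \<otimes> inv k \<in> ?D" using k gG by blast
  qed
qed

text \<open>
  The image of \<open>P\<close> in \<open>G/U\<close> is a \<open>p\<close>-group, so its order is at most the \<open>p\<close>-part of \<open>|G/U|\<close>. Hence
  \<open>P \<inter> U\<close>, the kernel of \<open>P \<rightarrow> G/U\<close>, has at least \<open>|U|\<close> elements.
\<close>

lemma (in group) normal_prime_power_le_sylow: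
  assumes fin: "finite (carrier G)" and p: "prime p" and P: "subgroup P G" "card P = p ^ a"
    and oG: "order G = p ^ a * m" "\<not> p dvd m" and U: "U \<lhd> G" "card U = p ^ e"
  shows "U \<subseteq> P"
proof -
  interpret U: normal U G by fact
  interpret P: subgroup P G by fact
  obtain K :: "nat monoid" and \<phi> where hom: "group_hom G K \<phi>"
    and surj: "\<phi> ` carrier G = carrier K" and finK: "finite (carrier K)"
    and ker: "\<And>x. x \<in> carrier G \<Longrightarrow> \<phi> x = \<one>\<^bsub>K\<^esub> \<longleftrightarrow> x \<in> U"
    and oK: "order G = order K * p ^ e"
    using nat_quotient[OF U(1) fin] U(2) by metis
  interpret \<phi>: group_hom G K \<phi> by fact
  have p0: "p > 0" using p prime_gt_0_nat by blast
  have eqP: "p ^ a = card (\<phi> ` P) * card (P \<inter> U)"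
    using \<phi>.card_quotient[OF fin P(1) surj ker] P(2) by simp
  then obtain i where i: "card (\<phi> ` P) = p ^ i"
    using p divides_primepow_nat by (metis dvd_triv_left)
  have "card (\<phi> ` P) dvd order K"
    using \<phi>.H.card_subgroup_dvd[OF finK \<phi>.subgroup_img_is_subgroup[OF P(1)] \<phi>.H.subgroup_self]
      surj P.subset by (auto simp: order_def)
  then have "p ^ i * p ^ e dvd p ^ a * m" using oK oG(1) i by (metis dvd_refl mult_dvd_mono)
  then have "p ^ (i + e) dvd p ^ a * m" by (simp add: power_add)
  moreover have "coprime (p ^ (i + e)) m" using p oG(2) by (simp add: prime_imp_coprime)
  ultimately have "p ^ (i + e) dvd p ^ a" by (simp add: coprime_dvd_mult_left_iff)
  then have "p ^ (i + e) \<le> p ^ a" using p0 by (simp add: dvd_imp_le del: power_dvd_imp_le)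
  then have "p ^ i * p ^ e \<le> p ^ i * card (P \<inter> U)"
    unfolding eqP i by (simp only: power_add)
  then have "card U \<le> card (P \<inter> U)" using p0 U(2) by simp
  moreover have "finite U" using fin U.subset finite_subset by blast
  ultimately have "P \<inter> U = U" by (intro card_seteq) auto
  then show ?thesis by blast
qed


text \<open>
  Both ways of passing to a smaller group in the induction are quotients, by a normal subgroup \<open>N\<close>
  of order prime to \<open>p\<close> or by a \<open>p\<close>-subgroup \<open>N = A\<close> of \<open>P\<close>. In either case \<open>P \<inter> N\<close> is the
  \<open>p\<close>-part of \<open>N\<close>, and this is what the local fact \<open>quotient\<close> assumes.
\<close>

lemma prime_part_cocycle_step:
  fixes G :: "nat monoid" (structure)
  assumes "group G" and fin: "finite (carrier G)" and sol: "solvable G" and p: "prime p"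
    and P: "subgroup P G" and cP: "card P = p ^ a" and oG: "order G = p ^ a * m"
    and m: "\<not> p dvd m" and type: "brace_type G p P"
    and IH: "\<And>(K :: nat monoid) Q b n. \<lbrakk>order K < order G; group K; finite (carrier K); solvable K;
      prime p; subgroup Q K; card Q = p ^ b; order K = p ^ b * n; \<not> p dvd n; brace_type K p Q\<rbrakk>
      \<Longrightarrow> has_onto_cocycle K (p ^ b)"
  shows "has_onto_cocycle G (p ^ a)"
proof -
  interpret group G by fact
  interpret P: subgroup P G by fact
  have PG [simp]: "x \<in> carrier G" if "x \<in> P" for x using that by (rule P.mem_carrier)
  have p0: "p > 0" using p prime_gt_0_nat by blast
  have oG0: "order G > 0" using fin by (simp add: order_gt_0_iff_finite)
  have quotient: "\<exists>(K :: nat monoid) \<phi> b. group_hom G K \<phi> \<and> \<phi> ` carrier G = carrier K \<and>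
      (\<forall>x\<in>carrier G. \<phi> x = \<one>\<^bsub>K\<^esub> \<longleftrightarrow> x \<in> N) \<and>
      has_onto_cocycle K (p ^ b) \<and> p ^ a = p ^ b * card (P \<inter> N)"
    if N: "N \<lhd> G" "N \<noteq> {\<one>}" and cN: "card N = card (P \<inter> N) * n" "\<not> p dvd n" for N n
  proof -
    interpret N: normal N G by fact
    obtain K :: "nat monoid" and \<phi> where hom: "group_hom G K \<phi>"
      and surj: "\<phi> ` carrier G = carrier K" and finK: "finite (carrier K)"
      and ker: "\<And>x. x \<in> carrier G \<Longrightarrow> \<phi> x = \<one>\<^bsub>K\<^esub> \<longleftrightarrow> x \<in> N"
      and oK: "order G = order K * card N"
      using nat_quotient[OF N(1) fin] by metis
    interpret \<phi>: group_hom G K \<phi> by fact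
    have eqP: "p ^ a = card (\<phi> ` P) * card (P \<inter> N)"
      using \<phi>.card_quotient[OF fin P surj ker] cP by simp
    then obtain b where b: "card (\<phi> ` P) = p ^ b"
      using p divides_primepow_nat by (metis dvd_triv_left)
    have PN0: "card (P \<inter> N) > 0" using eqP p0 by (metis gr0I mult_0_right power_not_zero less_numeral_extra(3))
    have "card N \<noteq> 1"
      using N(2) N.one_closed by (metis card_1_singletonE singletonD)
    moreover have "card N > 0"
      using oK oG0 by (metis gr0I mult_0_right less_numeral_extra(3))
    ultimately have less_K: "order K < order G" using oK oG0 by simp
    have Psub: "subgroup (\<phi> ` P) K" by (rule \<phi>.subgroup_img_is_subgroup[OF P])
    have "p ^ b dvd order K"
      using \<phi>.H.card_subgroup_dvd[OF finK Psub \<phi>.H.subgroup_self] surj P.subset b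
      by (auto simp: order_def)
    then obtain m' where m': "order K = p ^ b * m'" by blast
    have "(p ^ b * card (P \<inter> N)) * m = (p ^ b * card (P \<inter> N)) * (m' * n)"
    proof -
      have "(p ^ b * card (P \<inter> N)) * m = order G" using oG eqP b by simp
      also have "\<dots> = (p ^ b * card (P \<inter> N)) * (m' * n)" using oK m' cN(1) by simp
      finally show ?thesis .
    qed
    moreover have "p ^ b * card (P \<inter> N) > 0" using p0 PN0 by simp
    ultimately have "m = m' * n" by (metis mult_left_cancel less_numeral_extra(3))
    then have ndvd: "\<not> p dvd m'" using m by auto
    have "has_onto_cocycle K (p ^ b)"
      by (rule IH[OF less_K \<phi>.H.group_axioms finK \<phi>.surj_hom_imp_solvable[OF surj sol] p
            Psub b m' ndvd brace_type_image[OF hom P type]])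
    then show ?thesis using hom surj ker eqP b by auto
  qed
  show ?thesis
  proof (cases "\<exists>N. N \<lhd> G \<and> N \<noteq> {\<one>} \<and> \<not> p dvd card N")
    case True
    then obtain N where N: "N \<lhd> G" "N \<noteq> {\<one>}" "\<not> p dvd card N" by blast
    have sub: "subgroup (P \<inter> N) G"
      using subgroups_Inter_pair P normal_imp_subgroup[OF N(1)] by blast
    have "card (P \<inter> N) dvd p ^ a" "card (P \<inter> N) dvd card N"
      using card_subgroup_dvd[OF fin sub P] card_subgroup_dvd[OF fin sub normal_imp_subgroup[OF N(1)]] cP
      by auto
    moreover have "coprime (p ^ a) (card N)" using p N(3) by (simp add: prime_imp_coprime)
    ultimately have "card (P \<inter> N) = 1" by (metis coprime_common_divisor_nat)
    then show ?thesis
      using quotient[OF N(1,2), of "card N"] N(3) has_onto_cocycle_pullback by fastforce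
  next
    case False
    then have no_p': "N = {\<one>}" if "N \<lhd> G" "\<not> p dvd card N" for N using that by blast
    \<comment> \<open>\<open>U\<close> is the largest normal \<open>p\<close>-subgroup; any normal \<open>p\<close>-subgroup of greatest order will do.\<close>
    define S where "S V \<longleftrightarrow> V \<lhd> G \<and> (\<exists>e. card V = p ^ e)" for V
    have "S {\<one>}"
      unfolding S_def normal_inv_iff
      by (intro conjI triv_subgroup exI[of _ 0]) auto
    moreover have "\<forall>V. S V \<longrightarrow> card V < order G + 1"
      unfolding S_def order_def
      using card_mono[OF fin subgroup.subset[OF normal_imp_subgroup]] by (auto simp: less_Suc_eq_le)
    ultimately obtain U where U: "S U" and max: "\<And>V. S V \<Longrightarrow> card V \<le> card U"
      using ex_has_greatest_nat[of S "{\<one>}" card "order G + 1"] by blast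
    obtain e where Un: "U \<lhd> G" and cU: "card U = p ^ e" using U by (auto simp: S_def)
    interpret U: normal U G by fact
    have UP: "U \<subseteq> P" by (rule normal_prime_power_le_sylow[OF fin p P cP oG m Un cU])
    define C where "C = {g \<in> carrier G. \<forall>u\<in>U. \<forall>w\<in>U.
        (u \<otimes> (g \<otimes> inv u \<otimes> inv g)) \<otimes> w = w \<otimes> (u \<otimes> (g \<otimes> inv u \<otimes> inv g))}"
    have C: "C \<lhd> G" unfolding C_def by (rule centralizer_mod_center_normal[OF Un])
    have class2: "(x \<otimes> y \<otimes> inv x \<otimes> inv y) \<otimes> w = w \<otimes> (x \<otimes> y \<otimes> inv x \<otimes> inv y)"
      if "x \<in> P" "y \<in> P" "w \<in> P" for x y w
      using type that unfolding brace_type_def by blast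
    have PC: "P \<subseteq> C"
    proof
      fix g assume g: "g \<in> P"
      have "(u \<otimes> (g \<otimes> inv u \<otimes> inv g)) \<otimes> w = w \<otimes> (u \<otimes> (g \<otimes> inv u \<otimes> inv g))"
        if "u \<in> U" "w \<in> U" for u w
      proof -
        have uw: "u \<in> P" "w \<in> P" using that UP by auto
        have "u \<otimes> (g \<otimes> inv u \<otimes> inv g) = u \<otimes> g \<otimes> inv u \<otimes> inv g"
          using g uw by (simp add: m_assoc)
        then show ?thesis using class2[OF uw(1) g uw(2)] by simp
      qed
      then show "g \<in> C" using g unfolding C_def by simp
    qed
    show ?thesis
    proof (cases "C \<subseteq> U")
      case True
      then have "P = U" using PC UP by blast
      then have "P \<lhd> G" using Un by simp
      from has_onto_cocycle_normal_sylow[OF group_axioms fin sol p this cP _ m type]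
      show ?thesis using oG cP by simp
    next
      case False
      then have "U \<subset> C" using UP PC by blast
      then obtain T q k where T: "T \<lhd> G" "U \<subseteq> T" "T \<subseteq> C" "prime q" "k > 0" "card T = card U * q ^ k"
        using normal_subgroup_prime_power_step[OF fin sol Un C] by blast
      have U0: "card U > 0" using cU p0 by simp
      have qk: "q ^ k > 1" using one_less_power[OF prime_gt_1_nat[OF T(4)] T(5)] .
      have "q \<noteq> p"
      proof
        assume "q = p"
        then have "S T" using T(1,6) cU by (auto simp: S_def power_add[symmetric])
        then have "card T \<le> card U" by (rule max)
        then show False using T(6) U0 qk by simp
      qed
      then have ndvd: "\<not> q dvd card U" and pq: "\<not> p dvd q ^ k"
        using cU p T(4) by (metis prime_dvd_power primes_dvd_imp_eq)+
      obtain Q where Q: "subgroup Q G" "Q \<subseteq> T" "card Q = q ^ k" and QU: "Q \<inter> U = {\<one>}"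
        and fr: "\<And>g. g \<in> carrier G \<Longrightarrow> \<exists>u\<in>U. \<exists>h\<in>conj_normalizer G Q. g = u \<otimes> h"
        using frattini_sylow[OF fin T(4,1) Un T(2,6) ndvd] by metis
      have pQ: "\<not> p dvd card Q" using pq Q(3) by simp
      have cen: "(u \<otimes> (y \<otimes> inv u \<otimes> inv y)) \<otimes> w = w \<otimes> (u \<otimes> (y \<otimes> inv u \<otimes> inv y))"
        if "u \<in> U" "y \<in> Q" "w \<in> U" for u y w
        using that Q(2) T(3) unfolding C_def by blast
      obtain A act \<delta> where A: "A \<lhd> G" "A \<subseteq> U" "cocycle G (G\<lparr>carrier := A\<rparr>) act \<delta>" "\<delta> ` A = A"
        and triv: "\<And>a m. \<lbrakk>a \<in> A; m \<in> A\<rbrakk> \<Longrightarrow> act a m = m"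
        and comm: "\<And>u y. \<lbrakk>A = {\<one>}; u \<in> U; y \<in> Q\<rbrakk> \<Longrightarrow> u \<otimes> y = y \<otimes> u"
        by (rule central_commutator_cocycle[OF fin Un p cU Q(1) pQ fr QU cen]) (assumption | blast)+
      have "A \<noteq> {\<one>}"
      proof
        assume A1: "A = {\<one>}"
        interpret Q: subgroup Q G by fact
        have "Q \<lhd> G"
          unfolding normal_inv_iff
        proof (intro conjI ballI Q(1))
          fix g y assume g: "g \<in> carrier G" and y: "y \<in> Q"
          obtain u h where u: "u \<in> U" and h: "h \<in> conj_normalizer G Q" and gh: "g = u \<otimes> h"
            using fr[OF g] by blast
          have uG: "u \<in> carrier G" and hG: "h \<in> carrier G" and yG: "y \<in> carrier G"
            using u h y U.mem_carrier Q.mem_carrier by (simp_all add: conj_normalizer_def)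
          have hy: "h \<otimes> y \<otimes> inv h \<in> Q" using h y unfolding conj_normalizer_def by blast
          have "g \<otimes> y \<otimes> inv g = u \<otimes> (h \<otimes> y \<otimes> inv h) \<otimes> inv u"
            unfolding gh by (rule conj_conj[OF uG hG yG])
          also have "u \<otimes> (h \<otimes> y \<otimes> inv h) = (h \<otimes> y \<otimes> inv h) \<otimes> u" by (rule comm[OF A1 u hy])
          also have "(h \<otimes> y \<otimes> inv h) \<otimes> u \<otimes> inv u = h \<otimes> y \<otimes> inv h"
            using uG hG yG by (simp add: m_assoc)
          finally show "g \<otimes> y \<otimes> inv g \<in> Q" using hy by simp
        qed
        then have "Q = {\<one>}" using no_p' pQ by blast
        then show False using Q(3) qk by simp
      qed
      note An1 = this
      have PA: "P \<inter> A = A" using A(2) UP by blast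
      have "card A = card (P \<inter> A) * 1" "\<not> p dvd 1" using PA p by auto
      from quotient[OF A(1) An1 this, unfolded PA]
      obtain K :: "nat monoid" and \<phi> b where K: "group_hom G K \<phi>" "\<phi> ` carrier G = carrier K"
        and ker: "\<And>x. x \<in> carrier G \<Longrightarrow> \<phi> x = \<one>\<^bsub>K\<^esub> \<longleftrightarrow> x \<in> A"
        and cK: "has_onto_cocycle K (p ^ b)" and pab: "p ^ a = p ^ b * card A"
        by blast
      have AG: "A \<subseteq> carrier G" using A(2) U.subset by blast
      have finA: "finite A" using AG fin finite_subset by blast
      have "has_onto_cocycle G (card (carrier (G\<lparr>carrier := A\<rparr>)) * p ^ b)"
        by (rule has_onto_cocycle_extend[OF A(3) _ K AG _ _ _ cK])
          (use finA A(4) triv ker AG in auto)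
      then show ?thesis using pab by (simp add: mult.commute)
    qed
  qed
qed

lemma prime_part_cocycle:
  fixes G :: "nat monoid"
  assumes "group G" "finite (carrier G)" "solvable G" "prime p"
    and "subgroup P G" "card P = p ^ a" "order G = p ^ a * m" "\<not> p dvd m" "brace_type G p P"
  shows "has_onto_cocycle G (p ^ a)"
  using assms
proof (induction "order G" arbitrary: G P a m rule: less_induct)
  case less
  show ?case
    by (rule prime_part_cocycle_step[OF less.prems]) (rule less.hyps)
qed

section \<open>Soluble groups with quaternion Sylow 2-subgroups\<close>

lemma brace_type_of_sylow:
  fixes G (structure)
  assumes "group G" and P: "subgroup P G" and nil: "nilpotent_class_le (G\<lparr>carrier := P\<rparr>) 2"
    and alt: "odd p \<or> G\<lparr>carrier := P\<rparr> \<cong> quaternion_group"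
  shows "brace_type G p P"
proof -
  interpret group G by fact
  interpret P: subgroup P G by fact
  let ?P = "G\<lparr>carrier := P\<rparr>"
  have PG [simp]: "x \<in> carrier G" if "x \<in> P" for x using that by (rule P.mem_carrier)
  have inv_P: "inv\<^bsub>?P\<^esub> x = inv x" if "x \<in> P" for x
    using m_inv_consistent[OF P that] by simp
  let ?c = "\<lambda>x y. x \<otimes> y \<otimes> inv x \<otimes> inv y"
  have "?c x y \<otimes> w = w \<otimes> ?c x y" if x: "x \<in> P" and y: "y \<in> P" and w: "w \<in> P" for x y w
  proof -
    have c: "?c x y \<in> P" using x y by simp
    have comm_mem: "a \<otimes> b \<otimes> inv a \<otimes> inv b \<in> commutator_subgroup ?P A B"
      if "a \<in> A" "b \<in> B" "a \<in> P" "b \<in> P" for a b A B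
    proof -
      have "a \<otimes>\<^bsub>?P\<^esub> b \<otimes>\<^bsub>?P\<^esub> inv\<^bsub>?P\<^esub> a \<otimes>\<^bsub>?P\<^esub> inv\<^bsub>?P\<^esub> b \<in> commutator_subgroup ?P A B"
        unfolding commutator_subgroup_def by (rule generate.incl) (use that in blast)
      then show ?thesis using inv_P that by simp
    qed
    have "?c x y \<in> lower_central ?P (Suc 0)"
      using comm_mem[of x P y P] x y by simp
    then have "?c (?c x y) w \<in> commutator_subgroup ?P (lower_central ?P (Suc 0)) P"
      using comm_mem[of "?c x y" "lower_central ?P (Suc 0)" w P] c w by blast
    then have "?c (?c x y) w \<in> lower_central ?P 2"
      by (simp add: numeral_2_eq_2)
    then have one: "?c (?c x y) w = \<one>" using nil by (simp add: nilpotent_class_le_def)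
    have "?c x y \<otimes> w = ?c (?c x y) w \<otimes> (w \<otimes> ?c x y)"
      using c w x y by (simp add: m_assoc inv_mult_group inv_mult_cancel)
    then show ?thesis unfolding one using c w by simp
  qed
  then show ?thesis using alt unfolding brace_type_def by blast
qed

theorem theorem2:
  fixes G :: "('a, 'b) monoid_scheme"
  assumes "group G"
    and "finite (carrier G)"
    and "solvable G"
    and "\<And>p P. sylow_subgroup G p P \<Longrightarrow> nilpotent_class_le (G\<lparr>carrier := P\<rparr>) 2"
    and "\<And>P. sylow_subgroup G 2 P \<Longrightarrow> G\<lparr>carrier := P\<rparr> \<cong> quaternion_group"
  shows "iyb_group TYPE(nat) G"
proof -
  interpret group G by fact
  obtain K :: "nat monoid" and f where K: "group K" and f: "f \<in> iso G K"
    using finite_group_iso_nat[OF assms(1,2)] by blast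
  interpret K: group K by fact
  interpret f: group_hom G K f
    using f by unfold_locales (simp add: iso_def)
  have bij: "bij_betw f (carrier G) (carrier K)" using f by (simp add: iso_def)
  have finK: "finite (carrier K)" using bij assms(2) bij_betw_finite by blast
  have solK: "solvable K"
    using f.surj_hom_imp_solvable assms(3) bij by (simp add: bij_betw_def)
  have oGK: "order G = order K" using bij by (simp add: order_def bij_betw_same_card)
  have oG0: "order G > 0" using assms(2) by (simp add: order_gt_0_iff_finite)
  have "has_onto_cocycle K (p ^ multiplicity p (order K))" if p: "prime p" for p
  proof -
    let ?a = "multiplicity p (order G)"
    obtain m where m: "order G = p ^ ?a * m" using multiplicity_dvd by blast
    obtain P where P: "subgroup P G" "card P = p ^ ?a"
      using sylow_thm[OF p assms(1) m assms(2)] by blast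
    then have syl: "sylow_subgroup G p P" using p by (simp add: sylow_subgroup_def)
    have "odd p \<or> G\<lparr>carrier := P\<rparr> \<cong> quaternion_group"
      using assms(5) syl p primes_dvd_imp_eq two_is_prime_nat by blast
    then have "brace_type G p P"
      by (rule brace_type_of_sylow[OF assms(1) P(1) assms(4)[OF syl]])
    then have type: "brace_type K p (f ` P)"
      by (rule brace_type_image[OF f.group_hom_axioms P(1)])
    have "inj_on f P"
      using bij subgroup.subset[OF P(1)] by (meson bij_betw_def inj_on_subset)
    then have cP: "card (f ` P) = p ^ ?a" using P(2) by (simp add: card_image)
    show ?thesis
      using prime_part_cocycle[OF K finK solK p f.subgroup_img_is_subgroup[OF P(1)] cP _ _ type, of m]
        m not_dvd_multiplicity_quotient[OF p oG0 m] by (simp flip: oGK)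
  qed
  then obtain M :: "nat monoid" and act \<pi> where
    M: "cocycle K M act \<pi>" "bij_betw \<pi> (carrier K) (carrier M)"
    using bijective_cocycle_from_prime_parts[OF K finK] by blast
  have "iyb_group TYPE(nat) K"
    by (rule iyb_group_of_bijective_cocycle[OF M(1) finK M(2)])
  moreover have "G \<cong> K" using f by (auto simp: is_iso_def)
  ultimately show ?thesis unfolding iyb_group_def using iso_trans by blast
qed

end
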